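(* Let $\tau$ be a continuous language (functions and relations required only to be continuous, not necessarily uniformly continuous), with function symbols $F_i$ ($i<n_F$) and relation symbols $R_j$ ($j<n_R$), where the metric $d$ is counted among the relation symbols. Then there is a discrete language $\tau^+$, containing function symbols $F_i^+$ and relation symbols $R_{R_j(\mathbf{z})\geq r}$, $R_{R_j(\mathbf{z})\leq r}$ for $j<n_R$, $r\in\mathbb{Q}'$, such that for every Metric Abstract Elementary Class $K$ with $\tau(K)=\tau$ there are: (i) an Abstract Elementary Class $K_{dense}$ with $\tau(K_{dense}) = \tau^+$ and $LS(K_{dense}) = LS(K)$; (ii) a map assigning to each $M\in K$ and each nicely dense $A\subseteq |M|$ a structure $M_A \in K_{dense}$; (iii) a map assigning to each $\mathcal{A}\in K_{dense}$ a structure $\overline{\mathcal{A}}\in K$, with the following properties: (1) $M_A$ has universe $A$, and for each tuple $\mathbf{a}$ from $A$, each $j<n_R$, $r\in\mathbb{Q}'$ and $\square\in\{\leq,\geq\}$: $M_A\models R_{R_j(\mathbf{z})\square r}[\mathbf{a}]$ iff $R_j^M(\mathbf{a})\,\square\, r$; (2) for $\mathcal{A}\in K_{dense}$ with universe $A$, the universe of $\overline{\mathcal{A}}$ is the completion of $A$ with respect to the metric $D(a,b) := \sup\{r\in\mathbb{Q}' : \mathcal{A}\models R_{d(x,y)\geq r}[a,b]\}$, and for each tuple $\mathbf{a}$ from $A$, each $j<n_R$, $r\in\mathbb{Q}'$ and $\square\in\{\leq,\geq\}$: $R_j^{\overline{\mathcal{A}}}(\mathbf{a})\,\square\, r$ iff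 $\mathcal{A}\models R_{R_j(\mathbf{z})\square r}[\mathbf{a}]$; (3) the maps are essentially inverse: for $M\in K$ and nicely dense $A\subseteq|M|$ there is an isomorphism $M\cong \overline{M_A}$ fixing $A$ pointwise, and for $\mathcal{A}\in K_{dense}$ with universe $A$ we have $(\overline{\mathcal{A}})_A = \mathcal{A}$; (4) if $M_\ell\in K$ and $A_\ell$ is nicely dense in $M_\ell$ for $\ell=0,1$, and $f:M_0\to M_1$ is a $K$-embedding with $f(A_0)\subseteq A_1$, then $f\restriction A_0$ is a $K_{dense}$-embedding from $(M_0)_{A_0}$ to $(M_1)_{A_1}$; and if $\mathcal{A},\mathcal{B}\in K_{dense}$ and $f:\mathcal{A}\to\mathcal{B}$ is a $K_{dense}$-embedding, then $f$ extends canonically (by continuity) to a $K$-embedding $\overline{f}:\overline{\mathcal{A}}\to\overline{\mathcal{B}}$.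
   Context: $\mathbb{Q}' := \mathbb{Q}\cap[0,1]$. A continuous $\tau$-structure is a complete metric space with continuous interpretations of the function symbols and continuous $[0,1]$-valued interpretations of the relation symbols. For a continuous structure $M$, $A\subseteq |M|$ is nicely dense if $A$ is dense in $(|M|,d^M)$ and closed under the functions of $M$; $dc(M)$ is the density character. A Metric Abstract Elementary Class (MAEC, Hirvonen–Hyttinen) is a class $K$ of continuous $\tau(K)$-structures with a relation $\prec_K$ such that: $\prec_K$ is a partial order; $M\prec_K N$ implies $M$ is a substructure of $N$; $K$ and $\prec_K$ are closed under isomorphisms; (coherence) if $M_0\prec_K M_2$, $M_1\prec_K M_2$ and $M_0\subseteq M_1$ then $M_0\prec_K M_1$; (chains) if $\langle M_i : i<\alpha\rangle$ is a $\prec_K$-increasing continuous chain then $\overline{\bigcup_i M_i}\in K$ (metric completion of the union), each $M_i\prec_K \overline{\bigcup_i M_i}$, and if $M_i\prec_K N$ for all $i$ then $\overline{\bigcup_i M_i}\prec_K N$; (Löwenheim–Skolem) there is a least infinite cardinal $LS(K)\ge|\tau(K)|$ such that for all $M\in K$ and $A\subseteq|M|$ there is $N\prec_K M$ with $A\subseteq |N|$ and $dc(N)\le |A|+LS(K)$. Abstract Elementary Classes (AECs) are in the sense of Shelah. A $K$-embedding $f:M\to N$ is an isomorphism of $M$ onto some $f[M]\prec_K N$; similarly for $K_{dense}$-embeddings with the strong substructure relation of $K_{dense}$. *)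

theory Defs
  imports "HOL-Analysis.Analysis"
begin

unbundle cardinal_syntax

text \<open>
  The type \<open>'v\<close> plays the role of the set-theoretic universe: the ``sets'' are its subsets of
  cardinality strictly below that of \<open>'v\<close>, every structure has such a small universe, and
  a ``class'' of structures is an arbitrary set of structures. If the cardinality of \<open>'v\<close> is
  inaccessible, the small sets behave like the members of a Grothendieck universe; the only
  closure property needed for metric completions to exist is that countable sequences in a small
  set form a small set.
\<close>

definition small :: "'v set \<Rightarrow> bool" where
  "small A \<longleftrightarrow> |A| <o |UNIV :: 'v set|"

section \<open>Languages and structures\<close>

record ('f, 'r) lang =
  fsyms :: "'f set"
  rsyms :: "'r set"
  farity :: "'f \<Rightarrow> nat"
  rarity :: "'r \<Rightarrow> nat"

text \<open>A continuous language has a distinguished binary relation symbol for the metric.\<close>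

record ('f, 'r) clang = "('f, 'r) lang" +
  dsym :: 'r

definition continuous_lang :: "('f, 'r) clang \<Rightarrow> bool" where
  "continuous_lang \<tau> \<longleftrightarrow> dsym \<tau> \<in> rsyms \<tau> \<and> rarity \<tau> (dsym \<tau>) = 2"

text \<open>
  Relation symbols take values in \<open>'b\<close>, which is \<open>bool\<close> for discrete structures and \<open>real\<close> for
  continuous ones.
\<close>

record ('v, 'f, 'r, 'b) struct =
  univ :: "'v set"
  fn :: "'f \<Rightarrow> 'v list \<Rightarrow> 'v"
  rl :: "'r \<Rightarrow> 'v list \<Rightarrow> 'b"

type_synonym ('v, 'f, 'r) dstruct = "('v, 'f, 'r, bool) struct"
type_synonym ('v, 'f, 'r) cstruct = "('v, 'f, 'r, real) struct"

definition tuples :: "nat \<Rightarrow> 'v set \<Rightarrow> 'v list set" where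
  "tuples n A = {xs. length xs = n \<and> set xs \<subseteq> A}"

text \<open>
  Interpretations are \<open>undefined\<close> outside their domain, so that equality of structures in HOL is
  equality of the underlying mathematical structures.
\<close>

definition is_structure ::
    "('f, 'r, 'z) lang_scheme \<Rightarrow> ('v, 'f, 'r, 'b) struct \<Rightarrow> bool" where
  "is_structure \<tau> M \<longleftrightarrow>
     univ M \<noteq> {} \<and> small (univ M) \<and>
     (\<forall>F\<in>fsyms \<tau>. \<forall>xs\<in>tuples (farity \<tau> F) (univ M). fn M F xs \<in> univ M) \<and>
     (\<forall>F xs. \<not> (F \<in> fsyms \<tau> \<and> xs \<in> tuples (farity \<tau> F) (univ M)) \<longrightarrow> fn M F xs = undefined) \<and>
     (\<forall>R xs. \<not> (R \<in> rsyms \<tau> \<and> xs \<in> tuples (rarity \<tau> R) (univ M)) \<longrightarrow> rl M R xs = undefined)"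

definition substructure ::
    "('f, 'r, 'z) lang_scheme \<Rightarrow> ('v, 'f, 'r, 'b) struct \<Rightarrow> ('v, 'f, 'r, 'b) struct \<Rightarrow> bool" where
  "substructure \<tau> M N \<longleftrightarrow>
     is_structure \<tau> M \<and> is_structure \<tau> N \<and> univ M \<subseteq> univ N \<and>
     (\<forall>F\<in>fsyms \<tau>. \<forall>xs\<in>tuples (farity \<tau> F) (univ M). fn M F xs = fn N F xs) \<and>
     (\<forall>R\<in>rsyms \<tau>. \<forall>xs\<in>tuples (rarity \<tau> R) (univ M). rl M R xs = rl N R xs)"

definition isomorphism ::
    "('f, 'r, 'z) lang_scheme \<Rightarrow> ('v \<Rightarrow> 'v) \<Rightarrow> ('v, 'f, 'r, 'b) struct \<Rightarrow> ('v, 'f, 'r, 'b) struct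
      \<Rightarrow> bool" where
  "isomorphism \<tau> g M N \<longleftrightarrow>
     bij_betw g (univ M) (univ N) \<and>
     (\<forall>F\<in>fsyms \<tau>. \<forall>xs\<in>tuples (farity \<tau> F) (univ M). g (fn M F xs) = fn N F (map g xs)) \<and>
     (\<forall>R\<in>rsyms \<tau>. \<forall>xs\<in>tuples (rarity \<tau> R) (univ M). rl M R xs = rl N R (map g xs))"

section \<open>Continuous structures\<close>

text \<open>
  \<^locale>\<open>Metric_space\<close> requires a nonnegative symmetric function on the whole type, hence the
  value 0 off the universe.
\<close>

definition sdist :: "('f, 'r) clang \<Rightarrow> ('v, 'f, 'r) cstruct \<Rightarrow> 'v \<Rightarrow> 'v \<Rightarrow> real" where
  "sdist \<tau> M x y = (if x \<in> univ M \<and> y \<in> univ M then rl M (dsym \<tau>) [x, y] else 0)"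

definition stop :: "('f, 'r) clang \<Rightarrow> ('v, 'f, 'r) cstruct \<Rightarrow> 'v topology" where
  "stop \<tau> M = Metric_space.mtopology (univ M) (sdist \<tau> M)"

definition tuple_top :: "('f, 'r) clang \<Rightarrow> ('v, 'f, 'r) cstruct \<Rightarrow> nat \<Rightarrow> (nat \<Rightarrow> 'v) topology" where
  "tuple_top \<tau> M n = product_topology (\<lambda>_. stop \<tau> M) {..<n}"

definition is_cstructure :: "('f, 'r) clang \<Rightarrow> ('v, 'f, 'r) cstruct \<Rightarrow> bool" where
  "is_cstructure \<tau> M \<longleftrightarrow>
     is_structure \<tau> M \<and>
     (\<forall>R\<in>rsyms \<tau>. \<forall>xs\<in>tuples (rarity \<tau> R) (univ M). rl M R xs \<in> {0..1}) \<and>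
     Metric_space (univ M) (sdist \<tau> M) \<and>
     Metric_space.mcomplete (univ M) (sdist \<tau> M) \<and>
     (\<forall>F\<in>fsyms \<tau>. continuous_map (tuple_top \<tau> M (farity \<tau> F)) (stop \<tau> M)
        (\<lambda>t. fn M F (map t [0..<farity \<tau> F]))) \<and>
     (\<forall>R\<in>rsyms \<tau>. continuous_map (tuple_top \<tau> M (rarity \<tau> R)) euclideanreal
        (\<lambda>t. rl M R (map t [0..<rarity \<tau> R])))"

definition dense_in :: "('f, 'r) clang \<Rightarrow> ('v, 'f, 'r) cstruct \<Rightarrow> 'v set \<Rightarrow> bool" where
  "dense_in \<tau> M A \<longleftrightarrow> A \<subseteq> univ M \<and> stop \<tau> M closure_of A = univ M"

definition nicely_dense :: "('f, 'r) clang \<Rightarrow> ('v, 'f, 'r) cstruct \<Rightarrow> 'v set \<Rightarrow> bool" where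
  "nicely_dense \<tau> M A \<longleftrightarrow>
     dense_in \<tau> M A \<and> (\<forall>F\<in>fsyms \<tau>. \<forall>xs\<in>tuples (farity \<tau> F) A. fn M F xs \<in> A)"

text \<open>Density character: the least cardinality of a dense subset.\<close>

definition dc :: "('f, 'r) clang \<Rightarrow> ('v, 'f, 'r) cstruct \<Rightarrow> 'v rel" where
  "dc \<tau> M = |SOME A. dense_in \<tau> M A \<and> (\<forall>B. dense_in \<tau> M B \<longrightarrow> |A| \<le>o |B| )|"

definition is_completion ::
    "'v set \<Rightarrow> ('v \<Rightarrow> 'v \<Rightarrow> real) \<Rightarrow> 'v set \<Rightarrow> ('v \<Rightarrow> 'v \<Rightarrow> real) \<Rightarrow> bool" where
  "is_completion A D X E \<longleftrightarrow>
     Metric_space A D \<and> Metric_space X E \<and> Metric_space.mcomplete X E \<and>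
     A \<subseteq> X \<and> (\<forall>a\<in>A. \<forall>b\<in>A. E a b = D a b) \<and> Metric_space.mtopology X E closure_of A = X"

section \<open>Chains and Loewenheim--Skolem numbers\<close>

text \<open>
  A chain \<open>\<langle>M i : i < \<alpha>\<rangle>\<close> is indexed by the elements of a small nonempty well-order \<open>r\<close> of type
  \<open>\<alpha>\<close>. The chain axioms below ask for the union of the chain to be small, which is automatic when
  the cardinality of \<open>'v\<close> is regular.
\<close>

definition chain_index :: "'v rel \<Rightarrow> bool" where
  "chain_index r \<longleftrightarrow> Well_order r \<and> Field r \<noteq> {} \<and> small (Field r)"

definition limit_in :: "'v rel \<Rightarrow> 'v \<Rightarrow> bool" where
  "limit_in r j \<longleftrightarrow> j \<in> Field r \<and> underS r j \<noteq> {} \<and>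
     (\<forall>i\<in>underS r j. \<exists>k\<in>underS r j. i \<in> underS r k)"

text \<open>
  \<open>LS_bound\<close>: the infinite cardinal \<open>\<kappa> \<ge> |\<tau>|\<close> has the Loewenheim--Skolem property. The notion of
  size is a parameter, being cardinality for AECs and density character for MAECs. Every small
  cardinal is realized as a relation on \<open>'v\<close>.
\<close>

definition LS_bound ::
    "(('v, 'f, 'r, 'b) struct \<Rightarrow> 'v rel) \<Rightarrow> ('f, 'r, 'z) lang_scheme \<Rightarrow> ('v, 'f, 'r, 'b) struct set \<Rightarrow>
      (('v, 'f, 'r, 'b) struct \<Rightarrow> ('v, 'f, 'r, 'b) struct \<Rightarrow> bool) \<Rightarrow> 'v rel \<Rightarrow> bool" where
  "LS_bound sz \<tau> K prec \<kappa> \<longleftrightarrow>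
     Cinfinite \<kappa> \<and> \<kappa> <o |UNIV :: 'v set| \<and> |fsyms \<tau> <+> rsyms \<tau>| \<le>o \<kappa> \<and>
     (\<forall>M\<in>K. \<forall>A\<subseteq>univ M. \<exists>N. prec N M \<and> A \<subseteq> univ N \<and> sz N \<le>o |A| +c \<kappa>)"

definition is_LS ::
    "(('v, 'f, 'r, 'b) struct \<Rightarrow> 'v rel) \<Rightarrow> ('f, 'r, 'z) lang_scheme \<Rightarrow> ('v, 'f, 'r, 'b) struct set \<Rightarrow>
      (('v, 'f, 'r, 'b) struct \<Rightarrow> ('v, 'f, 'r, 'b) struct \<Rightarrow> bool) \<Rightarrow> 'v rel \<Rightarrow> bool" where
  "is_LS sz \<tau> K prec \<kappa> \<longleftrightarrow>
     LS_bound sz \<tau> K prec \<kappa> \<and> (\<forall>\<mu>. LS_bound sz \<tau> K prec \<mu> \<longrightarrow> \<kappa> \<le>o \<mu>)"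

definition card_univ :: "('v, 'f, 'r, 'b) struct \<Rightarrow> 'v rel" where
  "card_univ M = |univ M|"

section \<open>Abstract elementary classes, discrete and metric\<close>

locale structure_class =
  fixes \<tau> :: "('f, 'r, 'z) lang_scheme"
    and is_str :: "('v, 'f, 'r, 'b) struct \<Rightarrow> bool"
    and K :: "('v, 'f, 'r, 'b) struct set"
    and prec :: "('v, 'f, 'r, 'b) struct \<Rightarrow> ('v, 'f, 'r, 'b) struct \<Rightarrow> bool" (infix \<open>\<preceq>\<close> 50)
  assumes structures: "M \<in> K \<Longrightarrow> is_str M"
    and partial_order: "partial_order_on K {(M, N). M \<preceq> N}"
    and prec_substructure: "M \<preceq> N \<Longrightarrow> substructure \<tau> M N"
    and iso_closed: "M \<in> K \<Longrightarrow> is_str N \<Longrightarrow> isomorphism \<tau> g M N \<Longrightarrow> N \<in> K"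
    and prec_iso_closed:
      "M \<preceq> N \<Longrightarrow> is_str M' \<Longrightarrow> is_str N' \<Longrightarrow> isomorphism \<tau> g M M' \<Longrightarrow> isomorphism \<tau> g N N' \<Longrightarrow>
        M' \<preceq> N'"
    and coherence: "M\<^sub>0 \<preceq> M\<^sub>2 \<Longrightarrow> M\<^sub>1 \<preceq> M\<^sub>2 \<Longrightarrow> substructure \<tau> M\<^sub>0 M\<^sub>1 \<Longrightarrow> M\<^sub>0 \<preceq> M\<^sub>1"

definition chain_union ::
    "('f, 'r, 'z) lang_scheme \<Rightarrow> 'v set \<Rightarrow> ('v \<Rightarrow> ('v, 'f, 'r, 'b) struct) \<Rightarrow> ('v, 'f, 'r, 'b) struct
      \<Rightarrow> bool" where
  "chain_union \<tau> I M N \<longleftrightarrow>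
     is_structure \<tau> N \<and> (\<forall>i\<in>I. substructure \<tau> (M i) N) \<and> univ N = (\<Union>i\<in>I. univ (M i))"

definition aec_chain ::
    "('f, 'r, 'z) lang_scheme \<Rightarrow> (('v, 'f, 'r, 'b) struct \<Rightarrow> ('v, 'f, 'r, 'b) struct \<Rightarrow> bool) \<Rightarrow>
      'v rel \<Rightarrow> ('v \<Rightarrow> ('v, 'f, 'r, 'b) struct) \<Rightarrow> bool" where
  "aec_chain \<tau> prec r M \<longleftrightarrow>
     chain_index r \<and> (\<forall>(i, j)\<in>r. prec (M i) (M j)) \<and>
     (\<forall>j. limit_in r j \<longrightarrow> chain_union \<tau> (underS r j) M (M j))"

locale AEC = structure_class \<tau> "is_structure \<tau>" K prec
  for \<tau> :: "('f, 'r, 'z) lang_scheme"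
    and K :: "('v, 'f, 'r) dstruct set"
    and prec :: "('v, 'f, 'r) dstruct \<Rightarrow> ('v, 'f, 'r) dstruct \<Rightarrow> bool" (infix \<open>\<preceq>\<close> 50) +
  assumes chains:
      "aec_chain \<tau> (\<preceq>) r M \<Longrightarrow> small (\<Union>i\<in>Field r. univ (M i)) \<Longrightarrow>
        \<exists>N\<in>K. chain_union \<tau> (Field r) M N \<and> (\<forall>i\<in>Field r. M i \<preceq> N)"
    and smoothness:
      "aec_chain \<tau> (\<preceq>) r M \<Longrightarrow> chain_union \<tau> (Field r) M N \<Longrightarrow>
        P \<in> K \<Longrightarrow> (\<And>i. i \<in> Field r \<Longrightarrow> M i \<preceq> P) \<Longrightarrow> N \<preceq> P"
    and LS: "\<exists>\<kappa>. is_LS card_univ \<tau> K (\<preceq>) \<kappa>"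

text \<open>
  The completion of the union of a chain is determined only up to isomorphism over the union; any
  continuous structure extending the members of the chain and containing their union densely is
  admitted. That such a structure exists is part of the chain axiom: the interpretations of the
  symbols are not assumed uniformly continuous, so they need not extend to the metric completion of
  the union.
\<close>

definition chain_completion ::
    "('f, 'r) clang \<Rightarrow> 'v set \<Rightarrow> ('v \<Rightarrow> ('v, 'f, 'r) cstruct) \<Rightarrow> ('v, 'f, 'r) cstruct \<Rightarrow> bool" where
  "chain_completion \<tau> I M N \<longleftrightarrow>
     is_cstructure \<tau> N \<and> (\<forall>i\<in>I. substructure \<tau> (M i) N) \<and> dense_in \<tau> N (\<Union>i\<in>I. univ (M i))"

definition maec_chain ::
    "('f, 'r) clang \<Rightarrow> (('v, 'f, 'r) cstruct \<Rightarrow> ('v, 'f, 'r) cstruct \<Rightarrow> bool) \<Rightarrow>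
      'v rel \<Rightarrow> ('v \<Rightarrow> ('v, 'f, 'r) cstruct) \<Rightarrow> bool" where
  "maec_chain \<tau> prec r M \<longleftrightarrow>
     chain_index r \<and> (\<forall>(i, j)\<in>r. prec (M i) (M j)) \<and>
     (\<forall>j. limit_in r j \<longrightarrow> chain_completion \<tau> (underS r j) M (M j))"

text \<open>
  In \<open>smoothness\<close> the completion is the one computed inside \<open>P\<close>, that is, the closure of the union
  in \<open>P\<close>; this is the substructure requirement on \<open>N\<close>.
\<close>

locale MAEC = structure_class \<tau> "is_cstructure \<tau>" K prec
  for \<tau> :: "('f, 'r) clang"
    and K :: "('v, 'f, 'r) cstruct set"
    and prec :: "('v, 'f, 'r) cstruct \<Rightarrow> ('v, 'f, 'r) cstruct \<Rightarrow> bool" (infix \<open>\<preceq>\<close> 50) +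
  assumes chains:
      "maec_chain \<tau> (\<preceq>) r M \<Longrightarrow> small (\<Union>i\<in>Field r. univ (M i)) \<Longrightarrow>
        \<exists>N\<in>K. chain_completion \<tau> (Field r) M N \<and> (\<forall>i\<in>Field r. M i \<preceq> N)"
    and smoothness:
      "maec_chain \<tau> (\<preceq>) r M \<Longrightarrow> P \<in> K \<Longrightarrow> (\<And>i. i \<in> Field r \<Longrightarrow> M i \<preceq> P) \<Longrightarrow>
        chain_completion \<tau> (Field r) M N \<Longrightarrow> substructure \<tau> N P \<Longrightarrow> N \<preceq> P"
    and LS: "\<exists>\<kappa>. is_LS (dc \<tau>) \<tau> K (\<preceq>) \<kappa>"

definition LS_AEC ::
    "('f, 'r, 'z) lang_scheme \<Rightarrow> ('v, 'f, 'r) dstruct set \<Rightarrow>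
      (('v, 'f, 'r) dstruct \<Rightarrow> ('v, 'f, 'r) dstruct \<Rightarrow> bool) \<Rightarrow> 'v rel" where
  "LS_AEC \<tau> K prec = (SOME \<kappa>. is_LS card_univ \<tau> K prec \<kappa>)"

definition LS_MAEC ::
    "('f, 'r) clang \<Rightarrow> ('v, 'f, 'r) cstruct set \<Rightarrow>
      (('v, 'f, 'r) cstruct \<Rightarrow> ('v, 'f, 'r) cstruct \<Rightarrow> bool) \<Rightarrow> 'v rel" where
  "LS_MAEC \<tau> K prec = (SOME \<kappa>. is_LS (dc \<tau>) \<tau> K prec \<kappa>)"

text \<open>An embedding of \<open>M\<close> into \<open>N\<close> with respect to a strong substructure relation.\<close>

definition strong_embedding ::
    "('f, 'r, 'z) lang_scheme \<Rightarrow> (('v, 'f, 'r, 'b) struct \<Rightarrow> ('v, 'f, 'r, 'b) struct \<Rightarrow> bool) \<Rightarrow>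
      ('v \<Rightarrow> 'v) \<Rightarrow> ('v, 'f, 'r, 'b) struct \<Rightarrow> ('v, 'f, 'r, 'b) struct \<Rightarrow> bool" where
  "strong_embedding \<tau> prec f M N \<longleftrightarrow> (\<exists>N\<^sub>0. prec N\<^sub>0 N \<and> isomorphism \<tau> f M N\<^sub>0)"

section \<open>The discrete language of dense subsets\<close>

datatype 'f plus_fun = Plus 'f

text \<open>\<open>Geq R r\<close> and \<open>Leq R r\<close> are the symbols \<open>R\<^bsub>R(z) \<ge> r\<^esub>\<close> and \<open>R\<^bsub>R(z) \<le> r\<^esub>\<close>.\<close>

datatype 'r plus_rel = Geq 'r rat | Leq 'r rat

definition Q01 :: "rat set" where
  "Q01 = {0..1}"

definition contains_dense_symbols ::
    "('f, 'r) clang \<Rightarrow> ('f plus_fun, 'r plus_rel) lang \<Rightarrow> bool" where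
  "contains_dense_symbols \<tau> \<tau>p \<longleftrightarrow>
     (\<forall>F\<in>fsyms \<tau>. Plus F \<in> fsyms \<tau>p \<and> farity \<tau>p (Plus F) = farity \<tau> F) \<and>
     (\<forall>R\<in>rsyms \<tau>. \<forall>r\<in>Q01.
        Geq R r \<in> rsyms \<tau>p \<and> rarity \<tau>p (Geq R r) = rarity \<tau> R \<and>
        Leq R r \<in> rsyms \<tau>p \<and> rarity \<tau>p (Leq R r) = rarity \<tau> R)"

text \<open>The metric \<open>D\<close> read off from a discrete structure; 0 off the universe as for \<open>sdist\<close>.\<close>

definition dense_dist ::
    "('f, 'r) clang \<Rightarrow> ('v, 'f plus_fun, 'r plus_rel) dstruct \<Rightarrow> 'v \<Rightarrow> 'v \<Rightarrow> real" where
  "dense_dist \<tau> \<A> a b =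
     (if a \<in> univ \<A> \<and> b \<in> univ \<A>
      then Sup {of_rat r | r. r \<in> Q01 \<and> rl \<A> (Geq (dsym \<tau>) r) [a, b]} else 0)"

end

theory Submission
  imports Defs
begin

text \<open>
  A structure \<open>M\<close> is determined, up to an isomorphism fixing \<open>A\<close>, by its restriction to a nicely
  dense set \<open>A\<close>, and the restriction is encoded by the rational cuts of its relations. So \<open>K\<^sub>d\<close>
  consists of these encodings, and \<open>M\<^sub>A\<close> is strong in \<open>N\<^sub>B\<close> if \<open>A \<subseteq> B\<close> and the closure of \<open>A\<close> in
  \<open>N\<close> is a strong substructure of \<open>N\<close>; by uniqueness this does not depend on the choice of \<open>N\<close>.
  The axioms transfer by passing to closures. Only the union of a chain needs an ambient space: there all
  members are realized inside one metric completion of the union of their dense sets.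
\<close>

section \<open>Substructures and isomorphic copies\<close>

text \<open>The symbols are continuous but not uniformly continuous, so a function on a dense set
  may fail to extend to the metric completion. Existence of an extension is therefore built into the
  class: an encoding belongs to it if some member of \<open>K\<close> induces it. What remains is
  uniqueness, and there plain continuity suffices, because continuous maps that agree on the finite
  powers of a dense set agree everywhere. Three obstacles shape the rest. Representations of the
  members of a chain are chosen separately, so they share their dense sets but need not be nested. A
  strong substructure of small density can meet a prescribed dense set in too few points. And all
  copies and completions have to be found inside \<open>'v\<close>, where small sets leave enough
  room for them. Rational cuts suffice because relations take values in the unit interval, so that a
  rational between two values lies in \<open>Q01\<close>.\<close>

lemma is_structureD:
  assumes "is_structure \<tau> M"
  shows "univ M \<noteq> {}" "small (univ M)"
    "\<And>F xs. F \<in> fsyms \<tau> \<Longrightarrow> xs \<in> tuples (farity \<tau> F) (univ M) \<Longrightarrow> fn M F xs \<in> univ M"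
    "\<And>F xs. \<not> (F \<in> fsyms \<tau> \<and> xs \<in> tuples (farity \<tau> F) (univ M)) \<Longrightarrow> fn M F xs = undefined"
    "\<And>R xs. \<not> (R \<in> rsyms \<tau> \<and> xs \<in> tuples (rarity \<tau> R) (univ M)) \<Longrightarrow> rl M R xs = undefined"
  using assms unfolding is_structure_def by blast+

lemma tuples_mono: "A \<subseteq> B \<Longrightarrow> tuples n A \<subseteq> tuples n B"
  by (auto simp: tuples_def)

lemma map_in_tuples: "xs \<in> tuples n A \<Longrightarrow> g ` A \<subseteq> B \<Longrightarrow> map g xs \<in> tuples n B"
  by (auto simp: tuples_def)

lemma small_mono: "small (A :: 'v set) \<Longrightarrow> |B :: 'v set| \<le>o |A| \<Longrightarrow> small B"
  unfolding small_def using ordLeq_ordLess_trans by blast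

lemma small_subset: "small A \<Longrightarrow> B \<subseteq> A \<Longrightarrow> small B"
  using small_mono card_of_mono1 by blast

lemma small_image: "small (A :: 'v set) \<Longrightarrow> small (g ` A :: 'v set)"
  using small_mono card_of_image by blast

lemma structure_eqI:
  assumes "is_structure \<tau> M" "is_structure \<tau> N" "univ M = univ N"
    and "\<And>F xs. F \<in> fsyms \<tau> \<Longrightarrow> xs \<in> tuples (farity \<tau> F) (univ M) \<Longrightarrow> fn M F xs = fn N F xs"
    and "\<And>R xs. R \<in> rsyms \<tau> \<Longrightarrow> xs \<in> tuples (rarity \<tau> R) (univ M) \<Longrightarrow> rl M R xs = rl N R xs"
  shows "M = N"
proof -
  have "fn M F xs = fn N F xs" for F xs
    using assms(3,4) is_structureD(4)[OF assms(1)] is_structureD(4)[OF assms(2)] by metis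
  moreover have "rl M R xs = rl N R xs" for R xs
    using assms(3,5) is_structureD(5)[OF assms(1)] is_structureD(5)[OF assms(2)] by metis
  ultimately have "fn M = fn N" "rl M = rl N" by blast+
  then show ?thesis using assms(3) by simp
qed

text \<open>Nonemptiness is included because a structure has a nonempty universe, while the empty
  set is closed under the functions of a language without constants.\<close>

definition fn_closed ::
    "('f, 'r, 'z) lang_scheme \<Rightarrow> ('v, 'f, 'r, 'b) struct \<Rightarrow> 'v set \<Rightarrow> bool" where
  "fn_closed \<tau> M A \<longleftrightarrow> A \<noteq> {} \<and> A \<subseteq> univ M \<and>
     (\<forall>F\<in>fsyms \<tau>. \<forall>xs\<in>tuples (farity \<tau> F) A. fn M F xs \<in> A)"

text \<open>Resetting the interpretations to \<open>undefined\<close> outside \<open>A\<close> turns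
  facts such as \<open>restr_restr\<close> into equalities rather than isomorphisms.\<close>

definition restr ::
    "('f, 'r, 'z) lang_scheme \<Rightarrow> ('v, 'f, 'r, 'b) struct \<Rightarrow> 'v set \<Rightarrow> ('v, 'f, 'r, 'b) struct" where
  "restr \<tau> M A =
    \<lparr>univ = A,
     fn = \<lambda>F xs. if F \<in> fsyms \<tau> \<and> xs \<in> tuples (farity \<tau> F) A then fn M F xs else undefined,
     rl = \<lambda>R xs. if R \<in> rsyms \<tau> \<and> xs \<in> tuples (rarity \<tau> R) A then rl M R xs else undefined\<rparr>"

lemma restr_simps [simp]:
  "univ (restr \<tau> M A) = A"
  "F \<in> fsyms \<tau> \<Longrightarrow> xs \<in> tuples (farity \<tau> F) A \<Longrightarrow> fn (restr \<tau> M A) F xs = fn M F xs"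
  "R \<in> rsyms \<tau> \<Longrightarrow> xs \<in> tuples (rarity \<tau> R) A \<Longrightarrow> rl (restr \<tau> M A) R xs = rl M R xs"
  by (simp_all add: restr_def)

lemma restr_restr: "B \<subseteq> A \<Longrightarrow> restr \<tau> (restr \<tau> M A) B = restr \<tau> M B"
  by (auto simp: restr_def fun_eq_iff tuples_def)

lemma is_structure_restr:
  assumes "is_structure \<tau> M" "fn_closed \<tau> M A"
  shows "is_structure \<tau> (restr \<tau> M A)"
  using assms small_subset[of "univ M" A] 
  unfolding is_structure_def fn_closed_def by (simp add: restr_def)

lemma substructure_restr:
  assumes "is_structure \<tau> M" "fn_closed \<tau> M A"
  shows "substructure \<tau> (restr \<tau> M A) M"
  using assms is_structure_restr unfolding substructure_def fn_closed_def by auto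

text \<open>The last two facts say that a substructure carries no data beyond its universe. Later
  arguments therefore handle substructures of a fixed structure as function-closed sets.\<close>

lemma substructureD:
  assumes "substructure \<tau> N M"
  shows "is_structure \<tau> N" "is_structure \<tau> M" "univ N \<subseteq> univ M"
    "\<And>F xs. F \<in> fsyms \<tau> \<Longrightarrow> xs \<in> tuples (farity \<tau> F) (univ N) \<Longrightarrow> fn N F xs = fn M F xs"
    "\<And>R xs. R \<in> rsyms \<tau> \<Longrightarrow> xs \<in> tuples (rarity \<tau> R) (univ N) \<Longrightarrow> rl N R xs = rl M R xs"
    "fn_closed \<tau> M (univ N)" "N = restr \<tau> M (univ N)"
proof -
  show *: "is_structure \<tau> N" "is_structure \<tau> M" "univ N \<subseteq> univ M"
    "\<And>F xs. F \<in> fsyms \<tau> \<Longrightarrow> xs \<in> tuples (farity \<tau> F) (univ N) \<Longrightarrow> fn N F xs = fn M F xs"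
    "\<And>R xs. R \<in> rsyms \<tau> \<Longrightarrow> xs \<in> tuples (rarity \<tau> R) (univ N) \<Longrightarrow> rl N R xs = rl M R xs"
    using assms unfolding substructure_def by blast+
  show c: "fn_closed \<tau> M (univ N)"
    using * is_structureD(1,3)[OF *(1)] unfolding fn_closed_def by metis
  show "N = restr \<tau> M (univ N)"
    by (rule structure_eqI[OF *(1) is_structure_restr[OF *(2) c]]) (simp_all add: *)
qed

lemma fn_closed_restr: "A \<subseteq> B \<Longrightarrow> fn_closed \<tau> M A \<Longrightarrow> fn_closed \<tau> (restr \<tau> M B) A"
  unfolding fn_closed_def using tuples_mono by (metis restr_simps(1,2) subsetD)

lemma substructure_restr_mono:
  assumes "is_structure \<tau> M" "fn_closed \<tau> M A" "fn_closed \<tau> M B" "A \<subseteq> B"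
  shows "substructure \<tau> (restr \<tau> M A) (restr \<tau> M B)"
  using substructure_restr[OF is_structure_restr[OF assms(1,3)] fn_closed_restr[OF assms(4,2)]]
  by (simp add: restr_restr assms(4))

lemma fn_closed_of_restr: "fn_closed \<tau> (restr \<tau> M B) A \<Longrightarrow> B \<subseteq> univ M \<Longrightarrow> fn_closed \<tau> M A"
  unfolding fn_closed_def using tuples_mono[of A B]
  by (metis (no_types, lifting) order_trans restr_simps(1,2) subsetD)

lemma restr_univ: "is_structure \<tau> M \<Longrightarrow> restr \<tau> M (univ M) = M"
  by (metis substructureD(7) substructure_def order_refl)

lemma substructure_antisym: "substructure \<tau> M N \<Longrightarrow> substructure \<tau> N M \<Longrightarrow> M = N"
  by (metis restr_univ subset_antisym substructureD(1,3,7))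

lemma isomorphismD:
  assumes "isomorphism \<tau> g M N"
  shows "bij_betw g (univ M) (univ N)" "inj_on g (univ M)" "g ` univ M = univ N"
    "\<And>F xs. F \<in> fsyms \<tau> \<Longrightarrow> xs \<in> tuples (farity \<tau> F) (univ M) \<Longrightarrow> g (fn M F xs) = fn N F (map g xs)"
    "\<And>R xs. R \<in> rsyms \<tau> \<Longrightarrow> xs \<in> tuples (rarity \<tau> R) (univ M) \<Longrightarrow> rl M R xs = rl N R (map g xs)"
  using assms unfolding isomorphism_def bij_betw_def by blast+

lemma map_tuples_inv:
  assumes "ys \<in> tuples n (g ` A)"
  shows "map (inv_into A g) ys \<in> tuples n A" "map g (map (inv_into A g) ys) = ys"
proof -
  show "map (inv_into A g) ys \<in> tuples n A" 
    using assms by (auto simp: tuples_def intro: inv_into_into)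
  show "map g (map (inv_into A g) ys) = ys"
    using assms by (auto simp: tuples_def f_inv_into_f subset_iff intro!: map_idI)
qed

lemma tuples_image: "ys \<in> tuples n (g ` A) \<Longrightarrow> \<exists>xs\<in>tuples n A. ys = map g xs"
  using map_tuples_inv by metis

lemma isomorphism_tuple_obtain:
  assumes "isomorphism \<tau> g M N" "ys \<in> tuples n (univ N)"
  obtains xs where "xs \<in> tuples n (univ M)" "ys = map g xs"
  using assms tuples_image isomorphismD(3) by metis

text \<open>Every tuple of the target is the image of a tuple of the source, so \<open>g\<close>
  dictates all values. This turns an isomorphism onto a given structure into an equality with the
  expected copy.\<close>

lemma isomorphism_image_unique:
  assumes "isomorphism \<tau> g M N" "isomorphism \<tau> g M N'" "is_structure \<tau> N" "is_structure \<tau> N'"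
  shows "N = N'"
proof (rule structure_eqI[OF assms(3,4)])
  show "univ N = univ N'" using assms isomorphismD(3) by metis
  show "fn N F xs = fn N' F xs" if "F \<in> fsyms \<tau>" "xs \<in> tuples (farity \<tau> F) (univ N)" for F xs
    using isomorphism_tuple_obtain[OF assms(1) that(2)] that(1) isomorphismD(4)[OF assms(1)]
      isomorphismD(4)[OF assms(2)] by metis
  show "rl N R xs = rl N' R xs" if "R \<in> rsyms \<tau>" "xs \<in> tuples (rarity \<tau> R) (univ N)" for R xs
    using isomorphism_tuple_obtain[OF assms(1) that(2)] that(1) isomorphismD(5)[OF assms(1)]
      isomorphismD(5)[OF assms(2)] by metis
qed

text \<open>Maps obtained by extension agree with the given one on a dense set only; this exchanges
  one for the other where the values on the universe are all that counts.\<close>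

lemma isomorphism_cong:
  assumes "\<And>x. x \<in> univ M \<Longrightarrow> f x = g x" "is_structure \<tau> M"
  shows "isomorphism \<tau> f M N \<longleftrightarrow> isomorphism \<tau> g M N"
proof -
  have "map f xs = map g xs" if "xs \<in> tuples n (univ M)" for xs n
    using that assms by (auto simp: tuples_def)
  moreover have "f (fn M F xs) = g (fn M F xs)"
    if "F \<in> fsyms \<tau>" "xs \<in> tuples (farity \<tau> F) (univ M)" for F xs
    using that assms(1) is_structureD(3)[OF assms(2)] by blast
  moreover have "bij_betw f (univ M) (univ N) \<longleftrightarrow> bij_betw g (univ M) (univ N)"
    using assms(1) by (rule bij_betw_cong)
  ultimately show ?thesis
    unfolding isomorphism_def by (simp del: map_eq_conv)
qed

lemma isomorphism_inv:
  assumes "isomorphism \<tau> g M N" "is_structure \<tau> M"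
  shows "isomorphism \<tau> (inv_into (univ M) g) N M"
  unfolding isomorphism_def
proof (intro conjI ballI)
  let ?h = "inv_into (univ M) g"
  note i = isomorphismD[OF assms(1)]
  show "bij_betw ?h (univ N) (univ M)" using i(1) by (rule bij_betw_inv_into)
  have hg: "map ?h (map g xs) = xs" if "xs \<in> tuples n (univ M)" for xs n
    using that i(2) by (auto simp: tuples_def subset_iff intro!: map_idI)
  show "?h (fn N F ys) = fn M F (map ?h ys)"
    if F: "F \<in> fsyms \<tau>" "ys \<in> tuples (farity \<tau> F) (univ N)" for F ys
  proof -
    obtain xs where xs: "xs \<in> tuples (farity \<tau> F) (univ M)" "ys = map g xs"
      by (rule isomorphism_tuple_obtain[OF assms(1) F(2)])
    then show ?thesis
      using F i(2,4) hg is_structureD(3)[OF assms(2)] by (metis inv_into_f_f)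
  qed
  show "rl N R ys = rl M R (map ?h ys)"
    if "R \<in> rsyms \<tau>" "ys \<in> tuples (rarity \<tau> R) (univ N)" for R ys
    using isomorphism_tuple_obtain[OF assms(1) that(2)] that(1) i(5) hg by metis
qed

lemma isomorphism_id_imp_eq:
  assumes "is_structure \<tau> M" "is_structure \<tau> N" "isomorphism \<tau> id M N"
  shows "M = N"
  by (rule isomorphism_image_unique[OF _ assms(3,1,2)]) (simp add: isomorphism_def bij_betw_def)

lemma isomorphism_refl: "isomorphism \<tau> id M M"
  by (simp add: isomorphism_def bij_betw_def)

text \<open>Transport of structure along \<open>g\<close>. The injections in question are extensions
  of a map prescribed on a dense set, and isometries into a common completion.\<close>

definition image_struct ::
    "('f, 'r, 'z) lang_scheme \<Rightarrow> ('v \<Rightarrow> 'v) \<Rightarrow> ('v, 'f, 'r, 'b) struct \<Rightarrow> ('v, 'f, 'r, 'b) struct" where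
  "image_struct \<tau> g M =
    \<lparr>univ = g ` univ M,
     fn = \<lambda>F xs. if F \<in> fsyms \<tau> \<and> xs \<in> tuples (farity \<tau> F) (g ` univ M)
       then g (fn M F (map (inv_into (univ M) g) xs)) else undefined,
     rl = \<lambda>R xs. if R \<in> rsyms \<tau> \<and> xs \<in> tuples (rarity \<tau> R) (g ` univ M)
       then rl M R (map (inv_into (univ M) g) xs) else undefined\<rparr>"

lemma univ_image_struct [simp]: "univ (image_struct \<tau> g M) = g ` univ M"
  by (simp add: image_struct_def)

lemma is_structure_image:
  assumes "is_structure \<tau> M"
  shows "is_structure \<tau> (image_struct \<tau> g M)"
  using assms small_image[of "univ M" g] map_tuples_inv(1)[of _ _ g "univ M"]
  unfolding is_structure_def image_struct_def by simp

lemma isomorphism_image: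
  assumes "inj_on g (univ M)"
  shows "isomorphism \<tau> g M (image_struct \<tau> g M)"
proof -
  have "map (inv_into (univ M) g) (map g xs) = xs" if "xs \<in> tuples n (univ M)" for xs n
    using that assms by (auto simp: tuples_def subset_iff intro!: map_idI)
  moreover have "map g xs \<in> tuples n (g ` univ M)" if "xs \<in> tuples n (univ M)" for xs n
    using that map_in_tuples by blast
  ultimately show ?thesis
    using assms unfolding isomorphism_def by (simp add: bij_betw_def image_struct_def)
qed

lemma isomorphism_restr:
  assumes "isomorphism \<tau> g M N" "fn_closed \<tau> M A"
  shows "isomorphism \<tau> g (restr \<tau> M A) (restr \<tau> N (g ` A))" "fn_closed \<tau> N (g ` A)"
proof -
  note i = isomorphismD[OF assms(1)]
  have A: "A \<subseteq> univ M" "A \<noteq> {}" using assms(2) by (auto simp: fn_closed_def)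
  have m: "map g xs \<in> tuples n (g ` A)" if "xs \<in> tuples n A" for xs n
    using that map_in_tuples by blast
  have m': "xs \<in> tuples n (univ M)" if "xs \<in> tuples n A" for xs n
    using that A tuples_mono by blast
  have "inj_on g A" using i(2) A inj_on_subset by blast
  then show "isomorphism \<tau> g (restr \<tau> M A) (restr \<tau> N (g ` A))"
    using i(4,5) m m' unfolding isomorphism_def by (simp add: bij_betw_def)
  show "fn_closed \<tau> N (g ` A)"
    unfolding fn_closed_def
  proof (intro conjI ballI)
    show "g ` A \<noteq> {}" "g ` A \<subseteq> univ N" using A i(3) by auto
    show "fn N F ys \<in> g ` A" if "F \<in> fsyms \<tau>" "ys \<in> tuples (farity \<tau> F) (g ` A)" for F ys
      using tuples_image[OF that(2)] i(4)[OF that(1)] m' assms(2) that(1)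
      unfolding fn_closed_def by (metis imageI)
  qed
qed

section \<open>Unions of directed families\<close>

text \<open>A tuple has finitely many entries, and directedness merges the members that contain them
  one entry at a time.\<close>

lemma directed_tuple:
  assumes dir: "\<And>i j. i \<in> I \<Longrightarrow> j \<in> I \<Longrightarrow> \<exists>k\<in>I. A i \<union> A j \<subseteq> A k" and "I \<noteq> {}"
    and "xs \<in> tuples n (\<Union>i\<in>I. A i)"
  shows "\<exists>i\<in>I. xs \<in> tuples n (A i)"
proof -
  have "set xs \<subseteq> (\<Union>i\<in>I. A i) \<Longrightarrow> \<exists>i\<in>I. set xs \<subseteq> A i"
  proof (induction xs)
    case Nil then show ?case using assms(2) by auto
  next
    case (Cons x xs)
    then obtain i j where "i \<in> I" "set xs \<subseteq> A i" "j \<in> I" "x \<in> A j" by auto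
    with dir[of i j] show ?case by fastforce
  qed
  then show ?thesis using assms(3) by (auto simp: tuples_def)
qed

text \<open>Each tuple of the union already lies in one member, which fixes all values there. As
  \<open>chain_union\<close> is a relation, this uniqueness is what lets a given union be replaced
  by a concretely built one.\<close>

lemma chain_union_unique:
  assumes "chain_union \<tau> I M N" "chain_union \<tau> I M N'" "I \<noteq> {}"
    and dir: "\<And>i j. i \<in> I \<Longrightarrow> j \<in> I \<Longrightarrow> \<exists>k\<in>I. univ (M i) \<union> univ (M j) \<subseteq> univ (M k)"
  shows "N = N'"
proof -
  note N = assms(1)[unfolded chain_union_def] and N' = assms(2)[unfolded chain_union_def]
  have t: "\<exists>i\<in>I. xs \<in> tuples n (univ (M i))" if "xs \<in> tuples n (univ N)" for xs n
  proof -
    have "xs \<in> tuples n (\<Union>i\<in>I. univ (M i))" using that N by simp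
    with dir assms(3) show ?thesis by (rule directed_tuple)
  qed
  show ?thesis
  proof (rule structure_eqI)
    show "is_structure \<tau> N" "is_structure \<tau> N'" "univ N = univ N'" using N N' by auto
    show "fn N F xs = fn N' F xs" if F: "F \<in> fsyms \<tau>" "xs \<in> tuples (farity \<tau> F) (univ N)" for F xs
    proof -
      obtain i where "i \<in> I" "xs \<in> tuples (farity \<tau> F) (univ (M i))" using t F(2) by blast
      then show ?thesis
        using N N' substructureD(4)[of \<tau> "M i" N F xs] substructureD(4)[of \<tau> "M i" N' F xs] F(1)
        by simp
    qed
    show "rl N R xs = rl N' R xs" if R: "R \<in> rsyms \<tau>" "xs \<in> tuples (rarity \<tau> R) (univ N)" for R xs
    proof -
      obtain i where "i \<in> I" "xs \<in> tuples (rarity \<tau> R) (univ (M i))" using t R(2) by blast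
      then show ?thesis
        using N N' substructureD(5)[of \<tau> "M i" N R xs] substructureD(5)[of \<tau> "M i" N' R xs] R(1)
        by simp
    qed
  qed
qed

lemma fn_closed_Union:
  assumes c: "\<And>i. i \<in> I \<Longrightarrow> fn_closed \<tau> M (A i)" and "I \<noteq> {}"
    and dir: "\<And>i j. i \<in> I \<Longrightarrow> j \<in> I \<Longrightarrow> \<exists>k\<in>I. A i \<union> A j \<subseteq> A k"
  shows "fn_closed \<tau> M (\<Union>i\<in>I. A i)"
  unfolding fn_closed_def
proof (intro conjI ballI)
  show "(\<Union>i\<in>I. A i) \<noteq> {}" using c assms(2) unfolding fn_closed_def by auto
  show "(\<Union>i\<in>I. A i) \<subseteq> univ M" using c unfolding fn_closed_def by blast
  fix F xs assume F: "F \<in> fsyms \<tau>" "xs \<in> tuples (farity \<tau> F) (\<Union>i\<in>I. A i)"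
  then obtain i where "i \<in> I" "xs \<in> tuples (farity \<tau> F) (A i)"
    using directed_tuple[OF dir assms(2) F(2)] by blast
  then show "fn M F xs \<in> (\<Union>i\<in>I. A i)" using c[of i] F(1) unfolding fn_closed_def by blast
qed

section \<open>Embeddings\<close>

text \<open>Isomorphisms are the case of full image and substructures the case
  \<open>g = id\<close>, so metric and topological transfer is proved once for both.\<close>

definition embeds ::
    "('f, 'r, 'z) lang_scheme \<Rightarrow> ('v \<Rightarrow> 'v) \<Rightarrow> ('v, 'f, 'r, 'b) struct \<Rightarrow> ('v, 'f, 'r, 'b) struct
      \<Rightarrow> bool" where
  "embeds \<tau> g M N \<longleftrightarrow>
     inj_on g (univ M) \<and> g ` univ M \<subseteq> univ N \<and>
     (\<forall>F\<in>fsyms \<tau>. \<forall>xs\<in>tuples (farity \<tau> F) (univ M). g (fn M F xs) = fn N F (map g xs)) \<and>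
     (\<forall>R\<in>rsyms \<tau>. \<forall>xs\<in>tuples (rarity \<tau> R) (univ M). rl M R xs = rl N R (map g xs))"

lemma embedsD:
  assumes "embeds \<tau> g M N"
  shows "inj_on g (univ M)" "g ` univ M \<subseteq> univ N"
    "\<And>F xs. F \<in> fsyms \<tau> \<Longrightarrow> xs \<in> tuples (farity \<tau> F) (univ M) \<Longrightarrow> g (fn M F xs) = fn N F (map g xs)"
    "\<And>R xs. R \<in> rsyms \<tau> \<Longrightarrow> xs \<in> tuples (rarity \<tau> R) (univ M) \<Longrightarrow> rl M R xs = rl N R (map g xs)"
  using assms unfolding embeds_def by blast+

lemma isomorphism_iff_embeds:
  "isomorphism \<tau> g M N \<longleftrightarrow> embeds \<tau> g M N \<and> g ` univ M = univ N"
  unfolding isomorphism_def embeds_def bij_betw_def by auto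

lemma substructure_embeds: "substructure \<tau> M N \<Longrightarrow> embeds \<tau> id M N"
  unfolding substructure_def embeds_def by simp

lemma embeds_comp:
  assumes "embeds \<tau> g M N" "embeds \<tau> h N P"
  shows "embeds \<tau> (h \<circ> g) M P"
proof -
  have "map g xs \<in> tuples n (univ N)" if "xs \<in> tuples n (univ M)" for n xs
    using map_in_tuples[OF that, of g "univ N"] embedsD(2)[OF assms(1)] by simp
  moreover have "inj_on (h \<circ> g) (univ M)"
    using embedsD(1,2)[OF assms(1)] embedsD(1)[OF assms(2)] comp_inj_on inj_on_subset by blast
  moreover have "(h \<circ> g) ` univ M \<subseteq> univ P"
    using embedsD(2)[OF assms(1)] embedsD(2)[OF assms(2)] by fastforce
  moreover have "(h \<circ> g) (fn M F xs) = fn P F (map (h \<circ> g) xs)"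
    if "F \<in> fsyms \<tau>" "xs \<in> tuples (farity \<tau> F) (univ M)" for F xs
    using that calculation(1) embedsD(3)[OF assms(1)] embedsD(3)[OF assms(2)] by simp
  moreover have "rl M R xs = rl P R (map (h \<circ> g) xs)"
    if "R \<in> rsyms \<tau>" "xs \<in> tuples (rarity \<tau> R) (univ M)" for R xs
    using that calculation(1) embedsD(4)[OF assms(1)] embedsD(4)[OF assms(2)] by simp
  ultimately show ?thesis
    unfolding embeds_def by blast
qed

section \<open>Discretization\<close>

definition plus_lang :: "('f, 'r) clang \<Rightarrow> ('f plus_fun, 'r plus_rel) lang" where
  "plus_lang \<tau> =
    \<lparr>fsyms = Plus ` fsyms \<tau>,
     rsyms = case_prod Geq ` (rsyms \<tau> \<times> Q01) \<union> case_prod Leq ` (rsyms \<tau> \<times> Q01),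
     farity = (\<lambda>G. case G of Plus F \<Rightarrow> farity \<tau> F),
     rarity = (\<lambda>Q. case Q of Geq R r \<Rightarrow> rarity \<tau> R | Leq R r \<Rightarrow> rarity \<tau> R)\<rparr>"

lemma plus_lang_simps [simp]:
  "Plus F \<in> fsyms (plus_lang \<tau>) \<longleftrightarrow> F \<in> fsyms \<tau>"
  "Geq R r \<in> rsyms (plus_lang \<tau>) \<longleftrightarrow> R \<in> rsyms \<tau> \<and> r \<in> Q01"
  "Leq R r \<in> rsyms (plus_lang \<tau>) \<longleftrightarrow> R \<in> rsyms \<tau> \<and> r \<in> Q01"
  "farity (plus_lang \<tau>) (Plus F) = farity \<tau> F"
  "rarity (plus_lang \<tau>) (Geq R r) = rarity \<tau> R"
  "rarity (plus_lang \<tau>) (Leq R r) = rarity \<tau> R"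
  by (auto simp: plus_lang_def)

lemma plus_fun_all: "(\<forall>G. P G) \<longleftrightarrow> (\<forall>F. P (Plus F))"
  by (metis plus_fun.exhaust)

lemma plus_rel_all: "(\<forall>Q. P Q) \<longleftrightarrow> (\<forall>R r. P (Geq R r) \<and> P (Leq R r))"
  by (metis plus_rel.exhaust)

lemma contains_dense_symbols_plus_lang: "contains_dense_symbols \<tau> (plus_lang \<tau>)"
  by (simp add: contains_dense_symbols_def)

text \<open>In a structure, function values off the domain are \<open>undefined\<close> already.
  Relations need the guard: comparing the real \<open>undefined\<close> with \<open>r\<close> need
  not yield the boolean \<open>undefined\<close>.\<close>

definition disc :: "('f, 'r) clang \<Rightarrow> ('v, 'f, 'r) cstruct \<Rightarrow> ('v, 'f plus_fun, 'r plus_rel) dstruct" where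
  "disc \<tau> S =
    \<lparr>univ = univ S,
     fn = (\<lambda>G xs. case G of Plus F \<Rightarrow> fn S F xs),
     rl = (\<lambda>Q xs. case Q of
        Geq R r \<Rightarrow> if R \<in> rsyms \<tau> \<and> r \<in> Q01 \<and> xs \<in> tuples (rarity \<tau> R) (univ S)
          then rl S R xs \<ge> of_rat r else undefined
      | Leq R r \<Rightarrow> if R \<in> rsyms \<tau> \<and> r \<in> Q01 \<and> xs \<in> tuples (rarity \<tau> R) (univ S)
          then rl S R xs \<le> of_rat r else undefined)\<rparr>"

lemma disc_simps [simp]:
  "univ (disc \<tau> S) = univ S"
  "fn (disc \<tau> S) (Plus F) xs = fn S F xs"
  "R \<in> rsyms \<tau> \<Longrightarrow> r \<in> Q01 \<Longrightarrow> xs \<in> tuples (rarity \<tau> R) (univ S) \<Longrightarrow>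
    rl (disc \<tau> S) (Geq R r) xs \<longleftrightarrow> rl S R xs \<ge> of_rat r"
  "R \<in> rsyms \<tau> \<Longrightarrow> r \<in> Q01 \<Longrightarrow> xs \<in> tuples (rarity \<tau> R) (univ S) \<Longrightarrow>
    rl (disc \<tau> S) (Leq R r) xs \<longleftrightarrow> rl S R xs \<le> of_rat r"
  by (simp_all add: disc_def)

lemma is_structure_disc:
  assumes "is_structure \<tau> S"
  shows "is_structure (plus_lang \<tau>) (disc \<tau> S)"
  using is_structureD[OF assms] unfolding is_structure_def
  by (auto simp: plus_fun_all plus_rel_all Ball_def disc_def)

text \<open>Two different values in the unit interval are separated by a rational, which then lies
  in \<open>Q01\<close> itself.\<close>

lemma real_eq_rat_cuts:
  fixes x y :: real
  assumes "x \<in> {0..1}" "y \<in> {0..1}"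
    and "\<And>r. r \<in> Q01 \<Longrightarrow> of_rat r \<le> x \<longleftrightarrow> of_rat r \<le> y"
  shows "x = y"
proof (rule ccontr)
  have *: "\<exists>r\<in>Q01. u < of_rat r \<and> of_rat r < v" if uv: "u < v" "u \<in> {0..1}" "v \<in> {0..1}" for u v :: real
  proof -
    obtain r where r: "u < of_rat r" "of_rat r < v" using of_rat_dense[OF uv(1)] by blast
    then have "(0::real) < of_rat r \<and> of_rat r < (1::real)" using uv(2,3) unfolding atLeastAtMost_iff by linarith
    then have "r \<in> Q01" unfolding Q01_def by simp
    then show ?thesis using r by blast
  qed
  assume "x \<noteq> y"
  then show False
    using *[of x y] *[of y x] assms by fastforce
qed

text \<open>Kept apart from \<open>is_cstructure\<close>: a restriction to a dense set is in general
  not complete, but its values still lie in the unit interval, and this is what decoding the cuts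
  requires.\<close>

definition unit_valued :: "('f, 'r, 'z) lang_scheme \<Rightarrow> ('v, 'f, 'r) cstruct \<Rightarrow> bool" where
  "unit_valued \<tau> S \<longleftrightarrow> (\<forall>R\<in>rsyms \<tau>. \<forall>xs\<in>tuples (rarity \<tau> R) (univ S). rl S R xs \<in> {0..1})"

lemma disc_rl_eq_iff:
  assumes "unit_valued \<tau> S" "unit_valued \<tau> T"
    and "R \<in> rsyms \<tau>" "xs \<in> tuples (rarity \<tau> R) (univ S)" "ys \<in> tuples (rarity \<tau> R) (univ T)"
  shows "rl S R xs = rl T R ys \<longleftrightarrow>
    (\<forall>r\<in>Q01. rl (disc \<tau> S) (Geq R r) xs = rl (disc \<tau> T) (Geq R r) ys \<and>
             rl (disc \<tau> S) (Leq R r) xs = rl (disc \<tau> T) (Leq R r) ys)"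
proof -
  have "rl S R xs \<in> {0..1}" "rl T R ys \<in> {0..1}"
    using assms unfolding unit_valued_def by blast+
  then show ?thesis using assms real_eq_rat_cuts[of "rl S R xs" "rl T R ys"] by auto
qed

text \<open>A value and its cuts determine each other, so passing to \<open>disc\<close> neither
  creates nor loses substructures.\<close>

lemma substructure_disc_iff:
  assumes S: "is_structure \<tau> S" "unit_valued \<tau> S" and T: "is_structure \<tau> T" "unit_valued \<tau> T"
  shows "substructure (plus_lang \<tau>) (disc \<tau> S) (disc \<tau> T) \<longleftrightarrow> substructure \<tau> S T"
proof -
  have "univ S \<subseteq> univ T \<Longrightarrow> R \<in> rsyms \<tau> \<Longrightarrow> xs \<in> tuples (rarity \<tau> R) (univ S) \<Longrightarrow>
      rl S R xs = rl T R xs \<longleftrightarrow>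
      (\<forall>r\<in>Q01. rl (disc \<tau> S) (Geq R r) xs = rl (disc \<tau> T) (Geq R r) xs \<and>
             rl (disc \<tau> S) (Leq R r) xs = rl (disc \<tau> T) (Leq R r) xs)" for R xs
    using disc_rl_eq_iff[OF S(2) T(2)] tuples_mono[of "univ S" "univ T"] by blast
  then show ?thesis
    using S(1) T(1) is_structure_disc[OF S(1)] is_structure_disc[OF T(1)]
    unfolding substructure_def by (auto simp: plus_fun_all plus_rel_all Ball_def)
qed

lemma isomorphism_disc_iff:
  assumes S: "unit_valued \<tau> S" and T: "unit_valued \<tau> T"
  shows "isomorphism (plus_lang \<tau>) g (disc \<tau> S) (disc \<tau> T) \<longleftrightarrow> isomorphism \<tau> g S T"
proof -
  have "bij_betw g (univ S) (univ T) \<Longrightarrow> R \<in> rsyms \<tau> \<Longrightarrow> xs \<in> tuples (rarity \<tau> R) (univ S) \<Longrightarrow>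
      rl S R xs = rl T R (map g xs) \<longleftrightarrow>
      (\<forall>r\<in>Q01. rl (disc \<tau> S) (Geq R r) xs = rl (disc \<tau> T) (Geq R r) (map g xs) \<and>
             rl (disc \<tau> S) (Leq R r) xs = rl (disc \<tau> T) (Leq R r) (map g xs))" for R xs
    using disc_rl_eq_iff[OF S T] map_in_tuples[of xs _ "univ S" g "univ T"]
    by (simp add: bij_betw_def)
  then show ?thesis
    unfolding isomorphism_def by (auto simp: plus_fun_all plus_rel_all Ball_def)
qed

text \<open>Equality of the encodings makes the identity an isomorphism between them; it decodes to
  an isomorphism that is the identity, hence to equality.\<close>

lemma disc_inject:
  assumes "is_structure \<tau> S" "unit_valued \<tau> S" "is_structure \<tau> T" "unit_valued \<tau> T"
    and "disc \<tau> S = disc \<tau> T"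
  shows "S = T"
proof -
  have "isomorphism (plus_lang \<tau>) id (disc \<tau> S) (disc \<tau> T)"
    using isomorphism_refl assms(5) by metis
  then have "isomorphism \<tau> id S T" using isomorphism_disc_iff[OF assms(2,4)] by blast
  then show ?thesis using isomorphism_id_imp_eq[OF assms(1,3)] by blast
qed

section \<open>Metric preliminaries\<close>

text \<open>Cauchy sequences and limits are carried along \<open>g\<close> in both directions, so
  completeness of the source is completeness of the image, and a subspace of a complete space is
  complete exactly when it is closed.\<close>

lemma isometry_complete_iff:
  assumes M: "Metric_space M d" and N: "Metric_space N e"
    and g: "g ` M \<subseteq> N" and iso: "\<And>x y. x \<in> M \<Longrightarrow> y \<in> M \<Longrightarrow> e (g x) (g y) = d x y"
    and complete: "Metric_space.mcomplete N e"
  shows "Metric_space.mcomplete M d \<longleftrightarrow> closedin (Metric_space.mtopology N e) (g ` M)"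
proof -
  interpret M: Metric_space M d by (rule M)
  interpret N: Metric_space N e by (rule N)
  interpret S: Submetric N e "g ` M" by unfold_locales (rule g)
  have "M.mcomplete \<longleftrightarrow> S.sub.mcomplete"
  proof
    assume c: M.mcomplete
    show S.sub.mcomplete
      unfolding S.sub.mcomplete_def
    proof (intro allI impI)
      fix s assume s: "S.sub.MCauchy s"
      define t where "t n = inv_into M g (s n)" for n
      have sM: "s n \<in> g ` M" for n using s unfolding S.sub.MCauchy_def by blast
      then have t: "t n \<in> M" "g (t n) = s n" for n
        unfolding t_def using sM by (simp_all add: inv_into_into f_inv_into_f)
      have "M.MCauchy t"
        using s t iso[of "t _" "t _"] unfolding M.MCauchy_def S.sub.MCauchy_def by auto
      then obtain x where x: "limitin M.mtopology t x sequentially"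
        using c unfolding M.mcomplete_def by blast
      have "limitin S.sub.mtopology s (g x) sequentially"
        using x t sM iso[OF t(1), of x] by (simp add: M.limitin_metric_dist_null S.sub.limitin_metric_dist_null t(2))
      then show "\<exists>x. limitin S.sub.mtopology s x sequentially" by blast
    qed
  next
    assume c: S.sub.mcomplete
    show M.mcomplete
      unfolding M.mcomplete_def
    proof (intro allI impI)
      fix s assume s: "M.MCauchy s"
      then have sM: "s n \<in> M" for n unfolding M.MCauchy_def by blast
      have "S.sub.MCauchy (g \<circ> s)"
        using s sM iso unfolding M.MCauchy_def S.sub.MCauchy_def by auto
      then obtain y where y: "limitin S.sub.mtopology (g \<circ> s) y sequentially"
        using c unfolding S.sub.mcomplete_def by blast
      then obtain x where x: "x \<in> M" "y = g x"
        using S.sub.limitin_mspace by blast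
      have "limitin M.mtopology s x sequentially"
        using y x sM iso[OF sM x(1)] by (simp add: M.limitin_metric_dist_null S.sub.limitin_metric_dist_null)
      then show "\<exists>x. limitin M.mtopology s x sequentially" by blast
    qed
  qed
  then show ?thesis using S.closedin_eq_mcomplete complete by blast
qed

text \<open>An isometry is Lipschitz with constant 1, so it extends to the closure by completeness
  of the target. That the extension is still isometric is checked by density, one argument of the
  distance at a time.\<close>

lemma isometry_extends_to_closure:
  assumes M: "Metric_space M d" and N: "Metric_space N e" and complete: "Metric_space.mcomplete N e"
    and A: "A \<subseteq> M" "Metric_space.mtopology M d closure_of A = M"
    and f: "f ` A \<subseteq> N" and iso: "\<And>x y. x \<in> A \<Longrightarrow> y \<in> A \<Longrightarrow> e (f x) (f y) = d x y"
  obtains g where "g ` M \<subseteq> N" "\<And>x. x \<in> A \<Longrightarrow> g x = f x"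
    "\<And>x y. x \<in> M \<Longrightarrow> y \<in> M \<Longrightarrow> e (g x) (g y) = d x y"
proof -
  interpret M: Metric_space M d by (rule M)
  interpret N: Metric_space N e by (rule N)
  have "mcomplete_of (metric (N, e))" using complete by simp
  moreover have "Lipschitz_continuous_map (submetric (metric (M, d)) A) (metric (N, e)) f"
    unfolding Lipschitz_continuous_map_def using f A(1) iso by (auto intro!: exI[of _ 1])
  ultimately obtain g where "Lipschitz_continuous_map
      (submetric (metric (M, d)) (mtopology_of (metric (M, d)) closure_of A)) (metric (N, e)) g"
    and gf: "\<And>x. x \<in> A \<Longrightarrow> g x = f x"
    by (rule Lipschitz_continuous_map_extends_to_closure_of) blast
  then have L: "Lipschitz_continuous_map (metric (M, d)) (metric (N, e)) g"
    using A(2) submetric_mspace[of "metric (M, d)"] by simp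
  then have c: "continuous_map M.mtopology N.mtopology g"
    using Lipschitz_continuous_imp_continuous_map by fastforce
  have gM: "g ` M \<subseteq> N" using Lipschitz_continuous_map_image[OF L] by auto
  have "continuous_map M.mtopology euclidean (\<lambda>x. e (g x) (g a))" if "a \<in> M" for a
    using continuous_map_mdist[of M.mtopology "metric (N, e)" g "\<lambda>_. g a"] c image_subset_iff[THEN iffD1, OF gM] that by simp
  moreover have "continuous_map M.mtopology euclidean (\<lambda>x. d x a)" if "a \<in> M" for a
    using continuous_map_mdist[of M.mtopology "metric (M, d)" "\<lambda>x. x" "\<lambda>_. a"] that by simp
  \<comment> \<open>With \<open>a\<close> fixed, both distances are continuous in \<open>x\<close>,
    so agreement on the dense set spreads to all of \<open>M\<close>.\<close>
  ultimately have ext: "e (g x) (g a) = d x a"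
    if "x \<in> M" "a \<in> M" "\<And>y. y \<in> A \<Longrightarrow> e (g y) (g a) = d y a" for x a
    using forall_in_closure_of_eq[of x M.mtopology A euclideanreal "\<lambda>x. e (g x) (g a)" "\<lambda>x. d x a"]
      that A(2) by simp
  have "e (g x) (g a) = d x a" if "x \<in> M" "a \<in> A" for x a
    using ext[of x a] that A(1) iso gf by auto
  \<comment> \<open>Symmetry swaps the arguments, so the same principle now frees the second
    one.\<close>
  then have "e (g x) (g y) = d x y" if "x \<in> M" "y \<in> M" for x y
    using ext[of x y] that A(1) M.commute N.commute by (metis subsetD)
  then show thesis using that gM gf by blast
qed

section \<open>Continuous structures\<close>

lemma is_cstructureD:
  assumes "is_cstructure \<tau> M"
  shows "is_structure \<tau> M" "unit_valued \<tau> M"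
    "Metric_space (univ M) (sdist \<tau> M)" "Metric_space.mcomplete (univ M) (sdist \<tau> M)"
    "\<And>F. F \<in> fsyms \<tau> \<Longrightarrow> continuous_map (tuple_top \<tau> M (farity \<tau> F)) (stop \<tau> M)
        (\<lambda>t. fn M F (map t [0..<farity \<tau> F]))"
    "\<And>R. R \<in> rsyms \<tau> \<Longrightarrow> continuous_map (tuple_top \<tau> M (rarity \<tau> R)) euclideanreal
        (\<lambda>t. rl M R (map t [0..<rarity \<tau> R]))"
  using assms unfolding is_cstructure_def unit_valued_def by blast+

lemma topspace_stop: "is_cstructure \<tau> M \<Longrightarrow> topspace (stop \<tau> M) = univ M"
  by (simp add: stop_def Metric_space.topspace_mtopology is_cstructureD(3))

lemma Hausdorff_stop: "is_cstructure \<tau> M \<Longrightarrow> Hausdorff_space (stop \<tau> M)"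
  by (simp add: stop_def Metric_space.Hausdorff_space_mtopology is_cstructureD(3))

lemma map_upt_in_tuples: "t \<in> {..<n} \<rightarrow> A \<Longrightarrow> map t [0..<n] \<in> tuples n A"
  by (auto simp: tuples_def)

text \<open>The topology on tuples lives on extensional functions, the interpretations on lists;
  this passes from a list to the function representing it.\<close>

lemma tuple_as_map:
  assumes "xs \<in> tuples n A"
  shows "restrict (nth xs) {..<n} \<in> {..<n} \<rightarrow>\<^sub>E A" "map (restrict (nth xs) {..<n}) [0..<n] = xs"
proof -
  show "restrict (nth xs) {..<n} \<in> {..<n} \<rightarrow>\<^sub>E A"
    using assms by (auto simp: tuples_def)
  show "map (restrict (nth xs) {..<n}) [0..<n] = xs"
    using assms by (intro nth_equalityI) (auto simp: tuples_def)
qed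

text \<open>The metric is itself a relation symbol, so an embedding of structures is an
  isometry.\<close>

lemma sdist_eq:
  assumes "continuous_lang \<tau>" "embeds \<tau> g N M" "x \<in> univ N" "y \<in> univ N"
  shows "sdist \<tau> M (g x) (g y) = sdist \<tau> N x y"
proof -
  have "[x, y] \<in> tuples (rarity \<tau> (dsym \<tau>)) (univ N)" "dsym \<tau> \<in> rsyms \<tau>"
    using assms by (auto simp: tuples_def continuous_lang_def)
  then show ?thesis
    using embedsD(2,4)[OF assms(2)] assms(3,4) unfolding sdist_def by force
qed

text \<open>The axioms are pulled back along the injective isometry \<open>g\<close>; pairs off the
  universe have distance 0 by the convention of \<open>sdist\<close>.\<close>

lemma embeds_Metric_space:
  assumes \<tau>: "continuous_lang \<tau>" and M: "is_cstructure \<tau> M" and g: "embeds \<tau> g N M"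
  shows "Metric_space (univ N) (sdist \<tau> N)"
proof -
  interpret M: Metric_space "univ M" "sdist \<tau> M" by (rule is_cstructureD(3)[OF M])
  note eq = sdist_eq[OF \<tau> g, symmetric]
  have gM: "x \<in> univ N \<Longrightarrow> g x \<in> univ M" for x using embedsD(2)[OF g] by blast
  have off: "sdist \<tau> N x y = 0" if "\<not> (x \<in> univ N \<and> y \<in> univ N)" for x y
    using that by (auto simp: sdist_def)
  show ?thesis
  proof
    show "0 \<le> sdist \<tau> N x y" for x y
      using eq[of x y] off[of x y] by (cases "x \<in> univ N \<and> y \<in> univ N") auto
    show "sdist \<tau> N x y = sdist \<tau> N y x" for x y
      using eq[of x y] eq[of y x] off[of x y] off[of y x] M.commute[of "g x" "g y"]
      by (cases "x \<in> univ N \<and> y \<in> univ N") auto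
    show "sdist \<tau> N x y = 0 \<longleftrightarrow> x = y" if "x \<in> univ N" "y \<in> univ N" for x y
      using eq[OF that] gM that embedsD(1)[OF g] by (simp add: inj_on_eq_iff)
    show "sdist \<tau> N x z \<le> sdist \<tau> N x y + sdist \<tau> N y z"
      if "x \<in> univ N" "y \<in> univ N" "z \<in> univ N" for x y z
      using eq that gM M.triangle by simp
  qed
qed

lemma embeds_embedding_map:
  assumes \<tau>: "continuous_lang \<tau>" and M: "is_cstructure \<tau> M" and g: "embeds \<tau> g N M"
  shows "embedding_map (stop \<tau> N) (stop \<tau> M) g"
proof -
  interpret Metric_space12 "univ N" "sdist \<tau> N" "univ M" "sdist \<tau> M"
    using embeds_Metric_space[OF assms] is_cstructureD(3)[OF M] by (simp add: Metric_space12_def)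
  show ?thesis
    unfolding stop_def
    by (rule isometry_imp_embedding_map) (use embedsD(2)[OF g] sdist_eq[OF \<tau> g] in auto)
qed

lemma embeds_continuous_map:
  assumes "continuous_lang \<tau>" "is_cstructure \<tau> M" "embeds \<tau> g N M"
  shows "continuous_map (stop \<tau> N) (stop \<tau> M) g"
  using embeds_embedding_map[OF assms] unfolding embedding_map_def
  by (meson continuous_map_in_subtopology homeomorphic_imp_continuous_map)

text \<open>Compose with the inverse of the homeomorphism from \<open>Y\<close> onto its
  image.\<close>

lemma continuous_map_into_embedding:
  assumes "embedding_map Y Z g" "continuous_map X Z (g \<circ> f)" "f ` topspace X \<subseteq> topspace Y"
  shows "continuous_map X Y f"
proof -
  obtain h where h: "homeomorphic_maps Y (subtopology Z (g ` topspace Y)) g h"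
    using assms(1) unfolding embedding_map_def homeomorphic_map_maps by blast
  have "continuous_map X (subtopology Z (g ` topspace Y)) (g \<circ> f)"
    using assms(2,3) by (auto simp: continuous_map_in_subtopology)
  then have "continuous_map X Y (h \<circ> (g \<circ> f))"
    using h continuous_map_compose unfolding homeomorphic_maps_def by blast
  then show ?thesis
    by (rule continuous_map_eq) (use h assms(3) in \<open>auto simp: homeomorphic_maps_def\<close>)
qed

lemma topspace_tuple_top:
  "topspace (tuple_top \<tau> M n) = {..<n} \<rightarrow>\<^sub>E topspace (stop \<tau> M)"
  by (simp add: tuple_top_def)

lemma continuous_map_tuple_top:
  assumes "continuous_map (stop \<tau> N) (stop \<tau> M) g"
  shows "continuous_map (tuple_top \<tau> N n) (tuple_top \<tau> M n) (\<lambda>t. restrict (g \<circ> t) {..<n})"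
  unfolding tuple_top_def continuous_map_componentwise
proof (intro conjI ballI)
  show "(\<lambda>t. restrict (g \<circ> t) {..<n}) ` topspace (product_topology (\<lambda>_. stop \<tau> N) {..<n})
      \<subseteq> extensional {..<n}" by auto
  fix k assume k: "k \<in> {..<n}"
  have "continuous_map (product_topology (\<lambda>_. stop \<tau> N) {..<n}) (stop \<tau> M) (g \<circ> (\<lambda>t. t k))"
    using continuous_map_product_projection[OF k, of "\<lambda>_. stop \<tau> N"] assms by (rule continuous_map_compose)
  then show "continuous_map (product_topology (\<lambda>_. stop \<tau> N) {..<n}) (stop \<tau> M)
      (\<lambda>t. restrict (g \<circ> t) {..<n} k)"
    using k by (simp add: o_def)
qed

lemma map_restrict_upt: "map (restrict f {..<n}) [0..<n] = map f [0..<n]"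
  by simp

lemma continuous_fn_comp:
  assumes "is_cstructure \<tau> M" "continuous_map (stop \<tau> N) (stop \<tau> M) g" "F \<in> fsyms \<tau>"
  shows "continuous_map (tuple_top \<tau> N (farity \<tau> F)) (stop \<tau> M)
    (\<lambda>t. fn M F (map g (map t [0..<farity \<tau> F])))"
  using continuous_map_compose[OF continuous_map_tuple_top[OF assms(2)] is_cstructureD(5)[OF assms(1,3)]]
  unfolding comp_def map_restrict_upt by (simp add: comp_def)

lemma continuous_rl_comp:
  assumes "is_cstructure \<tau> M" "continuous_map (stop \<tau> N) (stop \<tau> M) g" "R \<in> rsyms \<tau>"
  shows "continuous_map (tuple_top \<tau> N (rarity \<tau> R)) euclideanreal
    (\<lambda>t. rl M R (map g (map t [0..<rarity \<tau> R])))"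
  using continuous_map_compose[OF continuous_map_tuple_top[OF assms(2)] is_cstructureD(6)[OF assms(1,3)]]
  unfolding comp_def map_restrict_upt by (simp add: comp_def)

text \<open>Unit values and continuity of the symbols are inherited through the embedding. What
  remains is completeness, and inside the complete \<open>M\<close> that is closedness of the
  image.\<close>

lemma embeds_is_cstructure_iff:
  assumes \<tau>: "continuous_lang \<tau>" and M: "is_cstructure \<tau> M" and g: "embeds \<tau> g N M"
    and N: "is_structure \<tau> N"
  shows "is_cstructure \<tau> N \<longleftrightarrow> closedin (stop \<tau> M) (g ` univ N)"
proof -
  have ms: "Metric_space (univ N) (sdist \<tau> N)" by (rule embeds_Metric_space[OF \<tau> M g])
  have top: "topspace (stop \<tau> N) = univ N"
    by (simp add: stop_def Metric_space.topspace_mtopology[OF ms])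
  note cg = embeds_continuous_map[OF \<tau> M g]
  have t: "map t [0..<n] \<in> tuples n (univ N)" if "t \<in> topspace (tuple_top \<tau> N n)" for t n
    using that map_upt_in_tuples[of t n "univ N"] by (auto simp: topspace_tuple_top top)
  have "rl N R xs \<in> {0..1}" if "R \<in> rsyms \<tau>" "xs \<in> tuples (rarity \<tau> R) (univ N)" for R xs
    using that embedsD(4)[OF g that] is_cstructureD(2)[OF M] map_in_tuples[OF that(2) embedsD(2)[OF g]]
    unfolding unit_valued_def by simp
  moreover have "continuous_map (tuple_top \<tau> N (farity \<tau> F)) (stop \<tau> N)
      (\<lambda>t. fn N F (map t [0..<farity \<tau> F]))" if F: "F \<in> fsyms \<tau>" for F
  proof (rule continuous_map_into_embedding[OF embeds_embedding_map[OF \<tau> M g]])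
    show "continuous_map (tuple_top \<tau> N (farity \<tau> F)) (stop \<tau> M)
        (g \<circ> (\<lambda>t. fn N F (map t [0..<farity \<tau> F])))"
      by (rule continuous_map_eq[OF continuous_fn_comp[OF M cg F]])
        (simp only: comp_apply embedsD(3)[OF g F t])
    show "(\<lambda>t. fn N F (map t [0..<farity \<tau> F])) ` topspace (tuple_top \<tau> N (farity \<tau> F))
        \<subseteq> topspace (stop \<tau> N)"
      using t is_structureD(3)[OF N F] top by blast
  qed
  moreover have "continuous_map (tuple_top \<tau> N (rarity \<tau> R)) euclideanreal
      (\<lambda>t. rl N R (map t [0..<rarity \<tau> R]))" if R: "R \<in> rsyms \<tau>" for R
    by (rule continuous_map_eq[OF continuous_rl_comp[OF M cg R]])
      (simp only: embedsD(4)[OF g R t])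
  ultimately have "is_cstructure \<tau> N \<longleftrightarrow> Metric_space.mcomplete (univ N) (sdist \<tau> N)"
    using N ms unfolding is_cstructure_def by blast
  also have "\<dots> \<longleftrightarrow> closedin (stop \<tau> M) (g ` univ N)"
    unfolding stop_def
    by (rule isometry_complete_iff[OF ms is_cstructureD(3)[OF M] embedsD(2)[OF g]
        sdist_eq[OF \<tau> g] is_cstructureD(4)[OF M]])
  finally show ?thesis .
qed

text \<open>The inverse isomorphism embeds \<open>N\<close> into \<open>M\<close> with image the
  whole space, which is closed.\<close>

lemma is_cstructure_isomorphic:
  assumes "continuous_lang \<tau>" "is_cstructure \<tau> M" "isomorphism \<tau> g M N" "is_structure \<tau> N"
  shows "is_cstructure \<tau> N"
proof -
  let ?h = "inv_into (univ M) g"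
  have i: "isomorphism \<tau> ?h N M"
    by (rule isomorphism_inv[OF assms(3) is_cstructureD(1)[OF assms(2)]])
  then have "?h ` univ N = topspace (stop \<tau> M)"
    using isomorphismD(3) topspace_stop[OF assms(2)] by metis
  then have "closedin (stop \<tau> M) (?h ` univ N)" by (metis closedin_topspace)
  then show ?thesis
    using embeds_is_cstructure_iff[OF assms(1,2) _ assms(4)] i unfolding isomorphism_iff_embeds by blast
qed

lemma isomorphism_homeomorphic_map:
  assumes "continuous_lang \<tau>" "is_cstructure \<tau> M" "is_cstructure \<tau> N" "isomorphism \<tau> g M N"
  shows "homeomorphic_map (stop \<tau> M) (stop \<tau> N) g"
  using embeds_embedding_map[OF assms(1,3)] assms(4) surjective_embedding_map
    topspace_stop[OF assms(2)] topspace_stop[OF assms(3)]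
  unfolding isomorphism_iff_embeds by metis

lemma isomorphism_closure_of:
  assumes "continuous_lang \<tau>" "is_cstructure \<tau> M" "is_cstructure \<tau> N" "isomorphism \<tau> g M N"
    and "A \<subseteq> univ M"
  shows "stop \<tau> N closure_of (g ` A) = g ` (stop \<tau> M closure_of A)"
  using homeomorphic_map_closure_of[OF isomorphism_homeomorphic_map[OF assms(1-4)], of A]
    assms(5) topspace_stop[OF assms(2)] by simp

text \<open>Closure commutes with products, so tuples from \<open>A\<close> are dense among all
  tuples, and continuous maps into a Hausdorff space that agree on a dense set are equal. No modulus
  of continuity enters.\<close>

lemma tuples_dense_agree:
  assumes M: "is_cstructure \<tau> M" and A: "dense_in \<tau> M A" and Y: "Hausdorff_space Y"
    and u: "continuous_map (tuple_top \<tau> M n) Y (\<lambda>t. u (map t [0..<n]))"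
    and v: "continuous_map (tuple_top \<tau> M n) Y (\<lambda>t. v (map t [0..<n]))"
    and eq: "\<And>xs. xs \<in> tuples n A \<Longrightarrow> u xs = v xs" and xs: "xs \<in> tuples n (univ M)"
  shows "u xs = v xs"
proof -
  let ?t = "restrict (nth xs) {..<n}"
  have "?t \<in> {..<n} \<rightarrow>\<^sub>E univ M" by (rule tuple_as_map(1)[OF xs])
  then have "?t \<in> tuple_top \<tau> M n closure_of ({..<n} \<rightarrow>\<^sub>E A)"
    using A unfolding tuple_top_def closure_of_product_topology dense_in_def by simp
  then have "u (map ?t [0..<n]) = v (map ?t [0..<n])"
    by (rule forall_in_closure_of_eq[OF _ Y u v]) (auto intro!: eq map_upt_in_tuples)
  then show ?thesis by (simp only: tuple_as_map(2)[OF xs])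
qed

text \<open>As an isometry, \<open>f\<close> extends by completeness of \<open>P\<close>. Both sides
  of each preservation condition are continuous functions already defined on all of
  \<open>M\<close>, so they agree once they agree on \<open>A\<close>. No symbol has to be extended,
  which is why mere continuity suffices.\<close>

lemma embeds_extends:
  assumes \<tau>: "continuous_lang \<tau>" and M: "is_cstructure \<tau> M" and P: "is_cstructure \<tau> P"
    and A: "dense_in \<tau> M A" "fn_closed \<tau> M A" and f: "embeds \<tau> f (restr \<tau> M A) P"
  obtains g where "embeds \<tau> g M P" "\<And>a. a \<in> A \<Longrightarrow> g a = f a"
proof -
  note sM = is_cstructureD(1)[OF M]
  have idA: "embeds \<tau> id (restr \<tau> M A) M"
    by (rule substructure_embeds[OF substructure_restr[OF sM A(2)]])
  have AM: "A \<subseteq> univ M" using A(1) unfolding dense_in_def by blast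
  obtain g where g: "g ` univ M \<subseteq> univ P" "\<And>x. x \<in> A \<Longrightarrow> g x = f x"
    "\<And>x y. x \<in> univ M \<Longrightarrow> y \<in> univ M \<Longrightarrow> sdist \<tau> P (g x) (g y) = sdist \<tau> M x y"
  proof (rule isometry_extends_to_closure[OF is_cstructureD(3)[OF M] is_cstructureD(3)[OF P]
        is_cstructureD(4)[OF P] AM, where f = f])
    show "Metric_space.mtopology (univ M) (sdist \<tau> M) closure_of A = univ M"
      using A(1) unfolding dense_in_def stop_def by blast
    show "f ` A \<subseteq> univ P" using embedsD(2)[OF f] by simp
    show "sdist \<tau> P (f x) (f y) = sdist \<tau> M x y" if "x \<in> A" "y \<in> A" for x y
      using sdist_eq[OF \<tau> f, of x y] sdist_eq[OF \<tau> idA, of x y] that by simp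
  qed blast
  interpret Metric_space12 "univ M" "sdist \<tau> M" "univ P" "sdist \<tau> P"
    using is_cstructureD(3)[OF M] is_cstructureD(3)[OF P] by (simp add: Metric_space12_def)
  have em: "embedding_map (stop \<tau> M) (stop \<tau> P) g"
    unfolding stop_def by (rule isometry_imp_embedding_map) (use g in auto)
  then have cg: "continuous_map (stop \<tau> M) (stop \<tau> P) g"
    unfolding embedding_map_def by (meson continuous_map_in_subtopology homeomorphic_imp_continuous_map)
  have map_g: "map g xs = map f xs" if "xs \<in> tuples n A" for xs n
    using that g(2) by (auto simp: tuples_def)
  have mem: "xs \<in> tuples n (univ M)" if "xs \<in> tuples n A" for xs n
    using that tuples_mono[OF AM] by blast
  have "g (fn M F xs) = fn P F (map g xs)"
    if F: "F \<in> fsyms \<tau>" and xs: "xs \<in> tuples (farity \<tau> F) (univ M)" for F xs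
  proof (rule tuples_dense_agree[OF M A(1) Hausdorff_stop[OF P] _ _ _ xs])
    show "continuous_map (tuple_top \<tau> M (farity \<tau> F)) (stop \<tau> P) (\<lambda>t. g (fn M F (map t [0..<farity \<tau> F])))"
      using continuous_map_compose[OF is_cstructureD(5)[OF M F] cg] by (simp add: comp_def)
    show "continuous_map (tuple_top \<tau> M (farity \<tau> F)) (stop \<tau> P) (\<lambda>t. fn P F (map g (map t [0..<farity \<tau> F])))"
      by (rule continuous_fn_comp[OF P cg F])
    fix ys assume ys: "ys \<in> tuples (farity \<tau> F) A"
    then have "fn M F ys \<in> A" using A(2) F unfolding fn_closed_def by blast
    then show "g (fn M F ys) = fn P F (map g ys)"
      using embedsD(3)[OF f F, of ys] ys F by (simp add: g(2) map_g[OF ys])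
  qed
  moreover have "rl M R xs = rl P R (map g xs)"
    if R: "R \<in> rsyms \<tau>" and xs: "xs \<in> tuples (rarity \<tau> R) (univ M)" for R xs
  proof (rule tuples_dense_agree[OF M A(1) Hausdorff_space_euclidean is_cstructureD(6)[OF M R]
        continuous_rl_comp[OF P cg R] _ xs])
    fix ys assume ys: "ys \<in> tuples (rarity \<tau> R) A"
    then show "rl M R ys = rl P R (map g ys)"
      using embedsD(4)[OF f R, of ys] R by (simp add: map_g[OF ys])
  qed
  moreover have "inj_on g (univ M)"
    using g(1,3) M1.zero by (intro inj_onI) (metis image_subset_iff M2.mdist_zero)
  ultimately have "embeds \<tau> g M P" using g(1) unfolding embeds_def by blast
  then show thesis using that g(2) by blast
qed

text \<open>A dense subset of a nonempty universe is nonempty, the extra clause of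
  \<open>fn_closed\<close>.\<close>

lemma nicely_dense_iff:
  assumes "is_cstructure \<tau> M"
  shows "nicely_dense \<tau> M A \<longleftrightarrow> dense_in \<tau> M A \<and> fn_closed \<tau> M A"
  using is_structureD(1)[OF is_cstructureD(1)[OF assms]]
  unfolding nicely_dense_def fn_closed_def dense_in_def by auto

lemma nicely_dense_univ: "is_cstructure \<tau> M \<Longrightarrow> nicely_dense \<tau> M (univ M)"
  using is_structureD(3)[OF is_cstructureD(1)] closure_of_topspace[of "stop \<tau> M"]
  unfolding nicely_dense_def dense_in_def by (metis order_refl topspace_stop)

text \<open>Completeness of \<open>M\<close> makes the image closed in \<open>P\<close>, and
  continuity keeps it within the closure of the image of \<open>A\<close>.\<close>

lemma embeds_dense_image:
  assumes \<tau>: "continuous_lang \<tau>" and M: "is_cstructure \<tau> M" and P: "is_cstructure \<tau> P"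
    and A: "dense_in \<tau> M A" and g: "embeds \<tau> g M P"
  shows "g ` univ M = stop \<tau> P closure_of (g ` A)"
proof
  show "g ` univ M \<subseteq> stop \<tau> P closure_of (g ` A)"
    using continuous_map_image_closure_subset[OF embeds_continuous_map[OF \<tau> P g], of A] A
    unfolding dense_in_def by simp
  have "closedin (stop \<tau> P) (g ` univ M)"
    using embeds_is_cstructure_iff[OF \<tau> P g is_cstructureD(1)[OF M]] M by blast
  then show "stop \<tau> P closure_of (g ` A) \<subseteq> g ` univ M"
    by (rule closure_of_minimal[rotated]) (use A in \<open>auto simp: dense_in_def\<close>)
qed

text \<open>Uniqueness of a structure over a nicely dense set: \<open>f\<close> extends to an
  embedding of \<open>M\<close> into \<open>P\<close>, and its image is the closure of
  \<open>B\<close>, that is, all of \<open>P\<close>.\<close>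

lemma isomorphism_extends:
  assumes \<tau>: "continuous_lang \<tau>" and M: "is_cstructure \<tau> M" and P: "is_cstructure \<tau> P"
    and A: "nicely_dense \<tau> M A" and B: "nicely_dense \<tau> P B"
    and f: "isomorphism \<tau> f (restr \<tau> M A) (restr \<tau> P B)"
  obtains g where "isomorphism \<tau> g M P" "\<And>a. a \<in> A \<Longrightarrow> g a = f a"
proof -
  note A' = A[unfolded nicely_dense_iff[OF M]] and B' = B[unfolded nicely_dense_iff[OF P]]
  have "embeds \<tau> id (restr \<tau> P B) P"
    using substructure_embeds substructure_restr is_cstructureD(1)[OF P] B' by blast
  with f have "embeds \<tau> (id \<circ> f) (restr \<tau> M A) P"
    unfolding isomorphism_iff_embeds using embeds_comp by blast
  then have "embeds \<tau> f (restr \<tau> M A) P" by simp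
  then obtain g where g: "embeds \<tau> g M P" "\<And>a. a \<in> A \<Longrightarrow> g a = f a"
    using embeds_extends[OF \<tau> M P] A' by metis
  have "g ` A = f ` A" using g(2) by simp
  also have "\<dots> = B" using isomorphismD(3)[OF f] by simp
  finally have "g ` univ M = univ P"
    using embeds_dense_image[OF \<tau> M P _ g(1)] A' B' unfolding dense_in_def by metis
  then show thesis using that g unfolding isomorphism_iff_embeds by blast
qed

section \<open>Closed hulls: completions computed inside a given structure\<close>

definition closed_hull :: "('f, 'r) clang \<Rightarrow> ('v, 'f, 'r) cstruct \<Rightarrow> 'v set \<Rightarrow> ('v, 'f, 'r) cstruct" where
  "closed_hull \<tau> M A = restr \<tau> M (stop \<tau> M closure_of A)"

lemma univ_closed_hull [simp]: "univ (closed_hull \<tau> M A) = stop \<tau> M closure_of A"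
  by (simp add: closed_hull_def)

lemma closure_of_subset_univ: "is_cstructure \<tau> M \<Longrightarrow> stop \<tau> M closure_of A \<subseteq> univ M"
  using closure_of_subset_topspace topspace_stop by metis

lemma subset_closure_of_univ: "is_cstructure \<tau> M \<Longrightarrow> A \<subseteq> univ M \<Longrightarrow> A \<subseteq> stop \<tau> M closure_of A"
  using closure_of_subset topspace_stop by metis

text \<open>A continuous function maps the closure of a set into the closure of its image; here the
  set is a finite power of \<open>A\<close>, which the function maps into \<open>A\<close>.\<close>

lemma fn_closed_closure:
  assumes M: "is_cstructure \<tau> M" and A: "fn_closed \<tau> M A"
  shows "fn_closed \<tau> M (stop \<tau> M closure_of A)"
  unfolding fn_closed_def
proof (intro conjI ballI)
  have AM: "A \<noteq> {}" "A \<subseteq> univ M" using A unfolding fn_closed_def by blast+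
  show "stop \<tau> M closure_of A \<noteq> {}" using subset_closure_of_univ[OF M AM(2)] AM(1) by blast
  show "stop \<tau> M closure_of A \<subseteq> univ M" by (rule closure_of_subset_univ[OF M])
  fix F xs assume F: "F \<in> fsyms \<tau>" and xs: "xs \<in> tuples (farity \<tau> F) (stop \<tau> M closure_of A)"
  let ?n = "farity \<tau> F" and ?t = "restrict (nth xs) {..<farity \<tau> F}"
  let ?f = "\<lambda>t. fn M F (map t [0..<?n])"
  have "?t \<in> tuple_top \<tau> M ?n closure_of ({..<?n} \<rightarrow>\<^sub>E A)"
    unfolding tuple_top_def closure_of_product_topology using tuple_as_map(1)[OF xs] by simp
  then have "?f ?t \<in> stop \<tau> M closure_of ?f ` ({..<?n} \<rightarrow>\<^sub>E A)"
    using continuous_map_image_closure_subset[OF is_cstructureD(5)[OF M F]] by blast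
  moreover have "?f ` ({..<?n} \<rightarrow>\<^sub>E A) \<subseteq> A"
    using A F map_upt_in_tuples[of _ ?n A] unfolding fn_closed_def by (auto simp: PiE_def)
  ultimately have "?f ?t \<in> stop \<tau> M closure_of A"
    using closure_of_mono by blast
  then show "fn M F xs \<in> stop \<tau> M closure_of A"
    by (simp only: tuple_as_map(2)[OF xs])
qed

lemma substructure_is_cstructure_iff:
  assumes "continuous_lang \<tau>" "is_cstructure \<tau> M" "substructure \<tau> N M"
  shows "is_cstructure \<tau> N \<longleftrightarrow> closedin (stop \<tau> M) (univ N)"
  using embeds_is_cstructure_iff[OF assms(1,2) substructure_embeds[OF assms(3)] substructureD(1)[OF assms(3)]]
  by simp

lemma stop_substructure:
  assumes "continuous_lang \<tau>" "is_cstructure \<tau> M" "substructure \<tau> N M"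
  shows "stop \<tau> N = subtopology (stop \<tau> M) (univ N)"
proof -
  have "Metric_space (univ N) (sdist \<tau> N)"
    by (rule embeds_Metric_space[OF assms(1,2) substructure_embeds[OF assms(3)]])
  then have top: "topspace (stop \<tau> N) = univ N"
    by (simp add: stop_def Metric_space.topspace_mtopology)
  have "homeomorphic_map (stop \<tau> N) (subtopology (stop \<tau> M) (univ N)) id"
    using embeds_embedding_map[OF assms(1,2) substructure_embeds[OF assms(3)]] top
    unfolding embedding_map_def by simp
  then show ?thesis by (simp add: homeomorphic_map_id)
qed

text \<open>The closure of a function-closed set serves as its completion inside \<open>M\<close>:
  the symbols are already defined there, and a closed substructure of a complete one is
  complete.\<close>

lemma closed_hull:
  assumes \<tau>: "continuous_lang \<tau>" and M: "is_cstructure \<tau> M" and A: "fn_closed \<tau> M A"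
  shows "substructure \<tau> (closed_hull \<tau> M A) M" "is_cstructure \<tau> (closed_hull \<tau> M A)" "nicely_dense \<tau> (closed_hull \<tau> M A) A"
    "restr \<tau> (closed_hull \<tau> M A) A = restr \<tau> M A"
proof -
  have AM: "A \<noteq> {}" "A \<subseteq> univ M" using A unfolding fn_closed_def by blast+
  note sub = subset_closure_of_univ[OF M AM(2)]
  show s: "substructure \<tau> (closed_hull \<tau> M A) M"
    unfolding closed_hull_def by (rule substructure_restr[OF is_cstructureD(1)[OF M] fn_closed_closure[OF M A]])
  show c: "is_cstructure \<tau> (closed_hull \<tau> M A)"
    using substructure_is_cstructure_iff[OF \<tau> M s] by simp
  show "nicely_dense \<tau> (closed_hull \<tau> M A) A"
    unfolding nicely_dense_iff[OF c] dense_in_def stop_substructure[OF \<tau> M s]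
    using sub fn_closed_restr[OF sub A] 
    by (simp add: closure_of_subtopology Int_absorb1 closed_hull_def[symmetric])
  show "restr \<tau> (closed_hull \<tau> M A) A = restr \<tau> M A"
    unfolding closed_hull_def by (rule restr_restr[OF sub])
qed

text \<open>\<open>N\<close> is complete, hence closed in \<open>M\<close>, so the closure taken in
  \<open>M\<close> does not leave \<open>N\<close>.\<close>

lemma closure_of_substructure:
  assumes \<tau>: "continuous_lang \<tau>" and M: "is_cstructure \<tau> M" and N: "is_cstructure \<tau> N"
    and s: "substructure \<tau> N M" and A: "A \<subseteq> univ N"
  shows "stop \<tau> N closure_of A = stop \<tau> M closure_of A"
proof -
  have "closedin (stop \<tau> M) (univ N)"
    using substructure_is_cstructure_iff[OF \<tau> M s] N by blast
  then have "stop \<tau> M closure_of A \<subseteq> univ N" using A by (rule closure_of_minimal[rotated])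
  then show ?thesis
    using A by (simp add: stop_substructure[OF \<tau> M s] closure_of_subtopology Int_absorb1)
qed

text \<open>A continuous substructure is recovered from any of its dense subsets. Relations between
  strong substructures of \<open>M\<close> thus become relations between subsets.\<close>

lemma dense_substructure_eq_hull:
  assumes "continuous_lang \<tau>" "is_cstructure \<tau> M" "is_cstructure \<tau> N"
    and s: "substructure \<tau> N M" and A: "dense_in \<tau> N A"
  shows "N = closed_hull \<tau> M A"
proof -
  have "A \<subseteq> univ N" "stop \<tau> N closure_of A = univ N" using A unfolding dense_in_def by blast+
  then show ?thesis
    using closure_of_substructure[OF assms(1-4), of A] substructureD(7)[OF s] unfolding closed_hull_def by simp
qed

lemma isomorphism_closed_hull:
  assumes \<tau>: "continuous_lang \<tau>" and M: "is_cstructure \<tau> M" and N: "is_cstructure \<tau> N"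
    and g: "isomorphism \<tau> g M N" and A: "fn_closed \<tau> M A"
  shows "isomorphism \<tau> g (closed_hull \<tau> M A) (closed_hull \<tau> N (g ` A))"
  using isomorphism_restr(1)[OF g fn_closed_closure[OF M A]] isomorphism_closure_of[OF \<tau> M N g] A
  unfolding closed_hull_def fn_closed_def by simp

lemma isomorphism_nicely_dense:
  assumes \<tau>: "continuous_lang \<tau>" and M: "is_cstructure \<tau> M" and N: "is_cstructure \<tau> N"
    and g: "isomorphism \<tau> g M N" and A: "nicely_dense \<tau> M A"
  shows "nicely_dense \<tau> N (g ` A)"
proof -
  note A' = A[unfolded nicely_dense_iff[OF M]]
  have "stop \<tau> N closure_of (g ` A) = univ N"
    using isomorphism_closure_of[OF \<tau> M N g, of A] A' isomorphismD(3)[OF g]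
    unfolding dense_in_def by simp
  then show ?thesis
    using isomorphism_restr(2)[OF g, of A] A' unfolding nicely_dense_iff[OF N] dense_in_def fn_closed_def
    by blast
qed

section \<open>Dense substructures\<close>

text \<open>This is the structure \<open>M_A\<close> of the correspondence.\<close>

definition down ::
    "('f, 'r) clang \<Rightarrow> ('v, 'f, 'r) cstruct \<Rightarrow> 'v set \<Rightarrow> ('v, 'f plus_fun, 'r plus_rel) dstruct" where
  "down \<tau> M A = disc \<tau> (restr \<tau> M A)"

lemma univ_down [simp]: "univ (down \<tau> M A) = A"
  by (simp add: down_def)

lemma unit_valued_restr:
  assumes "is_cstructure \<tau> M" "A \<subseteq> univ M"
  shows "unit_valued \<tau> (restr \<tau> M A)"
  using is_cstructureD(2)[OF assms(1)] tuples_mono[OF assms(2)] unfolding unit_valued_def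
  by (auto simp del: atLeastAtMost_iff)

lemma restr_dense:
  assumes "is_cstructure \<tau> M" "fn_closed \<tau> M A"
  shows "is_structure \<tau> (restr \<tau> M A)" "unit_valued \<tau> (restr \<tau> M A)"
proof -
  show "is_structure \<tau> (restr \<tau> M A)"
    by (rule is_structure_restr[OF is_cstructureD(1)[OF assms(1)] assms(2)])
  show "unit_valued \<tau> (restr \<tau> M A)"
    using assms unit_valued_restr unfolding fn_closed_def by blast
qed

lemma is_structure_down:
  "is_cstructure \<tau> M \<Longrightarrow> fn_closed \<tau> M A \<Longrightarrow> is_structure (plus_lang \<tau>) (down \<tau> M A)"
  unfolding down_def by (rule is_structure_disc[OF restr_dense(1)])

lemma substructure_down_iff:
  assumes "is_cstructure \<tau> M" "fn_closed \<tau> M A" "is_cstructure \<tau> N" "fn_closed \<tau> N B"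
  shows "substructure (plus_lang \<tau>) (down \<tau> M A) (down \<tau> N B)
    \<longleftrightarrow> substructure \<tau> (restr \<tau> M A) (restr \<tau> N B)"
  unfolding down_def using substructure_disc_iff restr_dense[OF assms(1,2)] restr_dense[OF assms(3,4)] by blast

lemma isomorphism_down_iff:
  assumes "is_cstructure \<tau> M" "fn_closed \<tau> M A" "is_cstructure \<tau> N" "fn_closed \<tau> N B"
  shows "isomorphism (plus_lang \<tau>) g (down \<tau> M A) (down \<tau> N B)
    \<longleftrightarrow> isomorphism \<tau> g (restr \<tau> M A) (restr \<tau> N B)"
  unfolding down_def using isomorphism_disc_iff restr_dense[OF assms(1,2)] restr_dense[OF assms(3,4)] by blast

lemma down_eq_iff:
  assumes "is_cstructure \<tau> M" "fn_closed \<tau> M A" "is_cstructure \<tau> N" "fn_closed \<tau> N B"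
  shows "down \<tau> M A = down \<tau> N B \<longleftrightarrow> restr \<tau> M A = restr \<tau> N B"
  using disc_inject restr_dense[OF assms(1,2)] restr_dense[OF assms(3,4)] unfolding down_def by metis

lemma nicely_denseD:
  assumes "is_cstructure \<tau> M" "nicely_dense \<tau> M A"
  shows "dense_in \<tau> M A" "fn_closed \<tau> M A" "A \<subseteq> univ M"
  using assms nicely_dense_iff[OF assms(1)] unfolding dense_in_def by blast+

section \<open>The class of dense substructures\<close>

text \<open>The assumption \<open>universe\<close> bounds the number of sequences from a small set,
  hence the size of its metric completion.\<close>

locale dense_MAEC = MAEC \<tau> K prec
  for \<tau> :: "('f, 'r) clang"
    and K :: "('v, 'f, 'r) cstruct set"
    and prec :: "('v, 'f, 'r) cstruct \<Rightarrow> ('v, 'f, 'r) cstruct \<Rightarrow> bool" (infix \<open>\<preceq>\<close> 50) +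
  assumes lang: "continuous_lang \<tau>"
    and universe: "small (A :: 'v set) \<Longrightarrow> |{s :: nat \<Rightarrow> 'v. range s \<subseteq> A}| <o |UNIV :: 'v set|"
begin

definition Kd :: "('v, 'f plus_fun, 'r plus_rel) dstruct set" where
  "Kd = {down \<tau> M A | M A. M \<in> K \<and> nicely_dense \<tau> M A}"

text \<open>Both sides are read inside one member \<open>N\<close> of \<open>K\<close>, so that
  transitivity, coherence and smoothness become statements about closed hulls of subsets of a single
  structure.\<close>

definition precd ::
    "('v, 'f plus_fun, 'r plus_rel) dstruct \<Rightarrow> ('v, 'f plus_fun, 'r plus_rel) dstruct \<Rightarrow> bool" where
  "precd \<A> \<B> \<longleftrightarrow> (\<exists>N B A. N \<in> K \<and> nicely_dense \<tau> N B \<and> fn_closed \<tau> N A \<and> A \<subseteq> B \<and>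
     closed_hull \<tau> N A \<preceq> N \<and> \<A> = down \<tau> N A \<and> \<B> = down \<tau> N B)"

text \<open>An arbitrary choice, harmless since any two candidates are isomorphic over the common
  dense set. Candidates contain the universe of \<open>\<A>\<close> literally, which is why the
  second half of (3) can be an equality.\<close>

definition up :: "('v, 'f plus_fun, 'r plus_rel) dstruct \<Rightarrow> ('v, 'f, 'r) cstruct" where
  "up \<A> = (SOME M. M \<in> K \<and> nicely_dense \<tau> M (univ \<A>) \<and> \<A> = down \<tau> M (univ \<A>))"

lemma up:
  assumes "\<A> \<in> Kd"
  shows "up \<A> \<in> K" "nicely_dense \<tau> (up \<A>) (univ \<A>)" "down \<tau> (up \<A>) (univ \<A>) = \<A>"
proof -
  have "\<exists>M. M \<in> K \<and> nicely_dense \<tau> M (univ \<A>) \<and> \<A> = down \<tau> M (univ \<A>)"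
    using assms unfolding Kd_def by auto
  from someI_ex[OF this] show "up \<A> \<in> K" "nicely_dense \<tau> (up \<A>) (univ \<A>)" "down \<tau> (up \<A>) (univ \<A>) = \<A>"
    unfolding up_def by auto
qed

lemma
  assumes "M \<preceq> N"
  shows prec_in_K: "M \<in> K" "N \<in> K"
  using partial_order assms unfolding partial_order_on_def preorder_on_def by auto

lemma prec_refl: "M \<in> K \<Longrightarrow> M \<preceq> M"
  using partial_order unfolding partial_order_on_def preorder_on_def refl_on_def by auto

lemma prec_trans: "M \<preceq> N \<Longrightarrow> N \<preceq> P \<Longrightarrow> M \<preceq> P"
  using partial_order unfolding partial_order_on_def preorder_on_def trans_def by auto

text \<open>The axiom \<open>LS\<close> provides an infinite cardinal realized as a relation on
  \<open>'v\<close>.\<close>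

lemma infinite_universe: "infinite (UNIV :: 'v set)"
proof
  assume fin: "finite (UNIV :: 'v set)"
  obtain \<kappa> :: "'v rel" where "Cinfinite \<kappa>"
    using LS unfolding is_LS_def LS_bound_def by blast
  then show False using finite_subset[OF subset_UNIV fin] unfolding cinfinite_def by blast
qed

text \<open>A small set removes too few elements to shrink an infinite universe, so the complement
  of the image of \<open>A\<close> still has full cardinality and receives \<open>M - A\<close>. The
  source type is arbitrary because an abstract completion has to be brought into \<open>'v\<close>
  as well.\<close>

lemma extend_inj_on:
  fixes f :: "'a \<Rightarrow> 'v"
  assumes f: "inj_on f A" and "A \<subseteq> M" and M: "|M| <o |UNIV :: 'v set|"
  obtains g where "inj_on g M" "\<And>a. a \<in> A \<Longrightarrow> g a = f a"
proof -
  have "|f ` A| \<le>o |M|"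
    using card_of_image[of f A] card_of_mono1[OF assms(2)] by (rule ordLeq_transitive)
  then have fA: "|f ` A| <o |UNIV :: 'v set|" using M by (rule ordLeq_ordLess_trans)
  have "\<not> |UNIV - f ` A| <o |UNIV :: 'v set|"
  proof
    assume "|UNIV - f ` A| <o |UNIV :: 'v set|"
    then have "|(UNIV - f ` A) \<union> f ` A| <o |UNIV :: 'v set|"
      using fA card_of_Un_ordLess_infinite[OF infinite_universe] by blast
    then show False by (simp add: ordLess_irreflexive)
  qed
  then have "|UNIV :: 'v set| \<le>o |UNIV - f ` A|"
    by (simp add: not_ordLess_iff_ordLeq card_of_Well_order)
  with M have "|M| <o |UNIV - f ` A|" by (rule ordLess_ordLeq_trans)
  then have "|M - A| \<le>o |UNIV - f ` A|"
    using card_of_mono1[of "M - A" M] ordLess_imp_ordLeq ordLeq_transitive by blast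
  then obtain h where h: "inj_on h (M - A)" "h ` (M - A) \<subseteq> UNIV - f ` A"
    unfolding card_of_ordLeq[symmetric] by blast
  let ?g = "\<lambda>x. if x \<in> A then f x else h x"
  have "inj_on ?g (A \<union> (M - A))"
    unfolding inj_on_Un
  proof (intro conjI)
    show "inj_on ?g A" using f by (simp cong: inj_on_cong)
    show "inj_on ?g (M - A)" using h(1) inj_on_cong[of "M - A" ?g h] by simp
    show "?g ` (A - (M - A)) \<inter> ?g ` (M - A - A) = {}" using h(2) by auto
  qed
  moreover have "A \<union> (M - A) = M" using assms(2) by blast
  ultimately have "inj_on ?g M" by simp
  then show thesis by (rule that) simp
qed

lemma K_copy:
  assumes M: "M \<in> K" and g: "inj_on g (univ M)"
  shows "image_struct \<tau> g M \<in> K" "isomorphism \<tau> g M (image_struct \<tau> g M)"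
proof -
  note c = structures[OF M]
  show i: "isomorphism \<tau> g M (image_struct \<tau> g M)" by (rule isomorphism_image[OF g])
  have "is_cstructure \<tau> (image_struct \<tau> g M)"
    by (rule is_cstructure_isomorphic[OF lang c i is_structure_image[OF is_cstructureD(1)[OF c]]])
  then show "image_struct \<tau> g M \<in> K" using i by (rule iso_closed[OF M])
qed

section \<open>Representations of encoded structures by members of \<open>K\<close>\<close>

lemma down_in_Kd: "M \<in> K \<Longrightarrow> nicely_dense \<tau> M A \<Longrightarrow> down \<tau> M A \<in> Kd"
  unfolding Kd_def by blast

lemma down_of_dense:
  assumes "down \<tau> M B = down \<tau> N B" "M \<in> K" "nicely_dense \<tau> M B" "N \<in> K" "nicely_dense \<tau> N B" "A \<subseteq> B"
  shows "restr \<tau> M A = restr \<tau> N A" "down \<tau> M A = down \<tau> N A"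
proof -
  have "restr \<tau> M B = restr \<tau> N B"
    using down_eq_iff nicely_denseD(2) structures assms by metis
  then show "restr \<tau> M A = restr \<tau> N A" using restr_restr[OF assms(6)] by metis
  then show "down \<tau> M A = down \<tau> N A" by (simp add: down_def)
qed

lemma isomorphism_of_down:
  assumes "isomorphism (plus_lang \<tau>) f (down \<tau> M A) (down \<tau> N B)"
    and "M \<in> K" "nicely_dense \<tau> M A" "N \<in> K" "nicely_dense \<tau> N B"
  obtains g where "isomorphism \<tau> g M N" "\<And>a. a \<in> A \<Longrightarrow> g a = f a"
proof -
  note M = structures[OF assms(2)] and N = structures[OF assms(4)]
  have "isomorphism \<tau> f (restr \<tau> M A) (restr \<tau> N B)"
    using assms(1) isomorphism_down_iff[OF M nicely_denseD(2)[OF M assms(3)] N nicely_denseD(2)[OF N assms(5)]]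
    by blast
  then show thesis by (rule isomorphism_extends[OF lang M N assms(3,5)]) (use that in blast)
qed

text \<open>The identity of \<open>B\<close> extends to an isomorphism between the two ambient
  structures. It fixes the smaller set pointwise, hence carries closed hull to closed hull, and the
  strong substructure relation is preserved.\<close>

lemma precd_rep:
  assumes "precd \<A> (down \<tau> N B)" "N \<in> K" "nicely_dense \<tau> N B"
  shows "fn_closed \<tau> N (univ \<A>)" "univ \<A> \<subseteq> B" "\<A> = down \<tau> N (univ \<A>)"
    "closed_hull \<tau> N (univ \<A>) \<preceq> N"
proof -
  obtain N' B' A where N': "N' \<in> K" "nicely_dense \<tau> N' B'" and A: "fn_closed \<tau> N' A" "A \<subseteq> B'"
    and p: "closed_hull \<tau> N' A \<preceq> N'" and eq: "\<A> = down \<tau> N' A" "down \<tau> N B = down \<tau> N' B'"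
    using assms(1) unfolding precd_def by blast
  have B: "B' = B" using arg_cong[OF eq(2), of univ] by simp
  note N'_ = N'(2)[unfolded B] and eq' = eq(2)[unfolded B] and AB = A(2)[unfolded B]
  have "isomorphism (plus_lang \<tau>) id (down \<tau> N' B) (down \<tau> N B)"
    using isomorphism_refl eq' by metis
  then obtain g where g: "isomorphism \<tau> g N' N" "\<And>b. b \<in> B \<Longrightarrow> g b = id b"
    using isomorphism_of_down[OF _ N'(1) N'_ assms(2,3)] by blast
  have gA: "g ` A = A" using g(2) AB by force
  note c = structures[OF N'(1)] structures[OF assms(2)]
  have U: "univ \<A> = A" by (simp add: eq(1))
  show cl: "fn_closed \<tau> N (univ \<A>)" using isomorphism_restr(2)[OF g(1) A(1)] by (simp add: gA U)
  show "univ \<A> \<subseteq> B" by (simp add: U AB)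
  show "\<A> = down \<tau> N (univ \<A>)"
    using down_of_dense(2)[OF eq'[symmetric] N'(1) N'_ assms(2,3) AB] eq(1) U by simp
  have "isomorphism \<tau> g (closed_hull \<tau> N' A) (closed_hull \<tau> N A)"
    using isomorphism_closed_hull[OF lang c g(1) A(1)] by (simp add: gA)
  with p show "closed_hull \<tau> N (univ \<A>) \<preceq> N"
    unfolding U using prec_iso_closed closed_hull(2)[OF lang c(2)] cl[unfolded U] c(2) g(1) by blast
qed

lemma precd_downI:
  assumes "N \<in> K" "nicely_dense \<tau> N B" "fn_closed \<tau> N A" "A \<subseteq> B" "closed_hull \<tau> N A \<preceq> N"
  shows "precd (down \<tau> N A) (down \<tau> N B)"
  using assms unfolding precd_def by blast

text \<open>By density of \<open>A\<close> in \<open>M\<close>, the structure \<open>M\<close> is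
  the closed hull of \<open>A\<close> in \<open>N\<close>, the form demanded by
  \<open>precd\<close>.\<close>

lemma precd_downI':
  assumes "M \<preceq> N" "nicely_dense \<tau> M A" "nicely_dense \<tau> N B" "A \<subseteq> B"
  shows "precd (down \<tau> M A) (down \<tau> N B)"
proof -
  note K = prec_in_K[OF assms(1)] and s = prec_substructure[OF assms(1)]
  note c = structures[OF K(1)] structures[OF K(2)]
  have h: "M = closed_hull \<tau> N A"
    by (rule dense_substructure_eq_hull[OF lang c(2,1) s nicely_denseD(1)[OF c(1) assms(2)]])
  have r: "restr \<tau> N A = restr \<tau> M A"
    using restr_restr[OF nicely_denseD(3)[OF c(1) assms(2)], of \<tau> N] substructureD(7)[OF s] by simp
  have "fn_closed \<tau> N A"
    using fn_closed_of_restr[of \<tau> N "univ M" A] nicely_denseD(2)[OF c(1) assms(2)]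
      substructureD(3,7)[OF s] by simp
  then show ?thesis
    using precd_downI[OF K(2) assms(3) _ assms(4)] h assms(1) r unfolding down_def by metis
qed

lemma precd_obtain_rep:
  assumes "precd \<A> \<B>"
  obtains N where "N \<in> K" "nicely_dense \<tau> N (univ \<B>)" "\<B> = down \<tau> N (univ \<B>)"
    "fn_closed \<tau> N (univ \<A>)" "univ \<A> \<subseteq> univ \<B>" "\<A> = down \<tau> N (univ \<A>)"
    "closed_hull \<tau> N (univ \<A>) \<preceq> N"
  using assms unfolding precd_def by force

lemma precd_in_Kd:
  assumes "precd \<A> \<B>"
  shows "\<A> \<in> Kd" "\<B> \<in> Kd"
proof -
  obtain N where N: "N \<in> K" "nicely_dense \<tau> N (univ \<B>)" "\<B> = down \<tau> N (univ \<B>)"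
    "fn_closed \<tau> N (univ \<A>)" "\<A> = down \<tau> N (univ \<A>)" "closed_hull \<tau> N (univ \<A>) \<preceq> N"
    using precd_obtain_rep[OF assms] by metis
  show "\<B> \<in> Kd" using N(1-3) down_in_Kd by metis
  note h = closed_hull[OF lang structures[OF N(1)] N(4)]
  have "down \<tau> (closed_hull \<tau> N (univ \<A>)) (univ \<A>) = \<A>"
    using N(5) h(4) unfolding down_def by simp
  then show "\<A> \<in> Kd" using down_in_Kd[OF prec_in_K(1)[OF N(6)] h(3)] by simp
qed

lemma precd_substructure: "precd \<A> \<B> \<Longrightarrow> substructure (plus_lang \<tau>) \<A> \<B>"
proof (erule precd_obtain_rep)
  fix N assume N: "N \<in> K" "nicely_dense \<tau> N (univ \<B>)" "\<B> = down \<tau> N (univ \<B>)"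
    "fn_closed \<tau> N (univ \<A>)" "univ \<A> \<subseteq> univ \<B>" "\<A> = down \<tau> N (univ \<A>)"
  note c = structures[OF N(1)]
  have B: "fn_closed \<tau> N (univ \<B>)" by (rule nicely_denseD(2)[OF c N(2)])
  have "substructure (plus_lang \<tau>) (down \<tau> N (univ \<A>)) (down \<tau> N (univ \<B>))"
    unfolding substructure_down_iff[OF c N(4) c B]
    by (rule substructure_restr_mono[OF is_cstructureD(1)[OF c] N(4) B N(5)])
  then show "substructure (plus_lang \<tau>) \<A> \<B>" using N(3,6) by simp
qed

text \<open>On \<open>A\<close> the maps \<open>f\<close> and \<open>g\<close> coincide, so
  \<open>f\<close> carries the encoding both to \<open>\<B>\<close> and to the encoding induced by
  \<open>N\<close>; a bijection leaves only one structure on its image.\<close>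

lemma down_image:
  assumes M: "is_cstructure \<tau> M" and N: "is_cstructure \<tau> N" and g: "isomorphism \<tau> g M N"
    and A: "nicely_dense \<tau> M A" and gf: "\<And>a. a \<in> A \<Longrightarrow> g a = f a"
    and f: "isomorphism (plus_lang \<tau>) f (down \<tau> M A) \<B>" and \<B>: "is_structure (plus_lang \<tau>) \<B>"
  shows "nicely_dense \<tau> N (f ` A)" "\<B> = down \<tau> N (f ` A)"
proof -
  note cl = nicely_denseD(2)[OF M A]
  have gA: "g ` A = f ` A" using gf by simp
  show nd: "nicely_dense \<tau> N (f ` A)"
    using isomorphism_nicely_dense[OF lang M N g A] gA by simp
  note cl' = nicely_denseD(2)[OF N nd]
  have "isomorphism (plus_lang \<tau>) g (down \<tau> M A) (down \<tau> N (f ` A))"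
    using isomorphism_restr(1)[OF g cl] gA isomorphism_down_iff[OF M cl N cl'] by simp
  then have "isomorphism (plus_lang \<tau>) f (down \<tau> M A) (down \<tau> N (f ` A))"
    using isomorphism_cong[of "down \<tau> M A" g f "plus_lang \<tau>"] is_structure_down[OF M cl] gf by simp
  then show "\<B> = down \<tau> N (f ` A)"
    using isomorphism_image_unique[OF f _ \<B> is_structure_down[OF N cl']] by blast
qed

text \<open>\<open>f\<close> is prescribed on the dense set alone. It is extended to an injection of
  all of \<open>M\<close>, for which the universe has room, and \<open>N\<close> is the copy of
  \<open>M\<close> along that injection.\<close>

lemma copy_of_isomorphic_down:
  assumes "M \<in> K" "nicely_dense \<tau> M A" "is_structure (plus_lang \<tau>) \<B>"
    and f: "isomorphism (plus_lang \<tau>) f (down \<tau> M A) \<B>"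
  obtains N g where "N \<in> K" "isomorphism \<tau> g M N" "\<And>a. a \<in> A \<Longrightarrow> g a = f a"
    "nicely_dense \<tau> N (f ` A)" "\<B> = down \<tau> N (f ` A)" 
proof -
  note M = structures[OF assms(1)] and A = nicely_denseD[OF structures[OF assms(1)] assms(2)]
  have inj: "inj_on f A" using isomorphismD(2)[OF f] by simp
  have "|univ M| <o |UNIV :: 'v set|"
    using is_structureD(2)[OF is_cstructureD(1)[OF M]] unfolding small_def .
  with inj A(3) obtain g where g: "inj_on g (univ M)" "\<And>a. a \<in> A \<Longrightarrow> g a = f a"
    by (rule extend_inj_on) blast
  note N = K_copy[OF assms(1) g(1)]
  note d = down_image[OF M structures[OF N(1)] N(2) assms(2) g(2) f assms(3)]
  show thesis by (rule that[OF N g(2) d])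
qed

text \<open>Working form of \<open>precd\<close>: once a representation of \<open>\<B>\<close> is
  fixed, the closed hull of the smaller set inside it is a strong substructure representing
  \<open>\<A>\<close>.\<close>

lemma precd_inner:
  assumes "precd \<A> \<B>" "N \<in> K" "nicely_dense \<tau> N (univ \<B>)" "down \<tau> N (univ \<B>) = \<B>"
  shows "closed_hull \<tau> N (univ \<A>) \<preceq> N" "nicely_dense \<tau> (closed_hull \<tau> N (univ \<A>)) (univ \<A>)"
    "down \<tau> (closed_hull \<tau> N (univ \<A>)) (univ \<A>) = \<A>" "fn_closed \<tau> N (univ \<A>)" "univ \<A> \<subseteq> univ \<B>"
    "down \<tau> N (univ \<A>) = \<A>"
proof -
  have "precd \<A> (down \<tau> N (univ \<B>))" using assms(1,4) by simp
  note r = precd_rep[OF this assms(2,3)]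
  note h = closed_hull[OF lang structures[OF assms(2)] r(1)]
  show "closed_hull \<tau> N (univ \<A>) \<preceq> N" by (rule r(4))
  show "nicely_dense \<tau> (closed_hull \<tau> N (univ \<A>)) (univ \<A>)" by (rule h(3))
  show "down \<tau> (closed_hull \<tau> N (univ \<A>)) (univ \<A>) = \<A>" 
    unfolding down_def h(4) using r(3) unfolding down_def by (rule sym)
  show "fn_closed \<tau> N (univ \<A>)" "univ \<A> \<subseteq> univ \<B>" by (rule r)+
  show "down \<tau> N (univ \<A>) = \<A>" using r(3) by (rule sym)
qed

lemma precdI:
  assumes "M \<preceq> N" "nicely_dense \<tau> M (univ \<A>)" "nicely_dense \<tau> N (univ \<B>)" "univ \<A> \<subseteq> univ \<B>"
    and "down \<tau> M (univ \<A>) = \<A>" "down \<tau> N (univ \<B>) = \<B>"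
  shows "precd \<A> \<B>"
  using precd_downI'[OF assms(1-4)] assms(5,6) by simp

lemma closed_hull_mono:
  assumes "is_cstructure \<tau> M" "fn_closed \<tau> M A" "fn_closed \<tau> M B" "A \<subseteq> B"
  shows "substructure \<tau> (closed_hull \<tau> M A) (closed_hull \<tau> M B)"
  unfolding closed_hull_def
  by (rule substructure_restr_mono[OF is_cstructureD(1)[OF assms(1)]
      fn_closed_closure[OF assms(1,2)] fn_closed_closure[OF assms(1,3)] closure_of_mono[OF assms(4)]])

text \<open>Transitivity and coherence are read inside one representation of the largest structure,
  where they are the axioms of \<open>K\<close> for closed hulls. Closure under isomorphisms goes
  through copies of representations, and antisymmetry is inherited from substructures.\<close>

lemma Kd_structure_class: "structure_class (plus_lang \<tau>) (is_structure (plus_lang \<tau>)) Kd precd"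
proof
  show "is_structure (plus_lang \<tau>) \<A>" if "\<A> \<in> Kd" for \<A>
    using that is_structure_down nicely_denseD(2) structures unfolding Kd_def by blast
  show "substructure (plus_lang \<tau>) \<A> \<B>" if "precd \<A> \<B>" for \<A> \<B>
    using that by (rule precd_substructure)
  have "precd \<A> \<A>" if A: "\<A> \<in> Kd" for \<A>
    by (rule precdI[OF prec_refl[OF up(1)[OF A]] up(2)[OF A] up(2)[OF A] order_refl up(3)[OF A] up(3)[OF A]])
  moreover have "precd \<A> \<C>" if p: "precd \<A> \<B>" "precd \<B> \<C>" for \<A> \<B> \<C>
  proof -
    note N = up[OF precd_in_Kd(2)[OF p(2)]]
    note B = precd_inner[OF p(2) N]
    note A = precd_inner[OF p(1) prec_in_K(1)[OF B(1)] B(2,3)]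
    show ?thesis
      by (rule precdI[OF prec_trans[OF A(1) B(1)] A(2) N(2) order_trans[OF A(5) B(5)] A(3) N(3)])
  qed
  moreover have "\<A> = \<B>" if "precd \<A> \<B>" "precd \<B> \<A>" for \<A> \<B>
    using substructure_antisym precd_substructure that by blast
  ultimately show "partial_order_on Kd {(\<A>, \<B>). precd \<A> \<B>}"
    unfolding partial_order_on_def preorder_on_def refl_on_def trans_def antisym_def
    using precd_in_Kd by blast
  show "\<B> \<in> Kd" if "\<A> \<in> Kd" "is_structure (plus_lang \<tau>) \<B>" "isomorphism (plus_lang \<tau>) g \<A> \<B>" for \<A> \<B> g
  proof -
    note M = up[OF that(1)]
    from M(1,2) that(2) show ?thesis
    proof (rule copy_of_isomorphic_down)
      show "isomorphism (plus_lang \<tau>) g (down \<tau> (up \<A>) (univ \<A>)) \<B>" using that(3) M(3) by simp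
      show "\<B> \<in> Kd" if "N \<in> K" "nicely_dense \<tau> N (g ` univ \<A>)" "\<B> = down \<tau> N (g ` univ \<A>)" for N
        using that down_in_Kd by simp
    qed
  qed
  show "precd \<A>' \<B>'" if p: "precd \<A> \<B>" and s: "is_structure (plus_lang \<tau>) \<A>'" "is_structure (plus_lang \<tau>) \<B>'"
    and f: "isomorphism (plus_lang \<tau>) f \<A> \<A>'" "isomorphism (plus_lang \<tau>) f \<B> \<B>'" for \<A> \<B> \<A>' \<B>' f
  proof -
    note N = up[OF precd_in_Kd(2)[OF p]]
    let ?N = "up \<B>" and ?M = "closed_hull \<tau> (up \<B>) (univ \<A>)"
    note A = precd_inner[OF p N]
    have fB: "isomorphism (plus_lang \<tau>) f (down \<tau> ?N (univ \<B>)) \<B>'" using f(2) N(3) by simp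
    have fA: "isomorphism (plus_lang \<tau>) f (down \<tau> ?M (univ \<A>)) \<A>'" using f(1) A(3) by simp
    obtain N' g where N': "N' \<in> K" "isomorphism \<tau> g ?N N'" "\<And>a. a \<in> univ \<B> \<Longrightarrow> g a = f a"
      "nicely_dense \<tau> N' (f ` univ \<B>)" "\<B>' = down \<tau> N' (f ` univ \<B>)"
      by (rule copy_of_isomorphic_down[OF N(1,2) s(2) fB]) blast
    note cN = structures[OF N(1)] and cN' = structures[OF N'(1)] and cM = structures[OF prec_in_K(1)[OF A(1)]]
    have M: "?M = restr \<tau> ?N (univ ?M)" "fn_closed \<tau> ?N (univ ?M)"
      using prec_substructure[OF A(1)] by (rule substructureD)+
    \<comment> \<open>\<open>prec_iso_closed\<close> asks for one map on both structures, so the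
      smaller one is moved by the same \<open>g\<close> that copies the larger one.\<close>
    define M' where "M' = restr \<tau> N' (g ` univ ?M)"
    have i: "isomorphism \<tau> g ?M M'"
      using isomorphism_restr(1)[OF N'(2) M(2)] unfolding M'_def M(1)[symmetric] .
    have "is_structure \<tau> M'"
      unfolding M'_def by (rule is_structure_restr[OF is_cstructureD(1)[OF cN'] isomorphism_restr(2)[OF N'(2) M(2)]])
    then have cM': "is_cstructure \<tau> M'" by (rule is_cstructure_isomorphic[OF lang cM i])
    have M'N': "M' \<preceq> N'" by (rule prec_iso_closed[OF A(1) cM' cN' i N'(2)])
    have "g a = f a" if "a \<in> univ \<A>" for a using N'(3) A(5) that by blast
    note d = down_image[OF cM cM' i A(2) this fA s(1)]
    have u: "univ \<A>' = f ` univ \<A>" "univ \<B>' = f ` univ \<B>"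
      using isomorphismD(3)[OF f(1)] isomorphismD(3)[OF f(2)] by simp_all
    show ?thesis
      by (rule precdI[OF M'N']) (use d N'(4,5) A(5) u in auto)
  qed
  show "precd \<A> \<B>" if p: "precd \<A> \<C>" "precd \<B> \<C>" and s: "substructure (plus_lang \<tau>) \<A> \<B>" for \<A> \<B> \<C>
  proof -
    note N = up[OF precd_in_Kd(2)[OF p(1)]]
    note A = precd_inner[OF p(1) N] and B = precd_inner[OF p(2) N]
    have sub: "univ \<A> \<subseteq> univ \<B>" by (rule substructureD(3)[OF s])
    have "closed_hull \<tau> (up \<C>) (univ \<A>) \<preceq> closed_hull \<tau> (up \<C>) (univ \<B>)"
      by (rule coherence[OF A(1) B(1) closed_hull_mono[OF structures[OF N(1)] A(4) B(4) sub]])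
    then show ?thesis by (rule precdI[OF _ A(2) B(2) sub A(3) B(3)])
  qed
qed

end

section \<open>Unions of chains in the encoded class\<close>

lemma dense_in_superset:
  assumes "is_cstructure \<tau> N" "dense_in \<tau> N U" "U \<subseteq> V" "V \<subseteq> univ N"
  shows "dense_in \<tau> N V"
  using assms closure_of_mono[OF assms(3), of "stop \<tau> N"] closure_of_subset_univ[OF assms(1), of V]
  unfolding dense_in_def by auto

lemma chain_index_linear:
  assumes "chain_index r" "i \<in> Field r" "j \<in> Field r"
  shows "(i, j) \<in> r \<or> (j, i) \<in> r"
  using assms unfolding chain_index_def well_order_on_def linear_order_on_def partial_order_on_def
    preorder_on_def refl_on_def total_on_def by metis

lemma chain_index_directed:
  assumes "chain_index r" "\<And>i j. (i, j) \<in> r \<Longrightarrow> A i \<subseteq> A j" "i \<in> Field r" "j \<in> Field r"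
  shows "\<exists>k\<in>Field r. A i \<union> A j \<subseteq> A k"
  using chain_index_linear[OF assms(1,3,4)] assms(2)[of i j] assms(2)[of j i] assms(3,4) by blast

lemma chain_union_down:
  assumes P: "is_cstructure \<tau> P" and A: "\<And>i. i \<in> I \<Longrightarrow> fn_closed \<tau> P (univ (\<A> i))"
    and eq: "\<And>i. i \<in> I \<Longrightarrow> down \<tau> P (univ (\<A> i)) = \<A> i"
    and U: "fn_closed \<tau> P (\<Union>i\<in>I. univ (\<A> i))"
  shows "chain_union (plus_lang \<tau>) I \<A> (down \<tau> P (\<Union>i\<in>I. univ (\<A> i)))"
  unfolding chain_union_def
proof (intro conjI ballI)
  let ?U = "\<Union>i\<in>I. univ (\<A> i)"
  show "is_structure (plus_lang \<tau>) (down \<tau> P ?U)" by (rule is_structure_down[OF P U])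
  show "univ (down \<tau> P ?U) = ?U" by simp
  fix i assume i: "i \<in> I"
  have "substructure (plus_lang \<tau>) (down \<tau> P (univ (\<A> i))) (down \<tau> P ?U)"
    unfolding substructure_down_iff[OF P A[OF i] P U]
    by (rule substructure_restr_mono[OF is_cstructureD(1)[OF P] A[OF i] U]) (use i in blast)
  then show "substructure (plus_lang \<tau>) (\<A> i) (down \<tau> P ?U)" by (simp add: eq[OF i])
qed

context dense_MAEC
begin

text \<open>The abstract completion lives in a space of real functions. Each of its points is the
  limit of a sequence from \<open>U\<close>, so by \<open>universe\<close> it has fewer points than
  \<open>'v\<close>, and the inverse of the embedding of \<open>U\<close> extends to an injection of
  it into \<open>'v\<close>.\<close>

lemma completion_exists:
  fixes U :: "'v set"
  assumes D: "Metric_space U D" and U: "small U"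
  obtains X E where "U \<subseteq> X" "small X" "Metric_space X E" "Metric_space.mcomplete X E"
    "\<And>x y. x \<in> U \<Longrightarrow> y \<in> U \<Longrightarrow> E x y = D x y"
proof -
  interpret D: Metric_space U D by (rule D)
  obtain f :: "'v \<Rightarrow> 'v \<Rightarrow> real" and m' where m': "mcomplete_of m'" "f \<in> U \<rightarrow> mspace m'"
    "mtopology_of m' closure_of f ` U = mspace m'"
    "\<And>x y. x \<in> U \<Longrightarrow> y \<in> U \<Longrightarrow> mdist m' (f x) (f y) = D x y"
    by (rule D.metric_completion) blast
  interpret Y: Metric_space "mspace m'" "mdist m'" by simp
  have top: "mtopology_of m' = Y.mtopology" by (simp add: mtopology_of_def)
  have inj: "inj_on f U"
  proof (rule inj_onI)
    fix x y assume "x \<in> U" "y \<in> U" "f x = f y"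
    then have "D x y = 0" using m'(4)[of x y] funcset_mem[OF m'(2)] by simp
    then show "x = y" using \<open>x \<in> U\<close> \<open>y \<in> U\<close> by simp
  qed
  \<comment> \<open>Limits in a metric space are unique, so this is a function of sequences; its
    values cover the completion.\<close>
  let ?lim = "\<lambda>s. THE l. limitin Y.mtopology (f \<circ> s) l sequentially"
  have "mspace m' \<subseteq> ?lim ` {s. range s \<subseteq> U}"
  proof
    fix y assume "y \<in> mspace m'"
    then have "y \<in> Y.mtopology closure_of f ` U" using m'(3) top by simp
    then obtain \<sigma> where \<sigma>: "range \<sigma> \<subseteq> f ` U" "limitin Y.mtopology \<sigma> y sequentially"
      unfolding Y.closure_of_sequentially by auto
    define s where "s n = inv_into U f (\<sigma> n)" for n :: nat
    have s: "s n \<in> U" "f (s n) = \<sigma> n" for n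
    proof -
      have "\<sigma> n \<in> f ` U" using \<sigma>(1) by blast
      then show "s n \<in> U" "f (s n) = \<sigma> n" unfolding s_def by (simp_all add: inv_into_into f_inv_into_f)
    qed
    then have "f \<circ> s = \<sigma>" by auto
    then have "y = ?lim s"
      using \<sigma>(2) by (auto intro!: the_equality[symmetric] Y.limitin_metric_unique)
    then show "y \<in> ?lim ` {s. range s \<subseteq> U}" using s(1) by blast
  qed
  then have "|mspace m'| \<le>o |{s :: nat \<Rightarrow> 'v. range s \<subseteq> U}|" by (rule surj_imp_ordLeq)
  then have card: "|mspace m'| <o |UNIV :: 'v set|" using universe[OF U] by (rule ordLeq_ordLess_trans)
  have inv: "inj_on (inv_into U f) (f ` U)" by (rule inj_on_inv_into) simp
  have fU: "f ` U \<subseteq> mspace m'" using m'(2) by blast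
  \<comment> \<open>\<open>h\<close> undoes \<open>f\<close> on the image of \<open>U\<close>, so
    that \<open>U\<close> becomes a literal subset of \<open>X\<close>.\<close>
  obtain h where h: "inj_on h (mspace m')" "\<And>y. y \<in> f ` U \<Longrightarrow> h y = inv_into U f y"
    using inv fU card by (rule extend_inj_on) blast
  define X where "X = h ` mspace m'"
  define k where "k = inv_into (mspace m') h"
  define E where "E x y = (if x \<in> X \<and> y \<in> X then mdist m' (k x) (k y) else 0)" for x y
  have hf: "h (f u) = u" if "u \<in> U" for u using h(2)[of "f u"] that inj by simp
  have k: "k x \<in> mspace m'" "h (k x) = x" if "x \<in> X" for x
    using that unfolding X_def k_def by (simp_all add: inv_into_into f_inv_into_f)
  have kh: "k (h y) = y" if "y \<in> mspace m'" for y using that h(1) unfolding k_def by simp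
  have UX: "U \<subseteq> X"
  proof
    fix u assume u: "u \<in> U"
    then show "u \<in> X" using hf[OF u] fU unfolding X_def by (metis image_eqI image_subset_iff)
  qed
  have "small X" unfolding small_def X_def using card_of_image card by (rule ordLeq_ordLess_trans)
  moreover have X: "Metric_space X E"
  proof
    show "0 \<le> E x y" "E x y = E y x" for x y unfolding E_def by (auto simp: Y.commute)
    show "E x y = 0 \<longleftrightarrow> x = y" if "x \<in> X" "y \<in> X" for x y
    proof -
      have "E x y = 0 \<longleftrightarrow> k x = k y" using that k(1)[OF that(1)] k(1)[OF that(2)] by (simp add: E_def)
      also have "\<dots> \<longleftrightarrow> x = y" using k(2)[OF that(1)] k(2)[OF that(2)] by metis
      finally show ?thesis .
    qed
    show "E x z \<le> E x y + E y z" if "x \<in> X" "y \<in> X" "z \<in> X" for x y z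
      using that Y.triangle[OF k(1)[OF that(1)] k(1)[OF that(2)] k(1)[OF that(3)]] by (simp add: E_def)
  qed
  moreover have "Metric_space.mcomplete X E"
  proof -
    have kX: "k ` X = mspace m'" using k(1) kh unfolding X_def by force
    have "Metric_space.mcomplete X E \<longleftrightarrow> closedin Y.mtopology (k ` X)"
    proof (rule isometry_complete_iff[OF X Y.Metric_space_axioms])
      show "k ` X \<subseteq> mspace m'" by (simp add: kX)
      show "mdist m' (k x) (k y) = E x y" if "x \<in> X" "y \<in> X" for x y using that by (simp add: E_def)
      show "Y.mcomplete" using m'(1) by (simp add: mcomplete_of_def)
    qed
    then show ?thesis by (simp add: kX)
  qed
  moreover have "E x y = D x y" if "x \<in> U" "y \<in> U" for x y
  proof -
    have "k x = f x" "k y = f y"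
      using kh[of "f x"] kh[of "f y"] that funcset_mem[OF m'(2)] hf by simp_all
    moreover have "x \<in> X" "y \<in> X" using that UX by blast+
    ultimately show ?thesis using m'(4)[OF that] by (simp add: E_def)
  qed
  ultimately show thesis by (rule that[OF UX]) blast
qed

text \<open>At a limit \<open>j\<close> the discrete union is all of \<open>univ (\<A> j)\<close>,
  which is dense in \<open>M j\<close>; the union of the earlier \<open>univ (M i)\<close> lies
  between that set and \<open>univ (M j)\<close>, hence is dense too.\<close>

lemma maec_chain_lift:
  assumes \<A>: "aec_chain (plus_lang \<tau>) precd r \<A>"
    and M: "\<And>i. i \<in> Field r \<Longrightarrow> nicely_dense \<tau> (M i) (univ (\<A> i))"
    and prec: "\<And>i j. (i, j) \<in> r \<Longrightarrow> M i \<preceq> M j"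
  shows "maec_chain \<tau> (\<preceq>) r M"
  unfolding maec_chain_def
proof (intro conjI)
  show "chain_index r" using \<A> unfolding aec_chain_def by blast
  show "\<forall>(i, j)\<in>r. M i \<preceq> M j" using prec by blast
  show "\<forall>j. limit_in r j \<longrightarrow> chain_completion \<tau> (underS r j) M (M j)"
  proof (intro allI impI)
    fix j assume j: "limit_in r j"
    then have jF: "j \<in> Field r" and "chain_union (plus_lang \<tau>) (underS r j) \<A> (\<A> j)"
      using \<A> unfolding aec_chain_def limit_in_def by blast+
    then have U: "univ (\<A> j) = (\<Union>i\<in>underS r j. univ (\<A> i))" unfolding chain_union_def by blast
    have ij: "(i, j) \<in> r" if "i \<in> underS r j" for i using that unfolding underS_def by blast
    have "(j, j) \<in> r" using \<A> jF chain_index_linear[of r j j] unfolding aec_chain_def by blast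
    then have cj: "is_cstructure \<tau> (M j)" using prec prec_in_K structures by blast
    show "chain_completion \<tau> (underS r j) M (M j)"
      unfolding chain_completion_def
    proof (intro conjI ballI)
      show "is_cstructure \<tau> (M j)" by (rule cj)
      show s: "substructure \<tau> (M i) (M j)" if "i \<in> underS r j" for i
        using prec_substructure[OF prec[OF ij[OF that]]] .
      show "dense_in \<tau> (M j) (\<Union>i\<in>underS r j. univ (M i))"
      proof (rule dense_in_superset[OF cj nicely_denseD(1)[OF cj M[OF jF]]])
        show "univ (\<A> j) \<subseteq> (\<Union>i\<in>underS r j. univ (M i))"
          unfolding U
        proof (rule UN_mono[OF order_refl])
          fix i assume "i \<in> underS r j"
          note ij = ij[OF this]
          then have "i \<in> Field r" by (rule FieldI1)
          then show "univ (\<A> i) \<subseteq> univ (M i)"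
            using nicely_denseD(3)[OF structures[OF prec_in_K(1)[OF prec[OF ij]]] M] by blast
        qed
        show "(\<Union>i\<in>underS r j. univ (M i)) \<subseteq> univ (M j)" using s substructureD(3) by blast
      qed
    qed
  qed
qed

lemma aec_chain_mono:
  assumes "aec_chain (plus_lang \<tau>) precd r \<A>" "(i, j) \<in> r"
  shows "univ (\<A> i) \<subseteq> univ (\<A> j)"
  using assms precd_substructure substructureD(3) unfolding aec_chain_def by blast

text \<open>A representation of \<open>\<P>\<close> contains all completions involved: the closed
  hulls of the members form a chain by coherence, and the closed hull of the union of the dense sets
  completes it, so smoothness of \<open>K\<close> applies.\<close>

lemma Kd_smoothness:
  assumes \<A>: "aec_chain (plus_lang \<tau>) precd r \<A>" and \<N>: "chain_union (plus_lang \<tau>) (Field r) \<A> \<N>"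
    and \<P>: "\<P> \<in> Kd" and p: "\<And>i. i \<in> Field r \<Longrightarrow> precd (\<A> i) \<P>"
  shows "precd \<N> \<P>"
proof -
  note P = up[OF \<P>] and cP = structures[OF up(1)[OF \<P>]]
  let ?P = "up \<P>"
  note inner = precd_inner[OF p P]
  have r: "chain_index r" "Field r \<noteq> {}" using \<A> unfolding aec_chain_def chain_index_def by blast+
  note mono = aec_chain_mono[OF \<A>]
  define U where "U = (\<Union>i\<in>Field r. univ (\<A> i))"
  define M where "M i = closed_hull \<tau> ?P (univ (\<A> i))" for i
  have U: "fn_closed \<tau> ?P U"
    unfolding U_def by (rule fn_closed_Union[OF inner(4) r(2) chain_index_directed[OF r(1) mono]])
  note N = closed_hull[OF lang cP U]
  let ?N = "closed_hull \<tau> ?P U"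
  have sub: "univ (\<A> i) \<subseteq> U" if "i \<in> Field r" for i using that unfolding U_def by blast
  have prec: "M i \<preceq> M j" if "(i, j) \<in> r" for i j
  proof -
    have ij: "i \<in> Field r" "j \<in> Field r" using that by (auto intro: FieldI1 FieldI2)
    show ?thesis
      unfolding M_def
      by (rule coherence[OF inner(1)[OF ij(1)] inner(1)[OF ij(2)]
            closed_hull_mono[OF cP inner(4)[OF ij(1)] inner(4)[OF ij(2)] mono[OF that]]])
  qed
  have "nicely_dense \<tau> (M i) (univ (\<A> i))" if "i \<in> Field r" for i
    unfolding M_def by (rule inner(2)[OF that])
  then have chain: "maec_chain \<tau> (\<preceq>) r M" using prec by (rule maec_chain_lift[OF \<A>])
  have sN: "substructure \<tau> (M i) ?N" if "i \<in> Field r" for i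
    unfolding M_def by (rule closed_hull_mono[OF cP inner(4)[OF that] U sub[OF that]])
  have "dense_in \<tau> ?N (\<Union>i\<in>Field r. univ (M i))"
  proof (rule dense_in_superset[OF N(2) nicely_denseD(1)[OF N(2,3)]])
    show "U \<subseteq> (\<Union>i\<in>Field r. univ (M i))"
      unfolding U_def
    proof (rule UN_mono[OF order_refl])
      show "univ (\<A> i) \<subseteq> univ (M i)" if "i \<in> Field r" for i
        unfolding M_def
        by (rule nicely_denseD(3)[OF structures[OF prec_in_K(1)[OF inner(1)[OF that]]] inner(2)[OF that]])
    qed
    show "(\<Union>i\<in>Field r. univ (M i)) \<subseteq> univ ?N" using sN substructureD(3) by blast
  qed
  then have "chain_completion \<tau> (Field r) M ?N" using N(2) sN unfolding chain_completion_def by blast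
  moreover have "M i \<preceq> ?P" if "i \<in> Field r" for i unfolding M_def by (rule inner(1)[OF that])
  ultimately have NP: "?N \<preceq> ?P"
    using smoothness[OF chain P(1), of ?N] N(1) by blast
  have "chain_union (plus_lang \<tau>) (Field r) \<A> (down \<tau> ?P U)"
    unfolding U_def by (rule chain_union_down[OF cP inner(4) inner(6) U[unfolded U_def]])
  then have eq: "\<N> = down \<tau> ?P U"
    using chain_union_unique[OF \<N> _ r(2) chain_index_directed[OF r(1) mono]] by blast
  then have u: "univ \<N> = U" by simp
  have "down \<tau> ?N U = \<N>" using N(4) eq unfolding down_def by simp
  moreover have "U \<subseteq> univ \<P>" unfolding U_def using inner(5) by blast
  ultimately show ?thesis
    using precdI[OF NP, of \<N> \<P>] N(3) P(2,3) unfolding u by blast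
qed

text \<open>The identity of \<open>A\<close> extends to an isomorphism of \<open>M\<close> onto
  \<open>N\<close>. As maps into the common space \<open>X\<close>, it and the inclusion are
  isometries agreeing on the dense set \<open>A\<close>, so the isomorphism is the identity. Sharing
  \<open>X\<close> upgrades isomorphism over \<open>A\<close> to equality.\<close>

lemma cstructure_eq_if_dense_agree:
  assumes M: "is_cstructure \<tau> M" and N: "is_cstructure \<tau> N"
    and A: "nicely_dense \<tau> M A" "nicely_dense \<tau> N A" "restr \<tau> M A = restr \<tau> N A"
    and X: "Metric_space X E" "univ M \<subseteq> X" "univ N \<subseteq> X"
    and EM: "\<And>x y. x \<in> univ M \<Longrightarrow> y \<in> univ M \<Longrightarrow> sdist \<tau> M x y = E x y"
    and EN: "\<And>x y. x \<in> univ N \<Longrightarrow> y \<in> univ N \<Longrightarrow> sdist \<tau> N x y = E x y"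
  shows "M = N"
proof -
  interpret M: Metric_space "univ M" "sdist \<tau> M" by (rule is_cstructureD(3)[OF M])
  interpret X: Metric_space X E by (rule X(1))
  have "isomorphism \<tau> id (restr \<tau> M A) (restr \<tau> N A)" using A(3) isomorphism_refl by metis
  then obtain g where g: "isomorphism \<tau> g M N" "\<And>a. a \<in> A \<Longrightarrow> g a = id a"
    by (rule isomorphism_extends[OF lang M N A(1,2)]) blast
  have gN: "g x \<in> univ N" if "x \<in> univ M" for x using isomorphismD(3)[OF g(1)] that by blast
  have gd: "E (g x) (g y) = sdist \<tau> M x y" if "x \<in> univ M" "y \<in> univ M" for x y
    using sdist_eq[OF lang, of g M N x y] g(1) that EN gN unfolding isomorphism_iff_embeds by simp
  have cont: "continuous_map M.mtopology X.mtopology h"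
    if "h ` univ M \<subseteq> X" "\<And>x y. x \<in> univ M \<Longrightarrow> y \<in> univ M \<Longrightarrow> E (h x) (h y) = sdist \<tau> M x y" for h
    unfolding M.metric_continuous_map[OF X.Metric_space_axioms] using that by auto
  have "continuous_map M.mtopology X.mtopology g" by (rule cont) (use gd gN X(3) in auto)
  moreover have "continuous_map M.mtopology X.mtopology id" by (rule cont) (use EM X(2) in auto)
  ultimately have eq: "g x = id x" if "x \<in> univ M" for x
    using forall_in_closure_of_eq[OF _ X.Hausdorff_space_mtopology, of x M.mtopology A g id] g(2) that
      nicely_denseD(1)[OF M A(1)] unfolding dense_in_def stop_def by blast
  then have "isomorphism \<tau> id M N"
    using isomorphism_cong[of M g id \<tau> N] is_cstructureD(1)[OF M] g(1) by blast
  then show ?thesis by (rule isomorphism_id_imp_eq[OF is_cstructureD(1)[OF M] is_cstructureD(1)[OF N]])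
qed

text \<open>The representations \<open>up (\<A> i)\<close> are unrelated outside their dense sets.
  Those fit together to one metric space \<open>U\<close>, whose completion \<open>X\<close>
  receives every representation isometrically over its dense set. \<open>X\<close> carries just a
  metric; the symbols travel with the individual copies.\<close>

lemma common_completion:
  assumes \<A>: "aec_chain (plus_lang \<tau>) precd r \<A>" and small: "small (\<Union>i\<in>Field r. univ (\<A> i))"
  obtains X M where "small X" "\<And>i. i \<in> Field r \<Longrightarrow> univ (M i) \<subseteq> X"
    "\<And>i. i \<in> Field r \<Longrightarrow> nicely_dense \<tau> (M i) (univ (\<A> i))"
    "\<And>i. i \<in> Field r \<Longrightarrow> down \<tau> (M i) (univ (\<A> i)) = \<A> i"
    "\<And>i j. (i, j) \<in> r \<Longrightarrow> M i \<preceq> M j"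
proof -
  define A where "A i = univ (\<A> i)" for i
  define U where "U = (\<Union>i\<in>Field r. A i)"
  have r: "chain_index r" using \<A> unfolding aec_chain_def by blast
  have mono: "A i \<subseteq> A j" if "(i, j) \<in> r" for i j unfolding A_def by (rule aec_chain_mono[OF \<A> that])
  note dir = chain_index_directed[where A = A, OF r mono]
  have rr: "(i, i) \<in> r" if "i \<in> Field r" for i using chain_index_linear[OF r that that] by blast
  have p: "precd (\<A> i) (\<A> j)" if "(i, j) \<in> r" for i j using \<A> that unfolding aec_chain_def by blast
  have Kd: "\<A> i \<in> Kd" if "i \<in> Field r" for i using precd_in_Kd(1)[OF p[OF rr[OF that]]] .
  define R where "R i = up (\<A> i)" for i
  have R: "R i \<in> K" "nicely_dense \<tau> (R i) (A i)" "down \<tau> (R i) (A i) = \<A> i" if "i \<in> Field r" for i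
    unfolding R_def A_def by (rule up[OF Kd[OF that]])+
  note cR = structures[OF R(1)]
  have AR: "A i \<subseteq> univ (R i)" if "i \<in> Field r" for i by (rule nicely_denseD(3)[OF cR[OF that] R(2)[OF that]])
  \<comment> \<open>Along the chain the encodings are substructures of each other, so the decoded
    distances agree.\<close>
  have dist: "sdist \<tau> (R i) x y = sdist \<tau> (R j) x y" if ij: "(i, j) \<in> r" and xy: "x \<in> A i" "y \<in> A i" for i j x y
  proof -
    have F: "i \<in> Field r" "j \<in> Field r" using ij by (auto intro: FieldI1 FieldI2)
    note cl = nicely_denseD(2)[OF cR[OF F(1)] R(2)[OF F(1)]] nicely_denseD(2)[OF cR[OF F(2)] R(2)[OF F(2)]]
    have "substructure (plus_lang \<tau>) (down \<tau> (R i) (A i)) (down \<tau> (R j) (A j))"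
      unfolding R(3)[OF F(1)] R(3)[OF F(2)] by (rule precd_substructure[OF p[OF ij]])
    then have s: "substructure \<tau> (restr \<tau> (R i) (A i)) (restr \<tau> (R j) (A j))"
      using substructure_down_iff[OF cR[OF F(1)] cl(1) cR[OF F(2)] cl(2)] by blast
    have t: "[x, y] \<in> tuples (rarity \<tau> (dsym \<tau>)) (A i)" "[x, y] \<in> tuples (rarity \<tau> (dsym \<tau>)) (A j)" "dsym \<tau> \<in> rsyms \<tau>"
      using lang xy mono[OF ij] unfolding continuous_lang_def by (auto simp: tuples_def)
    then have "rl (R i) (dsym \<tau>) [x, y] = rl (R j) (dsym \<tau>) [x, y]"
      using substructureD(5)[OF s t(3), of "[x, y]"] by simp
    then show ?thesis
      unfolding sdist_def using xy mono[OF ij] AR[OF F(1)] AR[OF F(2)] by (simp add: subset_iff)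
  qed
  \<comment> \<open>Any index whose dense set contains both points serves; the chain is linear, so
    by \<open>dist\<close> the choice does not matter.\<close>
  define D where "D x y = (if x \<in> U \<and> y \<in> U then
      sdist \<tau> (R (SOME i. i \<in> Field r \<and> x \<in> A i \<and> y \<in> A i)) x y else 0)" for x y
  have D: "D x y = sdist \<tau> (R i) x y" if i: "i \<in> Field r" and xy: "x \<in> A i" "y \<in> A i" for i x y
  proof -
    define j where "j = (SOME i. i \<in> Field r \<and> x \<in> A i \<and> y \<in> A i)"
    have j: "j \<in> Field r \<and> x \<in> A j \<and> y \<in> A j"
      unfolding j_def by (rule someI[of _ i]) (use i xy in blast)
    have "sdist \<tau> (R j) x y = sdist \<tau> (R i) x y"
      using chain_index_linear[OF r i] j dist[of i j x y] dist[of j i x y] xy by fastforce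
    moreover have "x \<in> U" "y \<in> U" using i xy unfolding U_def by blast+
    ultimately show ?thesis unfolding D_def j_def by simp
  qed
  \<comment> \<open>Three points because of the triangle inequality; for pairs one point is
    repeated.\<close>
  have common: "\<exists>i\<in>Field r. x \<in> A i \<and> y \<in> A i \<and> z \<in> A i" if "x \<in> U" "y \<in> U" "z \<in> U" for x y z
  proof -
    have "Field r \<noteq> {}" using that unfolding U_def by blast
    then have "\<exists>i\<in>Field r. [x, y, z] \<in> tuples 3 (A i)"
      using directed_tuple[where A = A and xs = "[x, y, z]" and n = 3, OF dir] that unfolding U_def
      by (auto simp: tuples_def)
    then show ?thesis by (auto simp: tuples_def)
  qed
  have Rm: "Metric_space (univ (R i)) (sdist \<tau> (R i))" if "i \<in> Field r" for i
    by (rule is_cstructureD(3)[OF cR[OF that]])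
  have DM: "Metric_space U D"
  proof
    show "0 \<le> D x y" for x y
      using Metric_space.nonneg[OF Rm] common[of x y y] D unfolding D_def by fastforce
    show "D x y = D y x" for x y
    proof (cases "x \<in> U \<and> y \<in> U")
      case True
      then obtain i where "i \<in> Field r" "x \<in> A i" "y \<in> A i" using common[of x y y] by blast
      then show ?thesis using D Metric_space.commute[OF Rm] by metis
    qed (auto simp: D_def)
    show "D x y = 0 \<longleftrightarrow> x = y" if xy: "x \<in> U" "y \<in> U" for x y
    proof -
      obtain i where i: "i \<in> Field r" "x \<in> A i" "y \<in> A i" using common[of x y y] xy by blast
      then have "x \<in> univ (R i)" "y \<in> univ (R i)" using AR[OF i(1)] by blast+
      then show ?thesis unfolding D[OF i] by (rule Metric_space.zero[OF Rm[OF i(1)]])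
    qed
    show "D x z \<le> D x y + D y z" if xyz: "x \<in> U" "y \<in> U" "z \<in> U" for x y z
    proof -
      obtain i where i: "i \<in> Field r" "x \<in> A i" "y \<in> A i" "z \<in> A i" using common xyz by blast
      then show ?thesis
        using D[OF i(1)] Metric_space.triangle[OF Rm[OF i(1)], of x y z] AR[OF i(1)] by (simp add: subset_iff)
    qed
  qed
  have "small U" using small unfolding U_def A_def .
  then obtain X E where X: "U \<subseteq> X" "small X" "Metric_space X E" "Metric_space.mcomplete X E"
    "\<And>x y. x \<in> U \<Longrightarrow> y \<in> U \<Longrightarrow> E x y = D x y"
    by (rule completion_exists[OF DM]) blast
  interpret X: Metric_space X E by (rule X(3))
  \<comment> \<open>Completeness of \<open>X\<close> extends the inclusion of \<open>A i\<close> to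
    an isometry of the whole representation.\<close>
  have "\<forall>i\<in>Field r. \<exists>h. h ` univ (R i) \<subseteq> X \<and> (\<forall>a\<in>A i. h a = a) \<and>
      (\<forall>x\<in>univ (R i). \<forall>y\<in>univ (R i). E (h x) (h y) = sdist \<tau> (R i) x y)"
  proof
    fix i assume i: "i \<in> Field r"
    have AU: "A i \<subseteq> U" using i unfolding U_def by blast
    obtain h where "h ` univ (R i) \<subseteq> X" "\<And>a. a \<in> A i \<Longrightarrow> h a = id a"
      "\<And>x y. x \<in> univ (R i) \<Longrightarrow> y \<in> univ (R i) \<Longrightarrow> E (h x) (h y) = sdist \<tau> (R i) x y"
    proof (rule isometry_extends_to_closure[OF Rm[OF i] X(3,4) AR[OF i], where f = id])
      show "Metric_space.mtopology (univ (R i)) (sdist \<tau> (R i)) closure_of A i = univ (R i)"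
        using nicely_denseD(1)[OF cR[OF i] R(2)[OF i]] unfolding dense_in_def stop_def by blast
      show "id ` A i \<subseteq> X" using AU X(1) by simp
      show "E (id x) (id y) = sdist \<tau> (R i) x y" if "x \<in> A i" "y \<in> A i" for x y
        using that AU X(5) D[OF i that] by (simp add: subset_iff)
    qed blast
    then show "\<exists>h. h ` univ (R i) \<subseteq> X \<and> (\<forall>a\<in>A i. h a = a) \<and>
      (\<forall>x\<in>univ (R i). \<forall>y\<in>univ (R i). E (h x) (h y) = sdist \<tau> (R i) x y)"
      by (intro exI[of _ h]) simp
  qed
  then obtain h where h: "\<forall>i\<in>Field r. h i ` univ (R i) \<subseteq> X \<and> (\<forall>a\<in>A i. h i a = a) \<and>
      (\<forall>x\<in>univ (R i). \<forall>y\<in>univ (R i). E (h i x) (h i y) = sdist \<tau> (R i) x y)"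
    by (rule bchoice[THEN exE])
  have inj: "inj_on (h i) (univ (R i))" if i: "i \<in> Field r" for i
  proof (rule inj_onI)
    fix x y assume xy: "x \<in> univ (R i)" "y \<in> univ (R i)" "h i x = h i y"
    then have "h i y \<in> X" using h i by blast
    then have "sdist \<tau> (R i) x y = 0" using h i xy X.mdist_zero by metis
    then show "x = y" using Metric_space.zero[OF Rm[OF i] xy(1,2)] by blast
  qed
  define M where "M i = image_struct \<tau> (h i) (R i)" for i
  have M: "M i \<in> K" "isomorphism \<tau> (h i) (R i) (M i)" if "i \<in> Field r" for i
    unfolding M_def by (rule K_copy[OF R(1)[OF that] inj[OF that]])+
  note cM = structures[OF M(1)]
  have MX: "univ (M i) \<subseteq> X" if "i \<in> Field r" for i using h that unfolding M_def by simp
  have ME: "sdist \<tau> (M i) x y = E x y" if i: "i \<in> Field r" and xy: "x \<in> univ (M i)" "y \<in> univ (M i)" for i x y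
  proof -
    obtain u v where uv: "u \<in> univ (R i)" "v \<in> univ (R i)" "x = h i u" "y = h i v"
      using xy isomorphismD(3)[OF M(2)[OF i]] by blast
    then have "sdist \<tau> (M i) x y = sdist \<tau> (R i) u v"
      using sdist_eq[OF lang, of "h i" "R i" "M i" u v] M(2)[OF i] unfolding isomorphism_iff_embeds by simp
    then show ?thesis using h i uv by simp
  qed
  have Md: "nicely_dense \<tau> (M i) (A i)" "down \<tau> (M i) (A i) = \<A> i" if i: "i \<in> Field r" for i
  proof -
    have "isomorphism (plus_lang \<tau>) id (down \<tau> (R i) (A i)) (\<A> i)"
      using isomorphism_refl R(3)[OF i] by metis
    note d = down_image[OF cR[OF i] cM[OF i] M(2)[OF i] R(2)[OF i] _ this]
    have "is_structure (plus_lang \<tau>) (\<A> i)"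
      using is_structure_down[OF cR[OF i] nicely_denseD(2)[OF cR[OF i] R(2)[OF i]]] R(3)[OF i] by simp
    then show "nicely_dense \<tau> (M i) (A i)" "down \<tau> (M i) (A i) = \<A> i"
      using d h i by simp_all
  qed
  have prec: "M i \<preceq> M j" if ij: "(i, j) \<in> r" for i j
  proof -
    have F: "i \<in> Field r" "j \<in> Field r" using ij by (auto intro: FieldI1 FieldI2)
    let ?N = "closed_hull \<tau> (M j) (A i)"
    note inner = precd_inner[OF p[OF ij] M(1)[OF F(2)] Md[OF F(2), unfolded A_def], folded A_def]
    note N = closed_hull[OF lang cM[OF F(2)] inner(4)]
    \<comment> \<open>Both structures sit in \<open>X\<close> with the metric \<open>E\<close> and
      induce the same encoding, so they are equal and not merely isomorphic; this is what makes the
      copies a chain.\<close>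
    have "M i = ?N"
    proof (rule cstructure_eq_if_dense_agree[OF cM[OF F(1)] N(2) Md(1)[OF F(1)] inner(2) _ X(3) MX[OF F(1)] _ ME[OF F(1)]])
      have "down \<tau> (M i) (A i) = down \<tau> ?N (A i)" using Md(2)[OF F(1)] inner(3) by simp
      then show "restr \<tau> (M i) (A i) = restr \<tau> ?N (A i)"
        using down_eq_iff[OF cM[OF F(1)] nicely_denseD(2)[OF cM[OF F(1)] Md(1)[OF F(1)]]
          N(2) nicely_denseD(2)[OF N(2) inner(2)]] by blast
      have s: "univ ?N \<subseteq> univ (M j)" by (rule substructureD(3)[OF N(1)])
      then show "univ ?N \<subseteq> X" using MX[OF F(2)] by blast
      show "sdist \<tau> ?N x y = E x y" if "x \<in> univ ?N" "y \<in> univ ?N" for x y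
        using sdist_eq[OF lang substructure_embeds[OF N(1)] that] ME[OF F(2), of x y] that s
        by (simp add: subset_iff)
    qed
    then show ?thesis using inner(1) by simp
  qed
  show thesis
    by (rule that[OF X(2), of M]) (use MX Md prec in \<open>simp_all add: A_def\<close>)
qed

text \<open>The chain axiom of \<open>K\<close> applies to the copies inside a common completion,
  whose union is small. The resulting \<open>N\<close> induces the required structure on the union
  of the dense sets.\<close>

lemma Kd_chains:
  assumes \<A>: "aec_chain (plus_lang \<tau>) precd r \<A>" and small: "small (\<Union>i\<in>Field r. univ (\<A> i))"
  shows "\<exists>\<N>\<in>Kd. chain_union (plus_lang \<tau>) (Field r) \<A> \<N> \<and> (\<forall>i\<in>Field r. precd (\<A> i) \<N>)"
proof -
  obtain X M where X: "small X" "\<And>i. i \<in> Field r \<Longrightarrow> univ (M i) \<subseteq> X"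
    and M: "\<And>i. i \<in> Field r \<Longrightarrow> nicely_dense \<tau> (M i) (univ (\<A> i))"
    "\<And>i. i \<in> Field r \<Longrightarrow> down \<tau> (M i) (univ (\<A> i)) = \<A> i"
    and prec: "\<And>i j. (i, j) \<in> r \<Longrightarrow> M i \<preceq> M j"
    using \<A> small by (rule common_completion) blast
  have r: "chain_index r" "Field r \<noteq> {}" using \<A> unfolding aec_chain_def chain_index_def by blast+
  note mono = aec_chain_mono[OF \<A>]
  have chain: "maec_chain \<tau> (\<preceq>) r M" by (rule maec_chain_lift[OF \<A> M(1) prec])
  have "(\<Union>i\<in>Field r. univ (M i)) \<subseteq> X" using X(2) by blast
  with X(1) have "small (\<Union>i\<in>Field r. univ (M i))" by (rule small_subset)
  from chains[OF chain this] obtain N where N: "N \<in> K" "chain_completion \<tau> (Field r) M N"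
    "\<And>i. i \<in> Field r \<Longrightarrow> M i \<preceq> N" by blast
  note cN = structures[OF N(1)]
  let ?U = "\<Union>i\<in>Field r. univ (\<A> i)"
  note s = prec_substructure[OF N(3)] and cM = structures[OF prec_in_K(1)[OF N(3)]]
  have hull: "M i = closed_hull \<tau> N (univ (\<A> i))" if "i \<in> Field r" for i
    by (rule dense_substructure_eq_hull[OF lang cN cM[OF that] s[OF that] nicely_denseD(1)[OF cM[OF that] M(1)[OF that]]])
  have cl: "fn_closed \<tau> N (univ (\<A> i))" "down \<tau> N (univ (\<A> i)) = \<A> i" if i: "i \<in> Field r" for i
  proof -
    have rN: "restr \<tau> N (univ (\<A> i)) = restr \<tau> (M i) (univ (\<A> i))"
      using restr_restr[OF nicely_denseD(3)[OF cM[OF i] M(1)[OF i]], of \<tau> N] substructureD(7)[OF s[OF i]] by simp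
    show "fn_closed \<tau> N (univ (\<A> i))"
      using fn_closed_of_restr[of \<tau> N "univ (M i)"] nicely_denseD(2)[OF cM[OF i] M(1)[OF i]]
        substructureD(3,7)[OF s[OF i]] by simp
    show "down \<tau> N (univ (\<A> i)) = \<A> i" using M(2)[OF i] rN unfolding down_def by simp
  qed
  have U: "fn_closed \<tau> N ?U"
    by (rule fn_closed_Union[OF cl(1) r(2) chain_index_directed[OF r(1) mono]])
  \<comment> \<open>Density in two stages: each \<open>M i\<close> lies in the closure of its own
    dense set, and the union of the \<open>M i\<close> is dense in \<open>N\<close>.\<close>
  have "univ (M i) \<subseteq> stop \<tau> N closure_of ?U" if "i \<in> Field r" for i
  proof -
    have "univ (\<A> i) \<subseteq> ?U" using that by blast
    then have "stop \<tau> N closure_of univ (\<A> i) \<subseteq> stop \<tau> N closure_of ?U" by (rule closure_of_mono)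
    then show ?thesis using hull[OF that] by (metis univ_closed_hull)
  qed
  then have "(\<Union>i\<in>Field r. univ (M i)) \<subseteq> stop \<tau> N closure_of ?U" by blast
  then have "stop \<tau> N closure_of (\<Union>i\<in>Field r. univ (M i)) \<subseteq> stop \<tau> N closure_of ?U"
    by (rule closure_of_minimal) simp
  moreover have "stop \<tau> N closure_of (\<Union>i\<in>Field r. univ (M i)) = univ N"
    using N(2) unfolding chain_completion_def dense_in_def by blast
  ultimately have "dense_in \<tau> N ?U"
    using U closure_of_subset_univ[OF cN, of ?U] unfolding dense_in_def fn_closed_def by blast
  then have nd: "nicely_dense \<tau> N ?U" using U nicely_dense_iff[OF cN] by blast
  show ?thesis
  proof (intro bexI[of _ "down \<tau> N ?U"] conjI ballI)
    show "chain_union (plus_lang \<tau>) (Field r) \<A> (down \<tau> N ?U)" by (rule chain_union_down[OF cN cl U])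
    show "down \<tau> N ?U \<in> Kd" by (rule down_in_Kd[OF N(1) nd])
    fix i assume i: "i \<in> Field r"
    have "precd (down \<tau> N (univ (\<A> i))) (down \<tau> N ?U)"
      by (rule precd_downI[OF N(1) nd cl(1)[OF i]]) (use i N(3)[OF i] hull[OF i] in auto)
    then show "precd (\<A> i) (down \<tau> N ?U)" by (simp add: cl(2)[OF i])
  qed
qed

end

section \<open>Loewenheim--Skolem numbers\<close>

lemma Cinfinite_nat: "Cinfinite l \<Longrightarrow> |UNIV :: nat set| \<le>o l"
  using ordIso_ordLeq_trans[OF card_of_nat natLeq_ordLeq_cinfinite] .

text \<open>By induction on \<open>n\<close>, since an infinite cardinal absorbs finite
  products.\<close>

lemma card_tuples:
  assumes l: "Cinfinite l" and A: "|A| \<le>o l"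
  shows "|tuples n A| \<le>o l"
proof (induction n)
  case 0
  have "tuples 0 A = {[]}" by (auto simp: tuples_def)
  moreover have "Field l \<noteq> {}" using l unfolding cinfinite_def by auto
  ultimately show ?case using Card_order_singl_ordLeq l by metis
next
  case (Suc n)
  have "tuples (Suc n) A \<subseteq> case_prod Cons ` (A \<times> tuples n A)"
  proof
    fix xs assume "xs \<in> tuples (Suc n) A"
    then obtain y ys where "xs = y # ys" "y \<in> A" "ys \<in> tuples n A"
      by (cases xs) (auto simp: tuples_def)
    then show "xs \<in> case_prod Cons ` (A \<times> tuples n A)" by force
  qed
  then have "|tuples (Suc n) A| \<le>o |A \<times> tuples n A|" by (rule surj_imp_ordLeq)
  also have "|A \<times> tuples n A| \<le>o l"
    using card_of_Times_ordLeq_infinite_Field A Suc l unfolding cinfinite_def by blast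
  finally show ?case .
qed

text \<open>Each relation symbol gives rise to countably many cut symbols, and an infinite cardinal
  absorbs that factor.\<close>

lemma plus_lang_card_iff:
  assumes l: "Cinfinite l"
  shows "|fsyms (plus_lang \<tau>) <+> rsyms (plus_lang \<tau>)| \<le>o l \<longleftrightarrow> |fsyms \<tau> <+> rsyms \<tau>| \<le>o l"
proof
  assume p: "|fsyms (plus_lang \<tau>) <+> rsyms (plus_lang \<tau>)| \<le>o l"
  \<comment> \<open>One cut per relation symbol is enough to inject the old language into the new
    one; the cut at 0 is taken.\<close>
  have "0 \<in> Q01" by (simp add: Q01_def)
  then have "|fsyms \<tau> <+> rsyms \<tau>| \<le>o |fsyms (plus_lang \<tau>) <+> rsyms (plus_lang \<tau>)|"
    by (intro card_of_ordLeqI[of "map_sum Plus (\<lambda>R. Geq R 0)"]) (auto simp: inj_on_def)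
  then show "|fsyms \<tau> <+> rsyms \<tau>| \<le>o l" using p by (rule ordLeq_transitive)
next
  assume p: "|fsyms \<tau> <+> rsyms \<tau>| \<le>o l"
  have f: "|fsyms \<tau>| \<le>o l" by (rule ordLeq_transitive[OF card_of_Plus1 p])
  have r: "|rsyms \<tau>| \<le>o l" by (rule ordLeq_transitive[OF card_of_Plus2 p])
  have "|UNIV :: rat set| \<le>o |UNIV :: nat set|"
    by (rule card_of_ordLeqI[of to_nat]) auto
  then have "|UNIV :: rat set| \<le>o l" using Cinfinite_nat[OF l] by (rule ordLeq_transitive)
  then have "|Q01| \<le>o l" using ordLeq_transitive[OF card_of_mono1[OF subset_UNIV]] by blast
  then have t: "|rsyms \<tau> \<times> Q01| \<le>o l"
    using card_of_Times_ordLeq_infinite_Field r l unfolding cinfinite_def by blast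
  have "|fsyms (plus_lang \<tau>)| \<le>o l"
    using ordLeq_transitive[OF card_of_image f] by (simp add: plus_lang_def)
  moreover have "|rsyms (plus_lang \<tau>)| \<le>o l"
    using Un_Cinfinite_bound[OF ordLeq_transitive[OF card_of_image t] ordLeq_transitive[OF card_of_image t] l]
    by (simp add: plus_lang_def)
  ultimately show "|fsyms (plus_lang \<tau>) <+> rsyms (plus_lang \<tau>)| \<le>o l"
    using card_of_Plus_ordLeq_infinite_Field l unfolding cinfinite_def by blast
qed

text \<open>Cardinals are well-ordered, so the minimum that \<open>dc\<close> selects by choice does
  exist.\<close>

lemma dc:
  assumes "is_cstructure \<tau> M"
  shows "\<exists>D. dense_in \<tau> M D \<and> dc \<tau> M = |D|" "dense_in \<tau> M B \<Longrightarrow> dc \<tau> M \<le>o |B|"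
proof -
  let ?R = "{|B| | B. dense_in \<tau> M B}"
  have "dense_in \<tau> M (univ M)"
    using nicely_dense_univ[OF assms] unfolding nicely_dense_def by blast
  then have "?R \<noteq> {}" by blast
  moreover have "\<forall>r\<in>?R. Well_order r" using card_of_Well_order by blast
  ultimately have "\<exists>r\<in>?R. \<forall>r'\<in>?R. r \<le>o r'" by (rule exists_minim_Well_order)
  then have "\<exists>D. dense_in \<tau> M D \<and> (\<forall>B. dense_in \<tau> M B \<longrightarrow> |D| \<le>o |B| )" by blast
  note some = someI_ex[OF this]
  show "\<exists>D. dense_in \<tau> M D \<and> dc \<tau> M = |D|" using some unfolding dc_def by blast
  show "dc \<tau> M \<le>o |B|" if "dense_in \<tau> M B" using some that unfolding dc_def by blast
qed

text \<open>A copy of the order type omega on elements of \<open>'v\<close>. It has no limit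
  elements, so chains indexed by it satisfy the continuity condition vacuously.\<close>

lemma omega_chain_index:
  fixes e :: "nat \<Rightarrow> 'v"
  assumes e: "inj e" and card: "|UNIV :: nat set| <o |UNIV :: 'v set|"
  defines "r \<equiv> {(e m, e n) | m n. m \<le> n}"
  shows "chain_index r" "Field r = range e" "\<not> limit_in r j"
proof -
  have iff: "(e m, e n) \<in> r \<longleftrightarrow> m \<le> n" for m n using injD[OF e] unfolding r_def by blast
  show F: "Field r = range e" unfolding r_def Field_def by auto
  have "wf (inv_image {(m :: nat, n). m < n} (inv e))" using wf by (rule wf_inv_image)
  moreover have "r - Id \<subseteq> inv_image {(m :: nat, n). m < n} (inv e)"
    using e by (auto simp: r_def inv_image_def less_le)
  ultimately have "wf (r - Id)" by (rule wf_subset)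
  moreover have "linear_order_on (Field r) r"
    unfolding linear_order_on_def partial_order_on_def preorder_on_def
  proof (intro conjI)
    show "r \<subseteq> Field r \<times> Field r" by (auto simp: Field_def)
    show "refl_on (Field r) r" unfolding F refl_on_def using iff by auto
    show "trans r" using injD[OF e] unfolding r_def trans_def by (auto) (metis order_trans)
    show "antisym r" using injD[OF e] unfolding r_def antisym_def by (auto) (metis order_antisym)
    show "total_on (Field r) r" unfolding F total_on_def using iff nle_le by auto
  qed
  ultimately have "Well_order r" unfolding well_order_on_def by blast
  moreover have "small (Field r)"
    unfolding F small_def using card_of_image card by (rule ordLeq_ordLess_trans)
  ultimately show "chain_index r" unfolding chain_index_def F by blast
  have under: "e m \<in> underS r (e n) \<longleftrightarrow> m < n" for m n
    using iff injD[OF e] unfolding underS_def by (auto simp: less_le)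
  have underE: "\<exists>m. x = e m" if "x \<in> underS r y" for x y
    using that F unfolding underS_def by (auto dest: FieldI1)
  show "\<not> limit_in r j"
  proof
    assume j: "limit_in r j"
    then obtain n where n: "j = e n" unfolding limit_in_def F by blast
    from j obtain x where "x \<in> underS r j" unfolding limit_in_def by blast
    then have "0 < n" using underE under n by fastforce
    \<comment> \<open>Nothing lies strictly between \<open>e (n - 1)\<close> and \<open>e n\<close>,
      against the limit property.\<close>
    then have "e (n - 1) \<in> underS r j" using under n by simp
    then obtain y where y: "y \<in> underS r j" "e (n - 1) \<in> underS r y" using j unfolding limit_in_def by blast
    then obtain k where "y = e k" using underE by blast
    then show False using y under n by auto
  qed
qed

context dense_MAEC
begin

text \<open>One round of an alternation: a strong substructure of density at most \<open>l\<close>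
  is taken around \<open>S\<close>, each point of a small dense subset of it is approximated by a
  sequence from \<open>B\<close>, and the function values on \<open>S \<inter> B\<close> are added.
  Countably many new points per old point stay within the bound \<open>l\<close>.\<close>

lemma LS_step:
  assumes b: "LS_bound (dc \<tau>) \<tau> K (\<preceq>) \<kappa>" and M: "M \<in> K" and B: "nicely_dense \<tau> M B"
    and l: "Cinfinite l" "\<kappa> \<le>o l" and S: "S \<subseteq> univ M" "|S| \<le>o l"
  shows "\<exists>S' N. S \<subseteq> S' \<and> S' \<subseteq> univ M \<and> |S'| \<le>o l \<and> N \<preceq> M \<and> S \<subseteq> univ N \<and>
    univ N \<subseteq> stop \<tau> M closure_of (S' \<inter> B) \<and>
    (\<forall>F\<in>fsyms \<tau>. \<forall>xs\<in>tuples (farity \<tau> F) (S \<inter> B). fn M F xs \<in> S')"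
proof -
  note cM = structures[OF M]
  interpret Mm: Metric_space "univ M" "sdist \<tau> M" by (rule is_cstructureD(3)[OF cM])
  have inf: "infinite (Field l)" "Card_order l" using l(1) unfolding cinfinite_def by blast+
  have "\<exists>N. N \<preceq> M \<and> S \<subseteq> univ N \<and> dc \<tau> N \<le>o |S| +c \<kappa>" and lang_le: "|fsyms \<tau> <+> rsyms \<tau>| \<le>o \<kappa>"
    and \<kappa>: "Card_order \<kappa>"
    using b M S(1) unfolding LS_bound_def by blast+
  then obtain N where N: "N \<preceq> M" "S \<subseteq> univ N" "dc \<tau> N \<le>o |S| +c \<kappa>" by blast
  note cN = structures[OF prec_in_K(1)[OF N(1)]] and sN = prec_substructure[OF N(1)]
  have "|Field \<kappa>| \<le>o l"
    using card_of_Field_ordIso[OF \<kappa>] l(2) by (rule ordIso_ordLeq_trans)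
  then have "|S| +c \<kappa> \<le>o l"
    unfolding csum_def Field_card_of by (rule card_of_Plus_ordLeq_infinite_Field[OF inf(1) S(2) _ inf(2)])
  with N(3) have dcN: "dc \<tau> N \<le>o l" by (rule ordLeq_transitive)
  obtain D where D: "dense_in \<tau> N D" "dc \<tau> N = |D|" using dc(1)[OF cN] by blast
  have DN: "D \<subseteq> univ N" "univ N = stop \<tau> M closure_of D"
    using D(1) closure_of_substructure[OF lang cM cN sN, of D] unfolding dense_in_def by auto
  have "\<exists>s. range s \<subseteq> B \<and> limitin (stop \<tau> M) s x sequentially" if "x \<in> D" for x
  proof -
    have "x \<in> Mm.mtopology closure_of B"
      using that DN(1) substructureD(3)[OF sN] nicely_denseD(1)[OF cM B] unfolding dense_in_def stop_def by blast
    then show ?thesis unfolding Mm.closure_of_sequentially stop_def by blast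
  qed
  then obtain s :: "'v \<Rightarrow> nat \<Rightarrow> 'v" where s: "\<And>x. x \<in> D \<Longrightarrow> range (s x) \<subseteq> B"
    "\<And>x. x \<in> D \<Longrightarrow> limitin (stop \<tau> M) (s x) x sequentially" by metis
  define E where "E = (\<Union>x\<in>D. range (s x))"
  define V where "V = (\<Union>F\<in>fsyms \<tau>. fn M F ` tuples (farity \<tau> F) (S \<inter> B))"
  have EB: "E \<subseteq> B" using s(1) unfolding E_def by blast
  have BM: "B \<subseteq> univ M" by (rule nicely_denseD(3)[OF cM B])
  have VM: "V \<subseteq> univ M"
    using is_structureD(3)[OF is_cstructureD(1)[OF cM]] tuples_mono[of "S \<inter> B" "univ M"] S(1)
    unfolding V_def by blast
  have "|range (s x)| \<le>o l" for x using card_of_image Cinfinite_nat[OF l(1)] by (rule ordLeq_transitive)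
  then have E: "|E| \<le>o l"
    unfolding E_def using D(2) dcN UNION_Cinfinite_bound[OF _ _ l(1), of D] by metis
  have "|S \<inter> B| \<le>o l" using card_of_mono1[of "S \<inter> B" S] S(2) ordLeq_transitive by blast
  then have img: "|fn M F ` tuples (farity \<tau> F) (S \<inter> B)| \<le>o l" for F
    using card_tuples[OF l(1)] card_of_image ordLeq_transitive by blast
  have fs: "|fsyms \<tau>| \<le>o l"
    by (rule ordLeq_transitive[OF card_of_Plus1 ordLeq_transitive[OF lang_le l(2)]])
  have V: "|V| \<le>o l" unfolding V_def by (intro UNION_Cinfinite_bound ballI fs img l(1))
  have "D \<subseteq> stop \<tau> M closure_of E"
  proof
    fix x assume x: "x \<in> D"
    have "range (s x) \<subseteq> E \<inter> univ M" using s(1)[OF x] BM x unfolding E_def by blast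
    moreover have "x \<in> univ M" using x DN(1) substructureD(3)[OF sN] by blast
    ultimately show "x \<in> stop \<tau> M closure_of E"
      using s(2)[OF x] unfolding stop_def Mm.closure_of_sequentially by blast
  qed
  also have "\<dots> \<subseteq> stop \<tau> M closure_of ((S \<union> E \<union> V) \<inter> B)"
    by (rule closure_of_mono) (use EB in blast)
  finally have "stop \<tau> M closure_of D \<subseteq> stop \<tau> M closure_of ((S \<union> E \<union> V) \<inter> B)"
    by (rule closure_of_minimal) simp
  moreover have "|S \<union> E \<union> V| \<le>o l" by (intro Un_Cinfinite_bound S(2) E V l(1))
  moreover have "S \<union> E \<union> V \<subseteq> univ M" using S(1) EB BM VM by blast
  moreover have "\<forall>F\<in>fsyms \<tau>. \<forall>xs\<in>tuples (farity \<tau> F) (S \<inter> B). fn M F xs \<in> S \<union> E \<union> V"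
    unfolding V_def by blast
  ultimately show ?thesis using N(1,2) DN(2) by (intro exI[of _ "S \<union> E \<union> V"] exI[of _ N]) auto
qed

text \<open>A strong substructure of density \<open>\<lambda>\<close> need not meet the given dense set densely, so one
  alternates between strong substructures and their approximations in the dense set; the union of
  the resulting \<open>\<omega>\<close>-chain is dense in a strong substructure by smoothness.\<close>

lemma LS_dense:
  assumes b: "LS_bound (dc \<tau>) \<tau> K (\<preceq>) \<kappa>" and M: "M \<in> K" and B: "nicely_dense \<tau> M B" and AB: "A \<subseteq> B"
  obtains C where "A \<subseteq> C" "C \<subseteq> B" "fn_closed \<tau> M C" "closed_hull \<tau> M C \<preceq> M" "|C| \<le>o |A| +c \<kappa>"
proof -
  note cM = structures[OF M]
  define l where "l = |A| +c \<kappa>"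
  have \<kappa>: "Cinfinite \<kappa>" "\<kappa> <o |UNIV :: 'v set|" using b unfolding LS_bound_def by blast+
  have l: "Cinfinite l" "\<kappa> \<le>o l" unfolding l_def using \<kappa>(1) Cinfinite_csum ordLeq_csum2 by blast+
  have Al: "|A| \<le>o l" unfolding l_def by (rule ordLeq_csum1[OF card_of_Card_order])
  have BM: "B \<subseteq> univ M" by (rule nicely_denseD(3)[OF cM B])
  define good where "good S \<longleftrightarrow> S \<subseteq> univ M \<and> |S| \<le>o l" for S
  define step where "step S S' N \<longleftrightarrow> S \<subseteq> S' \<and> good S' \<and> N \<preceq> M \<and> S \<subseteq> univ N \<and>
    univ N \<subseteq> stop \<tau> M closure_of (S' \<inter> B) \<and>
    (\<forall>F\<in>fsyms \<tau>. \<forall>xs\<in>tuples (farity \<tau> F) (S \<inter> B). fn M F xs \<in> S')" for S S' N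
  have "\<exists>S' N. step S S' N" if "good S" for S
    using LS_step[OF b M B l, of S] that unfolding good_def step_def by blast
  then have "\<exists>p. good S \<longrightarrow> step S (fst p) (snd p)" for S by force
  then obtain p where p: "good S \<Longrightarrow> step S (fst (p S)) (snd (p S))" for S by metis
  define S where "S n = ((\<lambda>S. fst (p S)) ^^ n) A" for n
  define N where "N n = snd (p (S n))" for n
  have good: "good (S n)" for n
  proof (induction n)
    case 0 show ?case using AB BM Al unfolding S_def good_def by auto
  next
    case (Suc n) then show ?case using p[of "S n"] unfolding S_def step_def by simp
  qed
  have step: "step (S n) (S (Suc n)) (N n)" for n
    using p[OF good[of n]] unfolding N_def S_def by simp
  note stepD = step[unfolded step_def]
  have NM: "N n \<preceq> M" "S n \<subseteq> univ (N n)" "univ (N n) \<subseteq> stop \<tau> M closure_of (S (Suc n) \<inter> B)" for n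
    using stepD by blast+
  note cN = structures[OF prec_in_K(1)[OF NM(1)]] and sN = prec_substructure[OF NM(1)]
  have S_mono: "S m \<subseteq> S n" if "m \<le> n" for m n
    by (rule lift_Suc_mono_le[OF _ that]) (use stepD in blast)
  have closed: "stop \<tau> M closure_of X \<subseteq> univ (N n)" if "X \<subseteq> univ (N n)" for X n
    using that substructure_is_cstructure_iff[OF lang cM sN] cN by (intro closure_of_minimal) blast+
  \<comment> \<open>\<open>N (Suc n)\<close> is closed in \<open>M\<close> and contains
    \<open>S (Suc n)\<close>, and the closure of \<open>S (Suc n) \<inter> B\<close> contains all of
    \<open>N n\<close>.\<close>
  have N_Suc: "univ (N n) \<subseteq> univ (N (Suc n))" for n
    using NM(3)[of n] closed[of "S (Suc n) \<inter> B" "Suc n"] NM(2)[of "Suc n"] by blast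
  have N_mono: "univ (N m) \<subseteq> univ (N n)" if "m \<le> n" for m n
    by (rule lift_Suc_mono_le[where f = "\<lambda>n. univ (N n)", OF N_Suc that])
  have N_prec: "N m \<preceq> N n" if "m \<le> n" for m n
  proof (rule coherence[OF NM(1) NM(1)])
    show "substructure \<tau> (N m) (N n)"
      using substructure_restr_mono[OF is_cstructureD(1)[OF cM] substructureD(6)[OF sN] substructureD(6)[OF sN] N_mono[OF that]]
        substructureD(7)[OF sN] by metis
  qed
  define C where "C = (\<Union>n. S n \<inter> B)"
  have AC: "A \<subseteq> C" using AB unfolding C_def S_def by (force intro!: exI[of _ "0 :: nat"])
  have CB: "C \<subseteq> B" unfolding C_def by blast
  have C: "fn_closed \<tau> M C"
    unfolding fn_closed_def
  proof (intro conjI ballI)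
    \<comment> \<open>\<open>A\<close> may be empty, so a point of \<open>C\<close> is drawn from
      \<open>N 0\<close>: its nonempty universe lies in the closure of
      \<open>S (Suc 0) \<inter> B\<close>.\<close>
    have "univ (N 0) \<noteq> {}" using is_structureD(1)[OF is_cstructureD(1)[OF cN]] .
    then have "S (Suc 0) \<inter> B \<noteq> {}" using NM(3)[of 0] by auto
    then show "C \<noteq> {}" unfolding C_def by blast
    show "C \<subseteq> univ M" using CB BM by blast
    fix F xs assume F: "F \<in> fsyms \<tau>" "xs \<in> tuples (farity \<tau> F) C"
    have "\<exists>n\<in>UNIV. xs \<in> tuples (farity \<tau> F) (S n \<inter> B)"
    proof (rule directed_tuple[where A = "\<lambda>n. S n \<inter> B"])
      show "\<exists>k\<in>UNIV. (S i \<inter> B) \<union> (S j \<inter> B) \<subseteq> S k \<inter> B" for i j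
        using S_mono[of i "max i j"] S_mono[of j "max i j"] by (intro bexI[of _ "max i j"]) auto
    qed (use F(2) in \<open>simp_all add: C_def\<close>)
    then obtain n where n: "xs \<in> tuples (farity \<tau> F) (S n \<inter> B)" by blast
    then have "fn M F xs \<in> S (Suc n)" using stepD F(1) by blast
    moreover have "fn M F xs \<in> B"
      using n tuples_mono[of "S n \<inter> B" B] nicely_denseD(2)[OF cM B] F(1) unfolding fn_closed_def by blast
    ultimately show "fn M F xs \<in> C" unfolding C_def by blast
  qed
  note hull = closed_hull[OF lang cM C]
  let ?H = "closed_hull \<tau> M C"
  have NH: "univ (N n) \<subseteq> univ ?H" for n
  proof -
    have "stop \<tau> M closure_of (S (Suc n) \<inter> B) \<subseteq> stop \<tau> M closure_of C"
      by (rule closure_of_mono) (auto simp: C_def)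
    then show ?thesis using NM(3)[of n] by simp
  qed
  have sNH: "substructure \<tau> (N n) ?H" for n
    using substructure_restr_mono[OF is_cstructureD(1)[OF cM] substructureD(6)[OF sN] substructureD(6)[OF hull(1)] NH]
      substructureD(7)[OF sN] substructureD(7)[OF hull(1)] by metis
  obtain e :: "nat \<Rightarrow> 'v" where e: "inj e" using infinite_countable_subset[OF infinite_universe] by blast
  have "|UNIV :: nat set| <o |UNIV :: 'v set|" by (rule ordLeq_ordLess_trans[OF Cinfinite_nat[OF \<kappa>(1)] \<kappa>(2)])
  note r = omega_chain_index[OF e this]
  let ?r = "{(e m, e n) | m n. m \<le> n}"
  have chain: "maec_chain \<tau> (\<preceq>) ?r (N \<circ> inv e)"
    unfolding maec_chain_def using r(1,3) N_prec by (auto simp: inv_f_f[OF e])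
  have completion: "chain_completion \<tau> (Field ?r) (N \<circ> inv e) ?H"
    unfolding chain_completion_def
  proof (intro conjI ballI)
    show "is_cstructure \<tau> ?H" by (rule hull(2))
    show "substructure \<tau> ((N \<circ> inv e) i) ?H" for i using sNH by simp
    have eq: "(\<Union>i\<in>Field ?r. univ ((N \<circ> inv e) i)) = (\<Union>n. univ (N n))"
      unfolding r(2) by (simp add: inv_f_f[OF e] image_image)
    \<comment> \<open>The universes of the \<open>N n\<close> lie in the closure of
      \<open>C\<close>, and their union contains \<open>C\<close>, so that union is dense in the
      hull.\<close>
    show "dense_in \<tau> ?H (\<Union>i\<in>Field ?r. univ ((N \<circ> inv e) i))"
      unfolding eq
    proof (rule dense_in_superset[OF hull(2) nicely_denseD(1)[OF hull(2,3)]])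
      show "C \<subseteq> (\<Union>n. univ (N n))" using NM(2) unfolding C_def by blast
      show "(\<Union>n. univ (N n)) \<subseteq> univ ?H" using NH by blast
    qed
  qed
  have "?H \<preceq> M"
    by (rule smoothness[OF chain M _ completion hull(1)]) (simp add: NM(1))
  moreover have "|C| \<le>o |A| +c \<kappa>"
  proof -
    have "|S n \<inter> B| \<le>o l" for n
      using card_of_mono1[of "S n \<inter> B" "S n"] good[of n] ordLeq_transitive unfolding good_def by blast
    then show ?thesis
      unfolding C_def l_def[symmetric] by (intro UNION_Cinfinite_bound ballI Cinfinite_nat l(1))
  qed
  ultimately show thesis using that AC CB C by blast
qed

text \<open>From left to right, the discrete property is applied to \<open>M\<close> with its whole
  universe as dense set, and the size of a set bounds the density character of its closed hull. From
  right to left, \<open>LS_dense\<close> yields a strong hull of a small subset of the given dense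
  set.\<close>

lemma LS_bound_Kd_iff:
  "LS_bound card_univ (plus_lang \<tau>) Kd precd \<mu> \<longleftrightarrow> LS_bound (dc \<tau>) \<tau> K (\<preceq>) \<mu>"
proof
  assume b: "LS_bound card_univ (plus_lang \<tau>) Kd precd \<mu>"
  then have \<mu>: "Cinfinite \<mu>" "\<mu> <o |UNIV :: 'v set|" "|fsyms \<tau> <+> rsyms \<tau>| \<le>o \<mu>"
    using plus_lang_card_iff unfolding LS_bound_def by blast+
  have "\<exists>N. N \<preceq> M \<and> A \<subseteq> univ N \<and> dc \<tau> N \<le>o |A| +c \<mu>" if M: "M \<in> K" and A: "A \<subseteq> univ M" for M A
  proof -
    note cM = structures[OF M]
    note nd = nicely_dense_univ[OF cM]
    let ?M = "down \<tau> M (univ M)"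
    have "?M \<in> Kd" "A \<subseteq> univ ?M" using down_in_Kd[OF M nd] A by simp_all
    then obtain \<N> where \<N>: "precd \<N> ?M" "A \<subseteq> univ \<N>" "card_univ \<N> \<le>o |A| +c \<mu>"
      using b unfolding LS_bound_def by blast
    note rep = precd_rep[OF \<N>(1) M nd]
    let ?N = "closed_hull \<tau> M (univ \<N>)"
    note hull = closed_hull[OF lang cM rep(1)]
    note nN = nicely_denseD[OF hull(2,3)]
    have "dc \<tau> ?N \<le>o |univ \<N>|" by (rule dc(2)[OF hull(2) nN(1)])
    then have "dc \<tau> ?N \<le>o |A| +c \<mu>" using \<N>(3) unfolding card_univ_def by (rule ordLeq_transitive)
    then show ?thesis using rep(4) nN(3) \<N>(2) by blast
  qed
  with \<mu> show "LS_bound (dc \<tau>) \<tau> K (\<preceq>) \<mu>" unfolding LS_bound_def by blast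
next
  assume b: "LS_bound (dc \<tau>) \<tau> K (\<preceq>) \<mu>"
  then have \<mu>: "Cinfinite \<mu>" "\<mu> <o |UNIV :: 'v set|" "|fsyms (plus_lang \<tau>) <+> rsyms (plus_lang \<tau>)| \<le>o \<mu>"
    using plus_lang_card_iff unfolding LS_bound_def by blast+
  have "\<exists>\<N>. precd \<N> \<M> \<and> A \<subseteq> univ \<N> \<and> card_univ \<N> \<le>o |A| +c \<mu>"
    if \<M>: "\<M> \<in> Kd" and A: "A \<subseteq> univ \<M>" for \<M> A
  proof -
    note M = up[OF \<M>]
    obtain C where C: "A \<subseteq> C" "C \<subseteq> univ \<M>" "fn_closed \<tau> (up \<M>) C" "closed_hull \<tau> (up \<M>) C \<preceq> up \<M>"
      "|C| \<le>o |A| +c \<mu>" by (rule LS_dense[OF b M(1,2) A])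
    have "precd (down \<tau> (up \<M>) C) \<M>"
      using precd_downI[OF M(1,2) C(3,2,4)] M(3) by simp
    then show ?thesis using C(1,5) unfolding card_univ_def by (intro exI[of _ "down \<tau> (up \<M>) C"]) simp
  qed
  with \<mu> show "LS_bound card_univ (plus_lang \<tau>) Kd precd \<mu>" unfolding LS_bound_def by blast
qed

lemma is_LS_Kd: "is_LS card_univ (plus_lang \<tau>) Kd precd = is_LS (dc \<tau>) \<tau> K (\<preceq>)"
  by (simp add: fun_eq_iff is_LS_def LS_bound_Kd_iff)

text \<open>The two predicates that single out the number are equal, so even the chosen cardinals
  coincide. Being a cardinal is recalled because \<open>=o\<close> is reflexive only on
  well-orders.\<close>

lemma LS_Kd: "LS_AEC (plus_lang \<tau>) Kd precd =o LS_MAEC \<tau> K (\<preceq>)"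
proof -
  have "is_LS (dc \<tau>) \<tau> K (\<preceq>) (LS_MAEC \<tau> K (\<preceq>))"
    unfolding LS_MAEC_def using LS by (rule someI_ex)
  then have "Card_order (LS_MAEC \<tau> K (\<preceq>))" unfolding is_LS_def LS_bound_def by blast
  moreover have "LS_AEC (plus_lang \<tau>) Kd precd = LS_MAEC \<tau> K (\<preceq>)"
    unfolding LS_AEC_def LS_MAEC_def is_LS_Kd ..
  ultimately show ?thesis by (simp add: ordIso_refl)
qed

lemma AEC_Kd: "AEC (plus_lang \<tau>) Kd precd"
proof -
  interpret Kd: structure_class "plus_lang \<tau>" "is_structure (plus_lang \<tau>)" Kd precd
    by (rule Kd_structure_class)
  show ?thesis
  proof
    show "\<exists>\<N>\<in>Kd. chain_union (plus_lang \<tau>) (Field r) \<A> \<N> \<and> (\<forall>i\<in>Field r. precd (\<A> i) \<N>)"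
      if "aec_chain (plus_lang \<tau>) precd r \<A>" "small (\<Union>i\<in>Field r. univ (\<A> i))" for r \<A>
      by (rule Kd_chains[OF that])
    show "precd \<N> \<P>" if "aec_chain (plus_lang \<tau>) precd r \<A>" "chain_union (plus_lang \<tau>) (Field r) \<A> \<N>"
      "\<P> \<in> Kd" "\<And>i. i \<in> Field r \<Longrightarrow> precd (\<A> i) \<P>" for r \<A> \<N> \<P>
      by (rule Kd_smoothness[OF that])
    show "\<exists>\<kappa>. is_LS card_univ (plus_lang \<tau>) Kd precd \<kappa>"
      unfolding is_LS_Kd by (rule LS)
  qed
qed

end

section \<open>The correspondence\<close>

text \<open>By density of the rationals \<open>d\<close> is the least upper bound of its lower
  rational cut; 0 always belongs to the cut, so the supremum is over a nonempty set even for
  \<open>d = 0\<close>.\<close>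

lemma Sup_rat_cut:
  fixes d :: real
  assumes "d \<in> {0..1}"
  shows "Sup {of_rat r | r. r \<in> Q01 \<and> of_rat r \<le> d} = d"
proof (rule cSup_eq_non_empty)
  let ?S = "{of_rat r | r. r \<in> Q01 \<and> of_rat r \<le> d} :: real set"
  have "of_rat 0 \<in> ?S" using assms by (intro CollectI exI[of _ 0]) (simp add: Q01_def)
  then have z: "0 \<in> ?S" by simp
  then show "?S \<noteq> {}" by blast
  show "x \<le> d" if "x \<in> ?S" for x using that by blast
  fix y assume y: "\<And>x. x \<in> ?S \<Longrightarrow> x \<le> y"
  show "d \<le> y"
  proof (rule ccontr)
    assume "\<not> d \<le> y"
    then obtain q where q: "y < of_rat q" "of_rat q < d" using of_rat_dense[of y d] by auto
    \<comment> \<open>\<open>y\<close> is nonnegative because it bounds the element 0, and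
      \<open>d\<close> is at most 1, so \<open>q\<close> lies in the unit interval.\<close>
    have "(0 :: real) < of_rat q \<and> of_rat q < (1 :: real)" using y[OF z] q assms unfolding atLeastAtMost_iff by linarith
    then have "q \<in> Q01" by (simp add: Q01_def)
    then have "of_rat q \<in> ?S" using q by auto
    then show False using y q by fastforce
  qed
qed

context dense_MAEC
begin

lemma down_properties:
  shows "F \<in> fsyms \<tau> \<Longrightarrow> a \<in> tuples (farity \<tau> F) A \<Longrightarrow> fn (down \<tau> M A) (Plus F) a = fn M F a"
    "R \<in> rsyms \<tau> \<Longrightarrow> r \<in> Q01 \<Longrightarrow> a \<in> tuples (rarity \<tau> R) A \<Longrightarrow>
      rl (down \<tau> M A) (Geq R r) a \<longleftrightarrow> rl M R a \<ge> of_rat r"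
    "R \<in> rsyms \<tau> \<Longrightarrow> r \<in> Q01 \<Longrightarrow> a \<in> tuples (rarity \<tau> R) A \<Longrightarrow>
      rl (down \<tau> M A) (Leq R r) a \<longleftrightarrow> rl M R a \<le> of_rat r"
  by (simp_all add: down_def)

lemma up_properties:
  assumes "\<A> \<in> Kd" "R \<in> rsyms \<tau>" "r \<in> Q01" "a \<in> tuples (rarity \<tau> R) (univ \<A>)"
  shows "rl (up \<A>) R a \<ge> of_rat r \<longleftrightarrow> rl \<A> (Geq R r) a" "rl (up \<A>) R a \<le> of_rat r \<longleftrightarrow> rl \<A> (Leq R r) a"
  using down_properties(2,3)[OF assms(2-4), of "up \<A>"] up(3)[OF assms(1)] by simp_all

text \<open>The \<open>Geq\<close> relations of the metric symbol form the lower rational cut of the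
  distance in the completion, and the supremum recovers it.\<close>

lemma dense_dist_eq:
  assumes \<A>: "\<A> \<in> Kd" and ab: "a \<in> univ \<A>" "b \<in> univ \<A>"
  shows "dense_dist \<tau> \<A> a b = sdist \<tau> (up \<A>) a b"
proof -
  note M = up[OF \<A>] and cM = structures[OF up(1)[OF \<A>]]
  have AM: "univ \<A> \<subseteq> univ (up \<A>)" by (rule nicely_denseD(3)[OF cM M(2)])
  have t: "[a, b] \<in> tuples (rarity \<tau> (dsym \<tau>)) (univ \<A>)" "dsym \<tau> \<in> rsyms \<tau>"
    using lang ab unfolding continuous_lang_def by (auto simp: tuples_def)
  let ?d = "rl (up \<A>) (dsym \<tau>) [a, b]"
  have "?d \<in> {0..1}"
    using is_cstructureD(2)[OF cM] t tuples_mono[OF AM] unfolding unit_valued_def by blast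
  note cut = Sup_rat_cut[OF this]
  have "rl \<A> (Geq (dsym \<tau>) r) [a, b] \<longleftrightarrow> of_rat r \<le> ?d" if "r \<in> Q01" for r
    using down_properties(2)[OF t(2) that t(1), of "up \<A>"] M(3) by simp
  then have "{of_rat r :: real | r. r \<in> Q01 \<and> rl \<A> (Geq (dsym \<tau>) r) [a, b]}
      = {of_rat r | r. r \<in> Q01 \<and> of_rat r \<le> ?d}" by blast
  then show ?thesis using cut ab AM by (simp add: dense_dist_def sdist_def subset_iff)
qed

lemma up_is_completion:
  assumes \<A>: "\<A> \<in> Kd"
  shows "is_completion (univ \<A>) (dense_dist \<tau> \<A>) (univ (up \<A>)) (sdist \<tau> (up \<A>))"
proof -
  note M = up[OF \<A>] and cM = structures[OF up(1)[OF \<A>]]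
  interpret M: Metric_space "univ (up \<A>)" "sdist \<tau> (up \<A>)" by (rule is_cstructureD(3)[OF cM])
  have AM: "univ \<A> \<subseteq> univ (up \<A>)" by (rule nicely_denseD(3)[OF cM M(2)])
  note eq = dense_dist_eq[OF \<A>]
  have off: "dense_dist \<tau> \<A> a b = 0" if "\<not> (a \<in> univ \<A> \<and> b \<in> univ \<A>)" for a b
    using that unfolding dense_dist_def by (rule if_not_P)
  have "Metric_space (univ \<A>) (dense_dist \<tau> \<A>)"
  proof
    show "0 \<le> dense_dist \<tau> \<A> a b" for a b
      using eq[of a b] off[of a b] by (cases "a \<in> univ \<A> \<and> b \<in> univ \<A>") auto
    show "dense_dist \<tau> \<A> a b = dense_dist \<tau> \<A> b a" for a b
      using eq[of a b] eq[of b a] off[of a b] off[of b a] M.commute[of a b]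
      by (cases "a \<in> univ \<A> \<and> b \<in> univ \<A>") auto
    show "dense_dist \<tau> \<A> a b = 0 \<longleftrightarrow> a = b" if "a \<in> univ \<A>" "b \<in> univ \<A>" for a b
      using eq[OF that] that AM by (simp add: subset_iff)
    show "dense_dist \<tau> \<A> a c \<le> dense_dist \<tau> \<A> a b + dense_dist \<tau> \<A> b c"
      if "a \<in> univ \<A>" "b \<in> univ \<A>" "c \<in> univ \<A>" for a b c
      using eq that AM M.triangle[of a b c] by (simp add: subset_iff)
  qed
  then show ?thesis
    using M.Metric_space_axioms is_cstructureD(4)[OF cM] AM eq nicely_denseD(1)[OF cM M(2)]
    unfolding is_completion_def dense_in_def stop_def by simp
qed

text \<open>\<open>M\<close> and the completion of its encoding share the nicely dense set
  \<open>A\<close> and induce the same structure on it.\<close>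

lemma up_down:
  assumes "M \<in> K" "nicely_dense \<tau> M A"
  shows "\<exists>g. isomorphism \<tau> g M (up (down \<tau> M A)) \<and> (\<forall>a\<in>A. g a = a)"
proof -
  note N = up[OF down_in_Kd[OF assms], unfolded univ_down]
  have "isomorphism (plus_lang \<tau>) id (down \<tau> M A) (down \<tau> (up (down \<tau> M A)) A)"
    unfolding N(3) by (rule isomorphism_refl)
  then obtain g where "isomorphism \<tau> g M (up (down \<tau> M A))" "\<And>a. a \<in> A \<Longrightarrow> g a = id a"
    by (rule isomorphism_of_down[OF _ assms N(1,2)]) blast
  then show ?thesis by (intro exI[of _ g]) simp
qed

text \<open>The image of \<open>M\<^sub>0\<close> is a strong substructure of
  \<open>M\<^sub>1\<close> in which the image of \<open>A\<^sub>0\<close> is nicely dense, so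
  \<open>precd_downI'\<close> applies.\<close>

lemma strong_embedding_down:
  assumes M\<^sub>0: "M\<^sub>0 \<in> K" "nicely_dense \<tau> M\<^sub>0 A\<^sub>0" and M\<^sub>1: "M\<^sub>1 \<in> K" "nicely_dense \<tau> M\<^sub>1 A\<^sub>1"
    and f: "strong_embedding \<tau> (\<preceq>) f M\<^sub>0 M\<^sub>1" "f ` A\<^sub>0 \<subseteq> A\<^sub>1"
  shows "strong_embedding (plus_lang \<tau>) precd (restrict f A\<^sub>0) (down \<tau> M\<^sub>0 A\<^sub>0) (down \<tau> M\<^sub>1 A\<^sub>1)"
proof -
  obtain N where N: "N \<preceq> M\<^sub>1" "isomorphism \<tau> f M\<^sub>0 N" using f(1) unfolding strong_embedding_def by blast
  note c\<^sub>0 = structures[OF M\<^sub>0(1)] and cN = structures[OF prec_in_K(1)[OF N(1)]]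
  note cl = nicely_denseD(2)[OF c\<^sub>0 M\<^sub>0(2)]
  have nd: "nicely_dense \<tau> N (f ` A\<^sub>0)" by (rule isomorphism_nicely_dense[OF lang c\<^sub>0 cN N(2) M\<^sub>0(2)])
  have "isomorphism (plus_lang \<tau>) f (down \<tau> M\<^sub>0 A\<^sub>0) (down \<tau> N (f ` A\<^sub>0))"
    using isomorphism_restr(1)[OF N(2) cl] isomorphism_down_iff[OF c\<^sub>0 cl cN nicely_denseD(2)[OF cN nd]] by blast
  then have "isomorphism (plus_lang \<tau>) (restrict f A\<^sub>0) (down \<tau> M\<^sub>0 A\<^sub>0) (down \<tau> N (f ` A\<^sub>0))"
    using isomorphism_cong[of "down \<tau> M\<^sub>0 A\<^sub>0" f "restrict f A\<^sub>0" "plus_lang \<tau>"] is_structure_down[OF c\<^sub>0 cl] by simp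
  moreover have "precd (down \<tau> N (f ` A\<^sub>0)) (down \<tau> M\<^sub>1 A\<^sub>1)"
    by (rule precd_downI'[OF N(1) nd M\<^sub>1(2) f(2)])
  ultimately show ?thesis unfolding strong_embedding_def by blast
qed

text \<open>The image of \<open>f\<close> is nicely dense in its closed hull in
  \<open>up \<B>\<close>, a strong substructure, and \<open>f\<close> extends to an isomorphism onto
  that hull. Any other continuous extension agrees with it on a dense set and so, by the Hausdorff
  property, everywhere.\<close>

lemma strong_embedding_up:
  assumes \<A>: "\<A> \<in> Kd" and \<B>: "\<B> \<in> Kd" and f: "strong_embedding (plus_lang \<tau>) precd f \<A> \<B>"
  shows "\<exists>g. strong_embedding \<tau> (\<preceq>) g (up \<A>) (up \<B>) \<and>
            (\<forall>a\<in>univ \<A>. g a = f a) \<and>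
            continuous_map (stop \<tau> (up \<A>)) (stop \<tau> (up \<B>)) g \<and>
            (\<forall>h. continuous_map (stop \<tau> (up \<A>)) (stop \<tau> (up \<B>)) h \<and> (\<forall>a\<in>univ \<A>. h a = f a) \<longrightarrow>
              (\<forall>x\<in>univ (up \<A>). h x = g x))"
proof -
  obtain \<N> where \<N>: "precd \<N> \<B>" "isomorphism (plus_lang \<tau>) f \<A> \<N>"
    using f unfolding strong_embedding_def by blast
  note M = up[OF \<A>] and P = up[OF \<B>]
  note cM = structures[OF M(1)] and cP = structures[OF P(1)]
  note Q = precd_inner[OF \<N>(1) P]
  let ?Q = "closed_hull \<tau> (up \<B>) (univ \<N>)"
  have "isomorphism (plus_lang \<tau>) f (down \<tau> (up \<A>) (univ \<A>)) (down \<tau> ?Q (univ \<N>))"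
    unfolding M(3) Q(3) by (rule \<N>(2))
  then obtain g where g: "isomorphism \<tau> g (up \<A>) ?Q" "\<And>a. a \<in> univ \<A> \<Longrightarrow> g a = f a"
    by (rule isomorphism_of_down[OF _ M(1,2) prec_in_K(1)[OF Q(1)] Q(2)]) blast
  have "embeds \<tau> (id \<circ> g) (up \<A>) (up \<B>)"
    using g(1) embeds_comp substructure_embeds[OF prec_substructure[OF Q(1)]]
    unfolding isomorphism_iff_embeds by blast
  then have "embeds \<tau> g (up \<A>) (up \<B>)" by simp
  then have c: "continuous_map (stop \<tau> (up \<A>)) (stop \<tau> (up \<B>)) g"
    by (rule embeds_continuous_map[OF lang cP])
  have unique: "h x = g x" if h: "continuous_map (stop \<tau> (up \<A>)) (stop \<tau> (up \<B>)) h" "\<forall>a\<in>univ \<A>. h a = f a"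
    and x: "x \<in> univ (up \<A>)" for h x
  proof (rule forall_in_closure_of_eq[OF _ Hausdorff_stop[OF cP] h(1) c])
    show "x \<in> stop \<tau> (up \<A>) closure_of (univ \<A>)"
      using x nicely_denseD(1)[OF cM M(2)] unfolding dense_in_def by simp
    show "h a = g a" if "a \<in> univ \<A>" for a using h(2) g(2) that by simp
  qed
  have strong: "strong_embedding \<tau> (\<preceq>) g (up \<A>) (up \<B>)"
    using Q(1) g(1) unfolding strong_embedding_def by blast
  show ?thesis
  proof (rule exI[of _ g], intro conjI ballI allI impI)
    show "h x = g x" if "continuous_map (stop \<tau> (up \<A>)) (stop \<tau> (up \<B>)) h \<and> (\<forall>a\<in>univ \<A>. h a = f a)"
      "x \<in> univ (up \<A>)" for h x using unique that by blast
  qed (rule strong g(2) c; assumption)+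
qed

end

theorem theorem6p1:
  fixes \<tau> :: "('f, 'r) clang"
  assumes lang: "continuous_lang \<tau>"
    and universe: "\<And>A :: 'v set. small A \<Longrightarrow> |{s :: nat \<Rightarrow> 'v. range s \<subseteq> A}| <o |UNIV :: 'v set|"
  shows "\<exists>\<tau>p :: ('f plus_fun, 'r plus_rel) lang.
    contains_dense_symbols \<tau> \<tau>p \<and>
    (\<forall>(K :: ('v, 'f, 'r) cstruct set) prec. MAEC \<tau> K prec \<longrightarrow>
      (\<exists>(Kd :: ('v, 'f plus_fun, 'r plus_rel) dstruct set) precd
        (down :: ('v, 'f, 'r) cstruct \<Rightarrow> 'v set \<Rightarrow> ('v, 'f plus_fun, 'r plus_rel) dstruct)
        (up :: ('v, 'f plus_fun, 'r plus_rel) dstruct \<Rightarrow> ('v, 'f, 'r) cstruct).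
        \<comment> \<open>(i)--(iii)\<close>
        AEC \<tau>p Kd precd \<and> LS_AEC \<tau>p Kd precd =o LS_MAEC \<tau> K prec \<and>
        (\<forall>M\<in>K. \<forall>A. nicely_dense \<tau> M A \<longrightarrow> down M A \<in> Kd) \<and>
        (\<forall>\<A>\<in>Kd. up \<A> \<in> K) \<and>
        \<comment> \<open>(1)\<close>
        (\<forall>M\<in>K. \<forall>A. nicely_dense \<tau> M A \<longrightarrow>
          univ (down M A) = A \<and>
          (\<forall>F\<in>fsyms \<tau>. \<forall>a\<in>tuples (farity \<tau> F) A. fn (down M A) (Plus F) a = fn M F a) \<and>
          (\<forall>R\<in>rsyms \<tau>. \<forall>r\<in>Q01. \<forall>a\<in>tuples (rarity \<tau> R) A.
            (rl (down M A) (Geq R r) a \<longleftrightarrow> rl M R a \<ge> of_rat r) \<and>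
            (rl (down M A) (Leq R r) a \<longleftrightarrow> rl M R a \<le> of_rat r))) \<and>
        \<comment> \<open>(2)\<close>
        (\<forall>\<A>\<in>Kd.
          is_completion (univ \<A>) (dense_dist \<tau> \<A>) (univ (up \<A>)) (sdist \<tau> (up \<A>)) \<and>
          (\<forall>R\<in>rsyms \<tau>. \<forall>r\<in>Q01. \<forall>a\<in>tuples (rarity \<tau> R) (univ \<A>).
            (rl (up \<A>) R a \<ge> of_rat r \<longleftrightarrow> rl \<A> (Geq R r) a) \<and>
            (rl (up \<A>) R a \<le> of_rat r \<longleftrightarrow> rl \<A> (Leq R r) a))) \<and>
        \<comment> \<open>(3)\<close>
        (\<forall>M\<in>K. \<forall>A. nicely_dense \<tau> M A \<longrightarrow>
          (\<exists>g. isomorphism \<tau> g M (up (down M A)) \<and> (\<forall>a\<in>A. g a = a))) \<and>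
        (\<forall>\<A>\<in>Kd. nicely_dense \<tau> (up \<A>) (univ \<A>) \<and> down (up \<A>) (univ \<A>) = \<A>) \<and>
        \<comment> \<open>(4)\<close>
        (\<forall>M\<^sub>0\<in>K. \<forall>M\<^sub>1\<in>K. \<forall>A\<^sub>0 A\<^sub>1 f.
          nicely_dense \<tau> M\<^sub>0 A\<^sub>0 \<and> nicely_dense \<tau> M\<^sub>1 A\<^sub>1 \<and>
          strong_embedding \<tau> prec f M\<^sub>0 M\<^sub>1 \<and> f ` A\<^sub>0 \<subseteq> A\<^sub>1 \<longrightarrow>
          strong_embedding \<tau>p precd (restrict f A\<^sub>0) (down M\<^sub>0 A\<^sub>0) (down M\<^sub>1 A\<^sub>1)) \<and>
        (\<forall>\<A>\<in>Kd. \<forall>\<B>\<in>Kd. \<forall>f. strong_embedding \<tau>p precd f \<A> \<B> \<longrightarrow>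
          (\<exists>g. strong_embedding \<tau> prec g (up \<A>) (up \<B>) \<and>
            (\<forall>a\<in>univ \<A>. g a = f a) \<and>
            continuous_map (stop \<tau> (up \<A>)) (stop \<tau> (up \<B>)) g \<and>
            (\<forall>h. continuous_map (stop \<tau> (up \<A>)) (stop \<tau> (up \<B>)) h \<and> (\<forall>a\<in>univ \<A>. h a = f a) \<longrightarrow>
              (\<forall>x\<in>univ (up \<A>). h x = g x))))))"
proof (rule exI[of _ "plus_lang \<tau>"], intro conjI allI impI, goal_cases)
  case 1
  show ?case by (rule contains_dense_symbols_plus_lang)
next
  \<comment> \<open>The language depends on \<open>\<tau>\<close> alone and is fixed before
    \<open>K\<close>, as the order of the quantifiers demands.\<close>
  case (2 K prec)
  interpret MAEC \<tau> K prec by (rule 2)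
  interpret dense_MAEC \<tau> K prec using lang universe by unfold_locales
  show ?case
    by (intro exI[of _ Kd] exI[of _ precd] exI[of _ "down \<tau>"] exI[of _ up] conjI ballI allI impI;
        (elim conjE)?;
        (rule AEC_Kd LS_Kd down_in_Kd up univ_down down_properties up_is_completion up_properties
          up_down strong_embedding_down strong_embedding_up; assumption))
qed

end
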